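(* Let $R=\mathbb{F}_2[[x,y]]/\bigl(xy(x^{2^np^m}+y^{2^np^m})\bigr)$ with maximal ideal $\mathfrak{m}=(x,y)R$, where $m,n\ge 0$ are integers and $p>3$ is a prime such that $2$ is a primitive root modulo $p^2$. Then $$\mathrm{g}\ell\ell(R)=\mathrm{index}(R)+1=2^np^m+3$$ and $$\mathfrak{m}^{2^np^m+3}\subseteq (x^2+xy+y^2).$$ If $m=1$, the same conclusions hold assuming only that $2$ is a primitive root modulo $p$ (instead of modulo $p^2$).
   Context: The generalized Loewy length $\mathrm{g}\ell\ell(R)$ of the Cohen-Macaulay local ring $(R,\mathfrak{m})$ is the smallest positive integer $n$ for which $\mathfrak{m}^n$ is contained in the ideal generated by some system of parameters of $R$. For a finitely generated $R$-module $M$, Auslander's $\delta$-invariant $\delta_R(M)$ is the smallest non-negative integer $n$ such that there is a surjective $R$-linear map $X\oplus R^n\to M$, where $X$ is a maximal Cohen-Macaulay $R$-module with no free direct summand ($X=0$ is allowed). The index of $R$ is $\mathrm{index}(R)=\inf\{n\ge 1 : \delta_R(R/\mathfrak{m}^n)=1\}$. (Known result of Ding: for a hypersurface ring $R=k[[x_1,\dots,x_n]]/(f)$ with $f\in(x_1,\dots,x_n)^r\setminus(x_1,\dots,x_n)^{r+1}$, the index equals the Hilbert-Samuel multiplicity, $\mathrm{index}(R)=e(R)=r$.) *)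

theory Defs
  imports
    "HOL-Algebra.Module"
    "HOL-Algebra.QuotRing"
    "HOL-Algebra.Ideal_Product"
    "HOL-Computational_Algebra.Formal_Power_Series"
    "HOL-Number_Theory.Residue_Primitive_Roots"
    "HOL-Library.Z2"
    "HOL-Library.Extended_Nat"
begin

section \<open>Modules\<close>

text \<open>
  Modules are the \<^locale>\<open>module\<close>s of HOL-Algebra. Their record type extends that of rings; the
  fields for multiplication and unit play no role and are filled with the most natural value.
\<close>

definition module_hom ::
  "('r, 'c) ring_scheme \<Rightarrow> ('r, 'a, 'd) module_scheme \<Rightarrow> ('r, 'b, 'e) module_scheme \<Rightarrow> ('a \<Rightarrow> 'b) set"
  where "module_hom R M N = {h \<in> carrier M \<rightarrow> carrier N.
    (\<forall>u\<in>carrier M. \<forall>v\<in>carrier M. h (u \<oplus>\<^bsub>M\<^esub> v) = h u \<oplus>\<^bsub>N\<^esub> h v) \<and>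
    (\<forall>r\<in>carrier R. \<forall>u\<in>carrier M. h (r \<odot>\<^bsub>M\<^esub> u) = r \<odot>\<^bsub>N\<^esub> h u)}"

definition free_module :: "('r, 'c) ring_scheme \<Rightarrow> nat \<Rightarrow> ('r, nat \<Rightarrow> 'r) module"
  where "free_module R k =
    \<lparr> carrier = {..<k} \<rightarrow>\<^sub>E carrier R,
      monoid.mult = (\<lambda>u v. \<lambda>i\<in>{..<k}. u i \<otimes>\<^bsub>R\<^esub> v i),
      monoid.one = (\<lambda>i\<in>{..<k}. \<one>\<^bsub>R\<^esub>),
      ring.zero = (\<lambda>i\<in>{..<k}. \<zero>\<^bsub>R\<^esub>),
      ring.add = (\<lambda>u v. \<lambda>i\<in>{..<k}. u i \<oplus>\<^bsub>R\<^esub> v i),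
      module.smult = (\<lambda>r u. \<lambda>i\<in>{..<k}. r \<otimes>\<^bsub>R\<^esub> u i) \<rparr>"

definition direct_sum ::
  "('r, 'a, 'd) module_scheme \<Rightarrow> ('r, 'b, 'e) module_scheme \<Rightarrow> ('r, 'a \<times> 'b) module"
  where "direct_sum M N =
    \<lparr> carrier = carrier M \<times> carrier N,
      monoid.mult = (\<lambda>u v. (fst u \<otimes>\<^bsub>M\<^esub> fst v, snd u \<otimes>\<^bsub>N\<^esub> snd v)),
      monoid.one = (\<one>\<^bsub>M\<^esub>, \<one>\<^bsub>N\<^esub>),
      ring.zero = (\<zero>\<^bsub>M\<^esub>, \<zero>\<^bsub>N\<^esub>),
      ring.add = (\<lambda>u v. (fst u \<oplus>\<^bsub>M\<^esub> fst v, snd u \<oplus>\<^bsub>N\<^esub> snd v)),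
      module.smult = (\<lambda>r u. (r \<odot>\<^bsub>M\<^esub> fst u, r \<odot>\<^bsub>N\<^esub> snd u)) \<rparr>"

definition quot_module :: "('r, 'c) ring_scheme \<Rightarrow> 'r set \<Rightarrow> ('r, 'r set) module"
  where "quot_module R I =
    \<lparr> carrier = carrier (R Quot I),
      monoid.mult = monoid.mult (R Quot I),
      monoid.one = \<one>\<^bsub>R Quot I\<^esub>,
      ring.zero = \<zero>\<^bsub>R Quot I\<^esub>,
      ring.add = ring.add (R Quot I),
      module.smult = (\<lambda>r C. (I +>\<^bsub>R\<^esub> r) \<otimes>\<^bsub>R Quot I\<^esub> C) \<rparr>"

lemma module_free_module:
  fixes R (structure) assumes "cring R" shows "Module.module R (free_module R k)"
proof -
  interpret cring R by fact
  show ?thesis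
  proof (rule moduleI)
    show "abelian_group (free_module R k)"
    proof (rule abelian_groupI)
      fix u assume u: "u \<in> carrier (free_module R k)"
      show "\<exists>v\<in>carrier (free_module R k). v \<oplus>\<^bsub>free_module R k\<^esub> u = \<zero>\<^bsub>free_module R k\<^esub>"
        using u by (intro bexI[of _ "\<lambda>i\<in>{..<k}. \<ominus> u i"])
          (auto simp: free_module_def PiE_iff fun_eq_iff l_neg)
    qed (auto simp: free_module_def PiE_iff fun_eq_iff a_ac extensional_def)
  qed (use assms in \<open>auto simp: free_module_def PiE_iff fun_eq_iff extensional_def
       l_distr r_distr m_assoc\<close>)
qed

lemma module_direct_sum:
  assumes "Module.module R M" "Module.module R N" shows "Module.module R (direct_sum M N)"
proof -
  interpret M: Module.module R M by fact
  interpret N: Module.module R N by fact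
  show ?thesis
  proof (rule moduleI)
    show "abelian_group (direct_sum M N)"
    proof (rule abelian_groupI)
      fix u assume u: "u \<in> carrier (direct_sum M N)"
      show "\<exists>v\<in>carrier (direct_sum M N). v \<oplus>\<^bsub>direct_sum M N\<^esub> u = \<zero>\<^bsub>direct_sum M N\<^esub>"
        using u by (intro bexI[of _ "(\<ominus>\<^bsub>M\<^esub> fst u, \<ominus>\<^bsub>N\<^esub> snd u)"])
          (auto simp: direct_sum_def M.M.l_neg N.M.l_neg)
    qed (auto simp: direct_sum_def M.M.a_ac N.M.a_ac)
  qed (auto simp: direct_sum_def M.R.is_cring M.smult_l_distr M.smult_r_distr M.smult_assoc1
         N.smult_l_distr N.smult_r_distr N.smult_assoc1)
qed

lemma module_quot_module:
  fixes R (structure) assumes "cring R" "ideal I R" shows "Module.module R (quot_module R I)"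
proof -
  interpret cring R by fact
  interpret I: ideal I R by fact
  interpret Q: cring "R Quot I" using I.quotient_is_cring[OF assms(1)] .
  interpret h: ring_hom_ring R "R Quot I" "(+>) I" by (rule I.rcos_ring_hom_ring)
  have eqs: "carrier (quot_module R I) = carrier (R Quot I)" "ring.add (quot_module R I) = ring.add (R Quot I)"
    "ring.zero (quot_module R I) = ring.zero (R Quot I)"
    "\<And>r C. r \<odot>\<^bsub>quot_module R I\<^esub> C = (I +> r) \<otimes>\<^bsub>R Quot I\<^esub> C"
    by (simp_all add: quot_module_def)
  show ?thesis
  proof (rule moduleI)
    show "abelian_group (quot_module R I)"
      by (rule abelian_groupI) (use Q.add.l_inv_ex in \<open>auto simp: eqs Q.a_ac Bex_def\<close>)
  qed (use assms in \<open>auto simp: eqs Q.l_distr Q.r_distr Q.m_assoc\<close>)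
qed

definition module_span :: "('r, 'c) ring_scheme \<Rightarrow> ('r, 'a, 'd) module_scheme \<Rightarrow> 'a set \<Rightarrow> 'a set"
  where "module_span R M A = \<Inter>{H. submodule H R M \<and> A \<subseteq> H}"

definition fin_gen :: "('r, 'c) ring_scheme \<Rightarrow> ('r, 'a, 'd) module_scheme \<Rightarrow> bool"
  where "fin_gen R M \<longleftrightarrow> (\<exists>A. finite A \<and> A \<subseteq> carrier M \<and> module_span R M A = carrier M)"

definition has_free_summand :: "('r, 'c) ring_scheme \<Rightarrow> ('r, 'a, 'd) module_scheme \<Rightarrow> bool"
  where "has_free_summand R M \<longleftrightarrow>
    (\<exists>F G k h. submodule F R M \<and> submodule G R M \<and>
       F \<inter> G = {\<zero>\<^bsub>M\<^esub>} \<and> F <+>\<^bsub>M\<^esub> G = carrier M \<and>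
       k \<ge> 1 \<and> h \<in> module_hom R (free_module R k) M \<and> bij_betw h (carrier (free_module R k)) F)"


section \<open>Local rings: dimension, depth, systems of parameters\<close>

text \<open>Only meaningful for local rings \<open>R\<close>.\<close>
definition max_ideal :: "('r, 'c) ring_scheme \<Rightarrow> 'r set"
  where "max_ideal R = (THE M. maximalideal M R)"

text \<open>\<open>I\<^sup>n\<close> is the power in the multiplicative monoid of ideals; \<open>I\<^sup>0\<close> is the unit ideal.\<close>
abbreviation ideal_pow :: "('r, 'c) ring_scheme \<Rightarrow> 'r set \<Rightarrow> nat \<Rightarrow> 'r set"
  where "ideal_pow R I n \<equiv> I [^]\<^bsub>ideals_set R\<^esub> n"

definition radical :: "('r, 'c) ring_scheme \<Rightarrow> 'r set \<Rightarrow> 'r set"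
  where "radical R I = {a \<in> carrier R. \<exists>k::nat. a [^]\<^bsub>R\<^esub> k \<in> I}"

definition krull_dim :: "('r, 'c) ring_scheme \<Rightarrow> enat"
  where "krull_dim R = Sup {enat d | d. \<exists>P :: nat \<Rightarrow> 'r set.
    (\<forall>i\<le>d. primeideal (P i) R) \<and> (\<forall>i<d. P i \<subset> P (Suc i))}"

text \<open>The submodule \<open>(a\<^sub>1, \<dots>, a\<^sub>r) M\<close>.\<close>
definition seq_mult :: "('r, 'c) ring_scheme \<Rightarrow> ('r, 'a, 'd) module_scheme \<Rightarrow> 'r list \<Rightarrow> 'a set"
  where "seq_mult R M as = module_span R M {a \<odot>\<^bsub>M\<^esub> u | a u. a \<in> set as \<and> u \<in> carrier M}"

text \<open>
  That \<open>a\<^sub>i\<close> is a nonzerodivisor on \<open>M / (a\<^sub>1, \<dots>, a\<^bsub>i-1\<^esub>) M\<close> is expressed by representatives in \<open>M\<close>.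
\<close>
definition regular_seq :: "('r, 'c) ring_scheme \<Rightarrow> ('r, 'a, 'd) module_scheme \<Rightarrow> 'r list \<Rightarrow> bool"
  where "regular_seq R M as \<longleftrightarrow>
    set as \<subseteq> carrier R \<and>
    (\<forall>i<length as. \<forall>u\<in>carrier M.
       as ! i \<odot>\<^bsub>M\<^esub> u \<in> seq_mult R M (take i as) \<longrightarrow> u \<in> seq_mult R M (take i as)) \<and>
    seq_mult R M as \<noteq> carrier M"

definition depth :: "('r, 'c) ring_scheme \<Rightarrow> ('r, 'a, 'd) module_scheme \<Rightarrow> enat"
  where "depth R M = Sup {enat (length as) | as. set as \<subseteq> max_ideal R \<and> regular_seq R M as}"

definition max_CM :: "('r, 'c) ring_scheme \<Rightarrow> ('r, 'a, 'd) module_scheme \<Rightarrow> bool"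
  where "max_CM R M \<longleftrightarrow>
    Module.module R M \<and> fin_gen R M \<and> carrier M \<noteq> {\<zero>\<^bsub>M\<^esub>} \<and> depth R M = krull_dim R"

definition system_of_parameters :: "('r, 'c) ring_scheme \<Rightarrow> 'r list \<Rightarrow> bool"
  where "system_of_parameters R as \<longleftrightarrow>
    enat (length as) = krull_dim R \<and> set as \<subseteq> max_ideal R \<and>
    radical R (genideal R (set as)) = max_ideal R"


section \<open>Generalized Loewy length, delta invariant and index\<close>

definition gen_loewy_length :: "('r, 'c) ring_scheme \<Rightarrow> nat"
  where "gen_loewy_length R =
    (LEAST n. n \<ge> 1 \<and>
       (\<exists>as. system_of_parameters R as \<and> ideal_pow R (max_ideal R) n \<subseteq> genideal R (set as)))"

text \<open>
  The module \<open>Y\<close> in the definition of the delta invariant ranges over all modules carried by the type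
  of sets of finite sequences over \<open>R\<close>. This is no restriction: a finitely generated module is
  isomorphic to some \<open>R\<^sup>k / U\<close>, whose elements are cosets, that is subsets of
  \<^term>\<open>carrier (free_module R k)\<close>.
\<close>
definition delta_inv :: "('r, 'c) ring_scheme \<Rightarrow> ('r, 'a, 'd) module_scheme \<Rightarrow> nat"
  where "delta_inv R M =
    (LEAST n. \<exists>Y :: ('r, (nat \<Rightarrow> 'r) set) module. \<exists>h.
       Module.module R Y \<and> (carrier Y = {\<zero>\<^bsub>Y\<^esub>} \<or> max_CM R Y) \<and> \<not> has_free_summand R Y \<and>
       h \<in> module_hom R (direct_sum Y (free_module R n)) M \<and>
       h ` carrier (direct_sum Y (free_module R n)) = carrier M)"

text \<open>With values in \<^typ>\<open>enat\<close>, so that the infimum of the empty set is \<open>\<infinity>\<close>.\<close>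
definition ring_index :: "('r, 'c) ring_scheme \<Rightarrow> enat"
  where "ring_index R =
    Inf {enat n | n. n \<ge> 1 \<and> delta_inv R (quot_module R (ideal_pow R (max_ideal R) n)) = 1}"


section \<open>The hypersurface ring\<close>

text \<open>
  \<open>F\<^sub>2[[x,y]]\<close> is the iterated power series ring \<open>F\<^sub>2[[x]][[y]]\<close>: the coefficient of \<open>x\<^sup>i y\<^sup>j\<close> in \<open>g\<close> is
  \<open>fps_nth (fps_nth g j) i\<close>.
\<close>
definition power_series_ring :: "bit fps fps ring"
  where "power_series_ring =
    \<lparr> carrier = UNIV, monoid.mult = (*), monoid.one = 1, ring.zero = 0, ring.add = (+) \<rparr>"

abbreviation X_ser :: "bit fps fps"
  where "X_ser \<equiv> fps_const fps_X"

abbreviation Y_ser :: "bit fps fps"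
  where "Y_ser \<equiv> fps_X"

definition hyp_ideal :: "nat \<Rightarrow> bit fps fps set"
  where "hyp_ideal N = genideal power_series_ring {X_ser * Y_ser * (X_ser ^ N + Y_ser ^ N)}"

definition hyp_ring :: "nat \<Rightarrow> bit fps fps set ring"
  where "hyp_ring N = power_series_ring Quot hyp_ideal N"

definition hyp_x :: "nat \<Rightarrow> bit fps fps set"
  where "hyp_x N = hyp_ideal N +>\<^bsub>power_series_ring\<^esub> X_ser"

definition hyp_y :: "nat \<Rightarrow> bit fps fps set"
  where "hyp_y N = hyp_ideal N +>\<^bsub>power_series_ring\<^esub> Y_ser"

lemma power_series_ring_simps [simp]:
  "carrier power_series_ring = UNIV" "a \<otimes>\<^bsub>power_series_ring\<^esub> b = a * b"
  "a \<oplus>\<^bsub>power_series_ring\<^esub> b = a + b" "\<one>\<^bsub>power_series_ring\<^esub> = 1" "\<zero>\<^bsub>power_series_ring\<^esub> = 0"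
  by (simp_all add: power_series_ring_def)

lemma cring_power_series_ring: "cring power_series_ring"
proof (rule cringI)
  show "abelian_group power_series_ring"
    by (rule abelian_groupI) (auto simp: algebra_simps intro: exI[of _ "- _"])
  show "comm_monoid power_series_ring"
    by (rule comm_monoidI) (auto simp: algebra_simps)
qed (auto simp: algebra_simps)

lemma ideal_hyp_ideal: "ideal (hyp_ideal N) power_series_ring"
  unfolding hyp_ideal_def using cring_power_series_ring by (intro ring.genideal_ideal cring.axioms) auto

lemma hyp_ideal_eq: "hyp_ideal N = {c * (X_ser * Y_ser * (X_ser ^ N + Y_ser ^ N)) | c. True}"
  unfolding hyp_ideal_def
  using cring.cgenideal_eq_genideal[OF cring_power_series_ring, of "X_ser * Y_ser * (X_ser ^ N + Y_ser ^ N)"]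
  by (simp add: cgenideal_def)

lemma cring_hyp_ring: "cring (hyp_ring N)"
  unfolding hyp_ring_def by (rule ideal.quotient_is_cring[OF ideal_hyp_ideal cring_power_series_ring])

lemma hyp_hom: "ring_hom_ring power_series_ring (hyp_ring N) ((+>\<^bsub>power_series_ring\<^esub>) (hyp_ideal N))"
  unfolding hyp_ring_def by (rule ideal.rcos_ring_hom_ring[OF ideal_hyp_ideal])

lemma carrier_hyp_ring: "carrier (hyp_ring N) = range ((+>\<^bsub>power_series_ring\<^esub>) (hyp_ideal N))"
  by (auto simp: hyp_ring_def FactRing_def A_RCOSETS_def')

lemma unit_series: 
  assumes "fps_nth (fps_nth g 0) 0 \<noteq> (0::bit)" shows "\<exists>h. h * g = (1::bit fps fps)"
proof -
  have "inverse (fps_nth g 0) * fps_nth g 0 = 1" using assms by (intro inverse_mult_eq_1) auto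
  from fps_left_inverse[OF this] show ?thesis by blast
qed

lemma series_decomp:
  "(g::bit fps fps) = fps_const (fps_const (fps_nth (fps_nth g 0) 0)) + 
     fps_const (fps_shift 1 (fps_nth g 0)) * X_ser + fps_shift 1 g * Y_ser"
proof -
  have 1: "h = fps_const (fps_nth h 0) + fps_shift 1 h * fps_X" for h :: "'z::comm_ring_1 fps"
    by (rule fps_ext) (auto simp: fps_X_mult_right_nth)
  show ?thesis
    apply (subst 1[of g])
    apply (subst 1[of "fps_nth g 0"])
    apply (simp flip: fps_const_add fps_const_mult)
    done
qed

lemma max_ideal_hyp_ring:
  "maximalideal (genideal (hyp_ring N) {hyp_x N, hyp_y N}) (hyp_ring N)"
  "max_ideal (hyp_ring N) = genideal (hyp_ring N) {hyp_x N, hyp_y N}"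
proof -
  let ?R = "hyp_ring N" and ?q = "(+>\<^bsub>power_series_ring\<^esub>) (hyp_ideal N)"
  let ?M = "genideal ?R {hyp_x N, hyp_y N}"
  interpret R: cring ?R by (rule cring_hyp_ring)
  interpret q: ring_hom_ring power_series_ring ?R ?q by (rule hyp_hom)
  interpret I: ideal "hyp_ideal N" power_series_ring by (rule ideal_hyp_ideal)
  have qc: "?q g \<in> carrier ?R" for g by (simp add: carrier_hyp_ring)
  have xy: "{hyp_x N, hyp_y N} \<subseteq> carrier ?R" by (auto simp: hyp_x_def hyp_y_def qc)
  interpret M: ideal ?M ?R by (rule R.genideal_ideal[OF xy])
  have xM: "?q X_ser \<in> ?M" "?q Y_ser \<in> ?M"
    using R.genideal_self[OF xy] by (auto simp: hyp_x_def hyp_y_def)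
  have M: "?q g \<in> ?M" if "fps_nth (fps_nth g 0) 0 = 0" for g
  proof -
    have "g = fps_const (fps_shift 1 (fps_nth g 0)) * X_ser + fps_shift 1 g * Y_ser"
      using series_decomp[of g] that by simp
    hence "?q g = ?q (fps_const (fps_shift 1 (fps_nth g 0))) \<otimes>\<^bsub>?R\<^esub> ?q X_ser
       \<oplus>\<^bsub>?R\<^esub> ?q (fps_shift 1 g) \<otimes>\<^bsub>?R\<^esub> ?q Y_ser"
      by (metis q.hom_add q.hom_mult power_series_ring_simps(1,2,3) UNIV_I)
    thus ?thesis using xM qc by (auto intro!: M.a_closed M.I_l_closed)
  qed
  define J where "J = {?q g | g. fps_nth (fps_nth g 0) 0 = 0}"
  have JM: "J \<subseteq> ?M" using M by (auto simp: J_def)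
  have I0: "fps_nth (fps_nth g 0) 0 = 0" if "g \<in> hyp_ideal N" for g
    using that by (auto simp: hyp_ideal_eq)
  have qinj: "fps_nth (fps_nth g 0) 0 = fps_nth (fps_nth g' 0) 0" if "?q g = ?q g'" for g g'
  proof -
    have "g \<in> hyp_ideal N +>\<^bsub>power_series_ring\<^esub> g'"
      using that I.a_rcos_self[of g] by simp
    then obtain h where "h \<in> hyp_ideal N" "g = h + g'"
      by (auto simp: a_r_coset_def' )
    thus ?thesis using I0[of h] by simp
  qed
  have iJ: "ideal J ?R"
  proof (rule idealI)
    show "ring ?R" by (rule R.ring_axioms)
    show "subgroup J (add_monoid ?R)"
    proof (rule R.add.subgroupI)
      show "J \<subseteq> carrier ?R" by (auto simp: J_def qc)
      show "J \<noteq> {}" unfolding J_def by (auto intro: exI[of _ 0])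
      fix a assume "a \<in> J"
      then obtain g where g: "a = ?q g" "fps_nth (fps_nth g 0) 0 = 0" by (auto simp: J_def)
      have "?q (\<ominus>\<^bsub>power_series_ring\<^esub> g) = \<ominus>\<^bsub>?R\<^esub> ?q g" by (rule q.hom_a_inv) simp
      moreover have "\<ominus>\<^bsub>power_series_ring\<^esub> g = - g"
        using abelian_group.minus_equality[of power_series_ring "- g" g] cring_power_series_ring
        by (auto simp: cring_def ring_def)
      ultimately have "\<ominus>\<^bsub>?R\<^esub> a = ?q (- g)" using g by simp
      thus "\<ominus>\<^bsub>?R\<^esub> a \<in> J" unfolding J_def using g by auto
    next
      fix a b assume "a \<in> J" "b \<in> J"
      then obtain g g' where g: "a = ?q g" "fps_nth (fps_nth g 0) 0 = 0"
        "b = ?q g'" "fps_nth (fps_nth g' 0) 0 = 0" by (auto simp: J_def)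
      have "a \<oplus>\<^bsub>?R\<^esub> b = ?q (g + g')" using q.hom_add[of g g'] g by simp
      thus "a \<oplus>\<^bsub>?R\<^esub> b \<in> J" unfolding J_def using g by auto
    qed
    fix a r assume "a \<in> J" "r \<in> carrier ?R"
    then obtain g g' where g: "a = ?q g" "fps_nth (fps_nth g 0) 0 = 0" "r = ?q g'"
      by (auto simp: J_def carrier_hyp_ring)
    have "r \<otimes>\<^bsub>?R\<^esub> a = ?q (g' * g)" using q.hom_mult[of g' g] g by simp
    thus "r \<otimes>\<^bsub>?R\<^esub> a \<in> J" unfolding J_def using g by (auto simp: fps_mult_nth_0)
    have "a \<otimes>\<^bsub>?R\<^esub> r = ?q (g * g')" using q.hom_mult[of g g'] g by simp
    thus "a \<otimes>\<^bsub>?R\<^esub> r \<in> J" unfolding J_def using g by (auto simp: fps_mult_nth_0)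
  qed
  have xyJ: "{hyp_x N, hyp_y N} \<subseteq> J"
    unfolding J_def hyp_x_def hyp_y_def by (auto intro: exI[of _ X_ser] exI[of _ Y_ser])
  have MJ: "?M = J"
    by (rule equalityI[OF R.genideal_minimal[OF iJ xyJ] JM])
  have one: "\<one>\<^bsub>?R\<^esub> \<notin> J"
  proof
    assume "\<one>\<^bsub>?R\<^esub> \<in> J"
    then obtain g where "\<one>\<^bsub>?R\<^esub> = ?q g" "fps_nth (fps_nth g 0) 0 = 0"
      unfolding J_def by blast
    moreover have "?q 1 = \<one>\<^bsub>?R\<^esub>" using q.hom_one by simp
    ultimately have "?q g = ?q 1" "fps_nth (fps_nth g 0) 0 = 0" by metis+
    thus False using qinj[of g 1] by simp
  qed
  have big: "K \<subseteq> J \<or> K = carrier ?R" if K: "ideal K ?R" for K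
  proof (rule ccontr)
    interpret K: ideal K ?R by fact
    assume c: "\<not> (K \<subseteq> J \<or> K = carrier ?R)"
    then obtain a where a: "a \<in> K" "a \<notin> J" by auto
    then obtain g where g: "a = ?q g" using K.a_subset by (auto simp: carrier_hyp_ring)
    with a have "fps_nth (fps_nth g 0) 0 \<noteq> 0" by (auto simp: J_def)
    then obtain h where "h * g = 1" using unit_series by blast
    hence "?q h \<otimes>\<^bsub>?R\<^esub> a = \<one>\<^bsub>?R\<^esub>" using q.hom_mult[of h g] q.hom_one g by simp
    hence "\<one>\<^bsub>?R\<^esub> \<in> K" using K.I_l_closed[OF a(1) qc[of h]] by metis
    thus False using c K.one_imp_carrier by blast
  qed
  show mx: "maximalideal ?M ?R"
  proof (rule maximalidealI)
    show "ideal ?M ?R" by (rule M.ideal_axioms)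
    show "carrier ?R \<noteq> ?M" using one MJ by auto
    show "K = ?M \<or> K = carrier ?R" if "ideal K ?R" "?M \<subseteq> K" for K
      using big[OF that(1)] that(2) MJ by auto
  qed
  show "max_ideal ?R = ?M" unfolding max_ideal_def
  proof (rule the_equality[where P = "\<lambda>K. maximalideal K ?R", OF mx])
    fix K assume K: "maximalideal K ?R"
    then have "ideal K ?R" "carrier ?R \<noteq> K" by (auto simp: maximalideal_def maximalideal_axioms_def)
    with big have "K \<subseteq> ?M" using MJ by blast
    moreover have "?M \<noteq> carrier ?R" using one MJ by auto
    ultimately show "K = ?M" using maximalideal.I_maximal[OF K M.ideal_axioms] M.a_subset by auto
  qed
qed

end

theory Submission
  imports Defs "HOL-Computational_Algebra.Polynomial"
begin

text \<open>
  Write \<open>S = F\<^sub>2[[x, y]]\<close>, \<open>N = 2\<^sup>n p\<^sup>m\<close>, \<open>f = xy(x\<^sup>N + y\<^sup>N)\<close> and \<open>R = S / (f)\<close>; the order of \<open>f\<close> is \<open>N + 2\<close>. As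
  \<open>p > 3\<close> is prime, \<open>N\<close> is positive and not divisible by \<open>3\<close>.

  \<^emph>\<open>Loewy length.\<close> Modulo \<open>Q = x\<^sup>2 + xy + y\<^sup>2\<close>, a form is determined by its value at \<open>(\<omega>, 1)\<close>, where \<open>\<omega>\<close>
  is a primitive third root of unity. Since \<open>f\<close> does not vanish there, \<open>Q\<close> and \<open>f\<close> together generate all
  forms of degree \<open>N + 3\<close> (lemma \<open>monomials_in_loewy_ideal\<close>), which gives the inclusion and the upper
  bound. For the lower bound, let \<open>\<alpha>\<close> be any parameter, of order \<open>d \<ge> 1\<close>. In degree \<open>N + 2\<close> the ideal
  \<open>(\<alpha>, f)\<close> has the initial forms \<open>H g + c f\<close>, where \<open>H\<close> is the initial form of \<open>\<alpha>\<close>, \<open>g\<close> has degree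
  \<open>N + 2 - d\<close> and \<open>c\<close> is a constant. For these to exhaust all forms, \<open>H\<close> must be linear and coprime to
  \<open>f\<close>; but \<open>f\<close> is divisible by every linear form over \<open>F\<^sub>2\<close> (lemma \<open>power_not_in_parameter_ideal\<close>).

  \<^emph>\<open>Index.\<close> The series \<open>g = f / x\<close> lies in \<open>(x, y)\<^bsup>N+1\<^esup>\<close>, so the maximal Cohen-Macaulay module
  \<open>S / (g)\<close>, which is not faithful and therefore has no free summand, maps onto \<open>R / m\<^sup>n\<close> for all
  \<open>n \<le> N + 1\<close> (lemma \<open>delta_inv_small\<close>). Conversely, a maximal Cohen-Macaulay module \<open>M\<close> that maps onto
  \<open>R / m\<^bsup>N+2\<^esup>\<close> has a free summand (lemma \<open>free_summand_if_onto\<close>). The kernel of a presentation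
  \<open>S\<^sup>k \<rightarrow> M\<close> is free, as \<open>M\<close> has a regular element, and it contains \<open>f S\<^sup>k\<close>. If \<open>v\<close> maps to \<open>1\<close>, then
  either \<open>f v\<close> has a unit among its coordinates in the kernel, and this coordinate provides a functional that
  splits off a free summand, or a comparison of orders shows that \<open>f\<close> lies in \<open>(x, y)\<^bsup>N+3\<^esup>\<close>.

  Both parts need that \<open>R\<close> has dimension one. This, and the fact that \<open>S / (g)\<close> has depth at most one,
  follow from an elementary principal ideal theorem: \<open>S / (g)\<close> is finite over \<open>F\<^sub>2[[x]]\<close>, so its
  elements are algebraic over this discrete valuation ring (lemma
  \<open>power_subset_if_nonzerodivisor_mod_cofactor\<close>).
\<close>

section \<open>The order filtration of the power series ring\<close>

abbreviation cf :: "bit fps fps \<Rightarrow> nat \<Rightarrow> nat \<Rightarrow> bit"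
  where "cf g i j \<equiv> fps_nth (fps_nth g j) i"

text \<open>
  The power \<open>(x, y)\<^sup>n\<close>, described by coefficients. This makes completeness and the separation of
  points by the filtration immediate.
\<close>

definition ord_ideal :: "nat \<Rightarrow> bit fps fps set"
  where "ord_ideal n = {g. \<forall>i j. i + j < n \<longrightarrow> cf g i j = 0}"

lemma bit_add_self: "a + a = (0 :: bit)"
  by (cases a) simp_all

lemma char2_fps: "a + a = 0" "- a = a" "a - b = a + b" for a b :: "bit fps"
proof -
  show 1: "a + a = 0" for a :: "bit fps" by (rule fps_ext) (simp only: fps_add_nth fps_zero_nth bit_add_self)
  show "- a = a" for a :: "bit fps" using 1[of a] by (rule minus_unique)
  thus "a - b = a + b" by (metis diff_conv_add_uminus)
qed

lemma char2: "a + a = 0" "- a = a" "a - b = a + b" for a b :: "bit fps fps"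
proof -
  show 1: "a + a = 0" for a :: "bit fps fps"
    by (rule fps_ext) (simp only: fps_add_nth char2_fps fps_zero_nth)
  show "- a = a" for a :: "bit fps fps" using 1[of a] by (rule minus_unique)
  thus "a - b = a + b" by (metis diff_conv_add_uminus)
qed

lemma ord_ideal_0 [simp]: "ord_ideal 0 = UNIV"
  by (simp add: ord_ideal_def)

lemma zero_ord_ideal [simp]: "0 \<in> ord_ideal n"
  by (simp add: ord_ideal_def)

lemma ord_ideal_add: "a \<in> ord_ideal n \<Longrightarrow> b \<in> ord_ideal n \<Longrightarrow> a + b \<in> ord_ideal n"
  by (auto simp: ord_ideal_def)

lemma ord_ideal_diff: "a \<in> ord_ideal n \<Longrightarrow> b \<in> ord_ideal n \<Longrightarrow> a - b \<in> ord_ideal n"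
  by (auto simp: ord_ideal_def)

lemma ord_ideal_antimono: "m \<le> n \<Longrightarrow> ord_ideal n \<subseteq> ord_ideal m"
  by (auto simp: ord_ideal_def)

lemma ord_ideal_mult:
  assumes "a \<in> ord_ideal m" "b \<in> ord_ideal n" shows "a * b \<in> ord_ideal (m + n)"
proof -
  have "cf (a * b) i j = 0" if ij: "i + j < m + n" for i j
  proof -
    have "cf a i' j' * cf b (i - i') (j - j') = 0" if "i' \<le> i" "j' \<le> j" for i' j'
    proof (cases "i' + j' < m")
      case False
      hence "(i - i') + (j - j') < n" using ij that by linarith
      thus ?thesis using assms(2) by (simp add: ord_ideal_def)
    qed (use assms(1) in \<open>simp add: ord_ideal_def\<close>)
    thus ?thesis unfolding fps_mult_nth fps_sum_nth by (intro sum.neutral ballI) (simp only: atLeastAtMost_iff)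
  qed
  thus ?thesis by (simp add: ord_ideal_def)
qed

lemma ord_ideal_mult_left: "b \<in> ord_ideal n \<Longrightarrow> a * b \<in> ord_ideal n"
  using ord_ideal_mult[of a 0 b n] by simp

lemma ord_ideal_mult_right: "b \<in> ord_ideal n \<Longrightarrow> b * a \<in> ord_ideal n"
  using ord_ideal_mult[of b n a 0] by simp

lemma ord_ideal_sum: "(\<And>i. i \<in> I \<Longrightarrow> a i \<in> ord_ideal n) \<Longrightarrow> (\<Sum>i\<in>I. a i) \<in> ord_ideal n"
  by (induction I rule: infinite_finite_induct) (auto intro: ord_ideal_add)

lemma ord_ideal_power: "a \<in> ord_ideal 1 \<Longrightarrow> a ^ n \<in> ord_ideal n"
proof (induction n)
  case (Suc n)
  thus ?case using ord_ideal_mult[of a 1 "a ^ n" n] by simp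
qed simp

lemma X_ord_ideal: "X_ser \<in> ord_ideal 1" and Y_ord_ideal: "Y_ser \<in> ord_ideal 1"
  by (auto simp: ord_ideal_def)

lemma one_notin_ord_ideal: "1 \<notin> ord_ideal 1"
  by (auto simp: ord_ideal_def)

lemma ord_ideal_1: "g \<in> ord_ideal 1 \<longleftrightarrow> cf g 0 0 = 0"
  by (auto simp: ord_ideal_def)

lemma unit_if_notin_ord_ideal: "g \<notin> ord_ideal 1 \<Longrightarrow> \<exists>h. h * g = 1"
  by (rule unit_series) (simp only: ord_ideal_1 not_False_eq_True simp_thms)

lemma ord_ideal_Inter:
  assumes "\<And>n. g \<in> ord_ideal n" shows "g = 0"
proof (intro fps_ext)
  fix i j
  have "g \<in> ord_ideal (Suc (i + j))" by (rule assms)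
  thus "cf g i j = cf 0 i j" by (simp add: ord_ideal_def)
qed

lemma ord_ideal_Suc_decomp:
  assumes "g \<in> ord_ideal (Suc n)"
  obtains a b where "a \<in> ord_ideal n" "b \<in> ord_ideal n" "g = a * X_ser + b * Y_ser"
proof
  show "g = fps_const (fps_shift 1 (fps_nth g 0)) * X_ser + fps_shift 1 g * Y_ser"
    using series_decomp[of g] assms by (simp add: ord_ideal_def)
  show "fps_const (fps_shift 1 (fps_nth g 0)) \<in> ord_ideal n" "fps_shift 1 g \<in> ord_ideal n"
    using assms by (auto simp: ord_ideal_def)
qed

text \<open>
  The coefficient of \<open>x\<^sup>i y\<^sup>j\<close> in the limit is read off from the term with index \<open>i + j + 1\<close>, from which
  on this coefficient does not change any more.
\<close>

lemma ord_ideal_complete: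
  assumes "\<And>n. t (Suc n) - t n \<in> ord_ideal n"
  obtains l where "\<And>n. l - t n \<in> ord_ideal n"
proof
  have stable: "cf (t n) i j = cf (t (Suc (i + j))) i j" if "Suc (i + j) \<le> n" for n i j
    using that
  proof (induction n rule: dec_induct)
    case (step n)
    have "cf (t (Suc n) - t n) i j = 0" using assms[of n] step.hyps by (auto simp: ord_ideal_def)
    thus ?case using step.IH unfolding fps_sub_nth by (simp only: right_minus_eq)
  qed simp
  show "Abs_fps (\<lambda>j. Abs_fps (\<lambda>i. cf (t (Suc (i + j))) i j)) - t n \<in> ord_ideal n" for n
    using stable[of _ _ n] by (simp add: ord_ideal_def)
qed

section \<open>Division by a Weierstrass polynomial\<close>

text \<open>
  The quotient expands \<open>1 / (y\<^sup>d - x\<^sup>e)\<close> as a geometric series in \<open>x\<^sup>e / y\<^sup>d\<close>: its coefficients satisfy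
  \<open>h\<^sub>l = g\<^bsub>l+d\<^esub> + x\<^sup>e h\<^bsub>l+d\<^esub>\<close>. Since \<open>e > 0\<close>, iterating this recursion contributes only finitely often
  to a given power of \<open>x\<close>. What remains below degree \<open>d\<close> in \<open>y\<close> is the remainder.
\<close>

lemma weierstrass_division:
  fixes g :: "'a :: comm_ring_1 fps fps"
  assumes "e > 0"
  obtains a h where
    "g = (\<Sum>j<d. fps_const (a j) * fps_X ^ j) + (fps_X ^ d - fps_const fps_X ^ e) * h"
proof -
  define c where "c = (\<lambda>l i k. fps_nth (fps_nth g (l + d + d * k)) (i - e * k))"
  define h where "h = Abs_fps (\<lambda>l. Abs_fps (\<lambda>i. \<Sum>k | e * k \<le> i. c l i k))"
  have fin: "finite {k. e * k \<le> i}" for i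
  proof (rule finite_subset)
    show "{k. e * k \<le> i} \<subseteq> {..i}" using assms by (auto elim!: order_trans[rotated])
  qed simp
  have rec: "fps_nth h l = fps_nth g (l + d) + fps_X ^ e * fps_nth h (l + d)" for l
  proof (rule fps_ext)
    fix i
    show "fps_nth (fps_nth h l) i = fps_nth (fps_nth g (l + d) + fps_X ^ e * fps_nth h (l + d)) i"
    proof (cases "i < e")
      case True
      have "{k. e * k \<le> i} = {0}"
      proof -
        have "k = 0" if "e * k \<le> i" for k using that True by (cases k) auto
        thus ?thesis by auto
      qed
      thus ?thesis using True by (simp add: h_def c_def fps_X_power_mult_nth)
    next
      case False
      have eq: "{k. e * k \<le> i} = insert 0 (Suc ` {k. e * k \<le> i - e})"
      proof -
        have "k \<in> insert 0 (Suc ` {k. e * k \<le> i - e})" if "e * k \<le> i" for k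
          using that by (cases k) auto
        thus ?thesis using False by auto
      qed
      have "fps_nth (fps_nth h l) i = c l i 0 + (\<Sum>k | e * k \<le> i - e. c l i (Suc k))"
        by (simp add: h_def eq fin sum.reindex)
      also have "(\<Sum>k | e * k \<le> i - e. c l i (Suc k)) = fps_nth (fps_nth h (l + d)) (i - e)"
        by (simp add: h_def c_def algebra_simps)
      finally show ?thesis using False by (simp add: c_def fps_X_power_mult_nth)
    qed
  qed
  define a where "a = (\<lambda>j. fps_nth g j + fps_X ^ e * fps_nth h j)"
  have "g = (\<Sum>j<d. fps_const (a j) * fps_X ^ j) + (fps_X ^ d - fps_const fps_X ^ e) * h"
  proof (rule fps_ext)
    fix l
    have 1: "fps_nth (\<Sum>j<d. fps_const (a j) * fps_X ^ j) l = (if l < d then a l else 0)"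
    proof -
      have "fps_nth (\<Sum>j<d. fps_const (a j) * fps_X ^ j) l = (\<Sum>j<d. if j = l then a j else 0)"
        unfolding fps_sum_nth by (rule sum.cong) (auto simp: fps_X_power_nth)
      also have "\<dots> = (if l < d then a l else 0)" by (subst sum.delta) auto
      finally show ?thesis .
    qed
    have 2: "fps_nth ((fps_X ^ d - fps_const fps_X ^ e) * h) l
        = (if l < d then 0 else fps_nth h (l - d)) - fps_X ^ e * fps_nth h l"
      by (simp add: left_diff_distrib fps_X_power_mult_nth)
    show "fps_nth g l = fps_nth ((\<Sum>j<d. fps_const (a j) * fps_X ^ j) + (fps_X ^ d - fps_const fps_X ^ e) * h) l"
      using rec[of "l - d"] unfolding fps_add_nth 1 2
      by (auto simp: a_def)
  qed
  thus thesis by (rule that)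
qed

section \<open>Restriction to the curve \<open>y = x\<^sup>2\<close>\<close>

text \<open>
  All three lines through the origin that are defined over \<open>F\<^sub>2\<close>, namely \<open>x\<close>, \<open>y\<close> and \<open>x + y\<close>, are components
  of \<open>xy(x\<^sup>N + y\<^sup>N)\<close>, so no linear form is a parameter of the hypersurface ring. The smooth curve
  \<open>y + x\<^sup>2\<close> is tangent to one of them but shares no component with the hypersurface. It is a
  parameter, and the quotient of the power series ring by it is the discrete valuation ring \<open>F\<^sub>2[[x]]\<close>.
\<close>

definition curve :: "bit fps fps"
  where "curve = Y_ser + fps_const (fps_X ^ 2)"

lemma curve_ord_ideal: "curve \<in> ord_ideal 1"
  unfolding ord_ideal_1 by (simp add: curve_def)

lemma curve_nonzero: "curve \<noteq> 0"
proof -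
  have "fps_nth curve 1 = 1" by (simp add: curve_def)
  thus ?thesis by auto
qed

text \<open>
  Comparing coefficients of \<open>y\<^bsup>l+1\<^esup>\<close> in \<open>(y + x\<^sup>2) h = a\<close> gives \<open>h\<^sub>l = x\<^sup>2 h\<^bsub>l+1\<^esub>\<close>. Hence every \<open>h\<^sub>l\<close> is divisible
  by all powers of \<open>x\<close>.
\<close>

lemma curve_dvd_const:
  assumes "fps_const a = curve * h" shows "a = 0"
proof -
  have nth: "fps_nth (curve * h) l = (if l = 0 then 0 else fps_nth h (l - 1)) + fps_X ^ 2 * fps_nth h l" for l
    by (simp add: curve_def distrib_right)
  have rec: "fps_nth h l = fps_X ^ 2 * fps_nth h (Suc l)" for l
  proof -
    have "fps_nth h l + fps_X ^ 2 * fps_nth h (Suc l) = fps_nth (fps_const a) (Suc l)"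
      unfolding assms nth by simp
    hence "fps_nth h l - fps_X ^ 2 * fps_nth h (Suc l) = 0"
      unfolding char2_fps(3) by simp
    thus ?thesis by (simp only: right_minus_eq)
  qed
  have "\<forall>l. cf h i l = 0" for i
  proof (induction i rule: less_induct)
    case (less i)
    show ?case
    proof
      fix l
      have "cf h i l = fps_nth (fps_X ^ 2 * fps_nth h (Suc l)) i" using rec[of l] by simp
      also have "\<dots> = 0" using less[of "i - 2"] by (cases "i < 2") (auto simp: fps_X_power_mult_nth)
      finally show "cf h i l = 0" .
    qed
  qed
  hence "h = 0" by (intro fps_ext) simp
  thus ?thesis using assms by simp
qed

text \<open>
  The restriction of a series to the curve, in other words \<open>g(x, x\<^sup>2)\<close>: the curve equation is not a
  variable, so the value is obtained as the remainder of the division by the equation.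
\<close>

definition restr :: "bit fps fps \<Rightarrow> bit fps"
  where "restr g = (THE a. curve dvd g - fps_const a)"

lemma restr_eqI:
  assumes "curve dvd g - fps_const a" shows "restr g = a"
  unfolding restr_def
proof (rule the_equality[where P = "\<lambda>a. curve dvd g - fps_const a", OF assms])
  fix b assume "curve dvd g - fps_const b"
  hence "curve dvd (g - fps_const b) - (g - fps_const a)" using assms by (rule dvd_diff)
  hence "curve dvd fps_const (a - b)" by simp
  then obtain h where "fps_const (a - b) = curve * h" by (rule dvdE)
  thus "b = a" using curve_dvd_const by fastforce
qed

lemma curve_dvd_restr: "curve dvd g - fps_const (restr g)"
proof -
  obtain a h where "g = (\<Sum>j<1. fps_const (a j) * Y_ser ^ j) + (Y_ser ^ 1 - X_ser ^ 2) * h"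
    using weierstrass_division[of 2 g 1] by auto
  hence "g - fps_const (a 0) = curve * h" by (simp add: curve_def char2(3)[of Y_ser])
  hence *: "curve dvd g - fps_const (a 0)" by simp
  with restr_eqI[OF *] show ?thesis by simp
qed

lemma restr_const [simp]: "restr (fps_const a) = a"
  by (rule restr_eqI) simp

lemma restr_1 [simp]: "restr 1 = 1"
  using restr_const[of 1] by simp

lemma restr_Y [simp]: "restr Y_ser = fps_X ^ 2"
  by (rule restr_eqI) (simp add: char2 curve_def)

lemma restr_X [simp]: "restr X_ser = fps_X"
  by (rule restr_const)

lemma restr_add [simp]: "restr (g + h) = restr g + restr h"
proof (rule restr_eqI)
  have "curve dvd (g - fps_const (restr g)) + (h - fps_const (restr h))"
    by (intro dvd_add curve_dvd_restr)
  thus "curve dvd g + h - fps_const (restr g + restr h)"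
    by (simp add: algebra_simps flip: fps_const_add)
qed

lemma restr_mult [simp]: "restr (g * h) = restr g * restr h"
proof (rule restr_eqI)
  have "curve dvd (g - fps_const (restr g)) * h + fps_const (restr g) * (h - fps_const (restr h))"
    by (intro dvd_add dvd_mult dvd_mult2 curve_dvd_restr)
  thus "curve dvd g * h - fps_const (restr g * restr h)"
    by (simp add: algebra_simps flip: fps_const_mult)
qed

lemma restr_power [simp]: "restr (g ^ n) = restr g ^ n"
  by (induction n) auto

lemma restr_eq_0_iff: "restr g = 0 \<longleftrightarrow> curve dvd g"
  using curve_dvd_restr[of g] restr_eqI[of g 0] by auto

lemma restr_curve [simp]: "restr curve = 0"
  by (simp add: restr_eq_0_iff)

lemma restr_diff [simp]: "restr (g - h) = restr g - restr h"
  by (simp add: char2 char2_fps)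

lemma restr_sum [simp]: "restr (\<Sum>i\<in>I. g i) = (\<Sum>i\<in>I. restr (g i))"
  using restr_const[of 0] by (induction I rule: infinite_finite_induct) auto

section \<open>Residue classes and powers of the maximal ideal\<close>

definition hyp_poly :: "nat \<Rightarrow> bit fps fps"
  where "hyp_poly N = X_ser * Y_ser * (X_ser ^ N + Y_ser ^ N)"

definition hyp_class :: "nat \<Rightarrow> bit fps fps \<Rightarrow> bit fps fps set"
  where "hyp_class N s = hyp_ideal N +>\<^bsub>power_series_ring\<^esub> s"

lemma hyp_class_conv: "hyp_class N s = {u. hyp_poly N dvd u - s}"
proof -
  have "hyp_class N s = {h + s | h. h \<in> hyp_ideal N}"
    by (auto simp: hyp_class_def a_r_coset_def')
  also have "\<dots> = {u. hyp_poly N dvd u - s}"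
    by (auto simp: hyp_ideal_eq hyp_poly_def dvd_def algebra_simps)
  finally show ?thesis .
qed

lemma hyp_class_eq_iff: "hyp_class N s = hyp_class N t \<longleftrightarrow> hyp_poly N dvd s - t"
proof
  assume "hyp_class N s = hyp_class N t"
  moreover have "s \<in> hyp_class N s" by (simp add: hyp_class_conv)
  ultimately show "hyp_poly N dvd s - t" by (simp add: hyp_class_conv)
next
  assume *: "hyp_poly N dvd s - t"
  have "hyp_poly N dvd u - t \<longleftrightarrow> hyp_poly N dvd u - s" for u
    using dvd_add_right_iff[OF *, of "u - s"] by simp
  thus "hyp_class N s = hyp_class N t" by (simp add: hyp_class_conv)
qed

lemma carrier_hyp_ring_eq: "carrier (hyp_ring N) = range (hyp_class N)"
  by (simp add: carrier_hyp_ring hyp_class_def[abs_def])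

lemma hyp_class_closed [simp]: "hyp_class N s \<in> carrier (hyp_ring N)"
  by (simp add: carrier_hyp_ring_eq)

lemma hyp_class_hom [simp]:
  "hyp_class N s \<oplus>\<^bsub>hyp_ring N\<^esub> hyp_class N t = hyp_class N (s + t)"
  "hyp_class N s \<otimes>\<^bsub>hyp_ring N\<^esub> hyp_class N t = hyp_class N (s * t)"
  and hyp_ring_zero: "\<zero>\<^bsub>hyp_ring N\<^esub> = hyp_class N 0"
  and hyp_ring_one: "\<one>\<^bsub>hyp_ring N\<^esub> = hyp_class N 1"
  and hyp_class_minus [simp]: "\<ominus>\<^bsub>hyp_ring N\<^esub> hyp_class N s = hyp_class N (- s)"
proof -
  interpret q: ring_hom_ring power_series_ring "hyp_ring N" "(+>\<^bsub>power_series_ring\<^esub>) (hyp_ideal N)"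
    by (rule hyp_hom)
  show add: "hyp_class N s \<oplus>\<^bsub>hyp_ring N\<^esub> hyp_class N t = hyp_class N (s + t)" for s t
    using q.hom_add[of s t] by (simp add: hyp_class_def)
  show "hyp_class N s \<otimes>\<^bsub>hyp_ring N\<^esub> hyp_class N t = hyp_class N (s * t)"
    using q.hom_mult[of s t] by (simp add: hyp_class_def)
  show zero: "\<zero>\<^bsub>hyp_ring N\<^esub> = hyp_class N 0"
    using q.hom_zero by (simp add: hyp_class_def)
  show "\<one>\<^bsub>hyp_ring N\<^esub> = hyp_class N 1"
    using q.hom_one by (simp add: hyp_class_def)
  show "\<ominus>\<^bsub>hyp_ring N\<^esub> hyp_class N s = hyp_class N (- s)"
    by (rule q.S.minus_equality) (simp_all add: add zero)
qed

lemma hyp_class_power [simp]: "hyp_class N s [^]\<^bsub>hyp_ring N\<^esub> (n::nat) = hyp_class N (s ^ n)"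
  by (induction n) (simp_all add: hyp_ring_one nat_pow_def mult.commute)

lemma genideal_hyp_class:
  "hyp_class N t \<in> genideal (hyp_ring N) {hyp_class N s} \<longleftrightarrow> (\<exists>u v. t = u * s + v * hyp_poly N)"
proof -
  interpret R: cring "hyp_ring N" by (rule cring_hyp_ring)
  have "genideal (hyp_ring N) {hyp_class N s} = range (\<lambda>u. hyp_class N (u * s))"
    unfolding R.cgenideal_eq_genideal[OF hyp_class_closed, symmetric]
    by (auto simp: cgenideal_def carrier_hyp_ring_eq) (metis hyp_class_hom(2) rangeI)
  hence "hyp_class N t \<in> genideal (hyp_ring N) {hyp_class N s} \<longleftrightarrow> (\<exists>u. hyp_poly N dvd t - u * s)"
    by (auto simp: hyp_class_eq_iff)
  also have "\<dots> \<longleftrightarrow> (\<exists>u v. t = u * s + v * hyp_poly N)"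
    by (auto simp: dvd_def algebra_simps)
  finally show ?thesis .
qed

lemma hyp_poly_ord_ideal: "hyp_poly N \<in> ord_ideal (N + 2)"
proof -
  have "X_ser * Y_ser \<in> ord_ideal (1 + 1)"
    by (intro ord_ideal_mult X_ord_ideal Y_ord_ideal)
  moreover have "X_ser ^ N + Y_ser ^ N \<in> ord_ideal N"
    by (intro ord_ideal_add ord_ideal_power X_ord_ideal Y_ord_ideal)
  ultimately have "hyp_poly N \<in> ord_ideal ((1 + 1) + N)"
    unfolding hyp_poly_def by (rule ord_ideal_mult)
  thus ?thesis by (simp add: add.commute)
qed

lemma hyp_class_in_image_iff:
  assumes "n \<le> N + 2"
  shows "hyp_class N s \<in> hyp_class N ` ord_ideal n \<longleftrightarrow> s \<in> ord_ideal n"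
proof
  assume "hyp_class N s \<in> hyp_class N ` ord_ideal n"
  then obtain t where t: "t \<in> ord_ideal n" "hyp_poly N dvd s - t" by (auto simp: hyp_class_eq_iff)
  have "hyp_poly N \<in> ord_ideal n" using hyp_poly_ord_ideal ord_ideal_antimono[OF assms] by blast
  hence "s - t \<in> ord_ideal n" using t(2) by (auto elim!: dvdE intro: ord_ideal_mult_right)
  from ord_ideal_add[OF this t(1)] show "s \<in> ord_ideal n" by simp
qed simp

lemma ideal_hyp_class_image: "ideal (hyp_class N ` ord_ideal n) (hyp_ring N)"
proof -
  interpret R: cring "hyp_ring N" by (rule cring_hyp_ring)
  show ?thesis
  proof (rule idealI)
    show "subgroup (hyp_class N ` ord_ideal n) (add_monoid (hyp_ring N))"
      by (rule R.add.subgroupI)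
        (auto simp: hyp_ring_zero char2 intro!: imageI intro: ord_ideal_add zero_ord_ideal)
  qed (auto simp: R.ring_axioms carrier_hyp_ring_eq intro!: imageI
         intro: ord_ideal_mult_left ord_ideal_mult_right)
qed

lemma max_ideal_conv: "max_ideal (hyp_ring N) = hyp_class N ` ord_ideal 1"
proof -
  interpret R: cring "hyp_ring N" by (rule cring_hyp_ring)
  define m where "m = genideal (hyp_ring N) {hyp_x N, hyp_y N}"
  have xy: "hyp_x N = hyp_class N X_ser" "hyp_y N = hyp_class N Y_ser"
    by (simp_all add: hyp_x_def hyp_y_def hyp_class_def)
  have sub: "{hyp_x N, hyp_y N} \<subseteq> carrier (hyp_ring N)" by (simp add: xy)
  interpret m: ideal m "hyp_ring N" unfolding m_def by (rule R.genideal_ideal[OF sub])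
  have gens: "hyp_class N X_ser \<in> m" "hyp_class N Y_ser \<in> m"
    using R.genideal_self[OF sub] by (auto simp: m_def xy)
  have "m = hyp_class N ` ord_ideal 1"
  proof
    show "m \<subseteq> hyp_class N ` ord_ideal 1" unfolding m_def
      by (rule R.genideal_minimal[OF ideal_hyp_class_image])
        (use X_ord_ideal Y_ord_ideal in \<open>auto simp: xy\<close>)
    show "hyp_class N ` ord_ideal 1 \<subseteq> m"
    proof safe
      fix g assume "g \<in> ord_ideal 1"
      then obtain a b where "g = a * X_ser + b * Y_ser"
        using ord_ideal_Suc_decomp[of g 0] by auto
      hence "hyp_class N g = hyp_class N a \<otimes>\<^bsub>hyp_ring N\<^esub> hyp_class N X_ser
          \<oplus>\<^bsub>hyp_ring N\<^esub> hyp_class N b \<otimes>\<^bsub>hyp_ring N\<^esub> hyp_class N Y_ser" by simp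
      thus "hyp_class N g \<in> m"
        using gens by (auto simp del: hyp_class_hom intro!: m.a_closed m.I_l_closed)
    qed
  qed
  thus ?thesis by (simp add: max_ideal_hyp_ring(2) m_def)
qed

lemma max_ideal_pow: "ideal_pow (hyp_ring N) (max_ideal (hyp_ring N)) n = hyp_class N ` ord_ideal n"
proof (induction n)
  case 0
  show ?case by (simp add: nat_pow_def ideals_set_def carrier_hyp_ring_eq)
next
  case (Suc n)
  have "ideal_prod (hyp_ring N) (hyp_class N ` ord_ideal n) (hyp_class N ` ord_ideal 1)
      = hyp_class N ` ord_ideal (Suc n)" (is "?P = ?I")
  proof
    show "?P \<subseteq> ?I"
    proof
      fix u assume "u \<in> ?P"
      thus "u \<in> ?I"
      proof (induction u rule: ideal_prod.induct)
        case (prod i j)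
        thus ?case using ord_ideal_mult[of _ n _ 1] by fastforce
      next
        case (sum u v)
        thus ?case by (auto intro: ord_ideal_add)
      qed
    qed
    show "?I \<subseteq> ?P"
    proof safe
      fix g assume "g \<in> ord_ideal (Suc n)"
      then obtain a b where ab: "a \<in> ord_ideal n" "b \<in> ord_ideal n" "g = a * X_ser + b * Y_ser"
        by (rule ord_ideal_Suc_decomp)
      have "hyp_class N a \<otimes>\<^bsub>hyp_ring N\<^esub> hyp_class N X_ser
          \<oplus>\<^bsub>hyp_ring N\<^esub> hyp_class N b \<otimes>\<^bsub>hyp_ring N\<^esub> hyp_class N Y_ser \<in> ?P"
        using ab X_ord_ideal Y_ord_ideal by (intro ideal_prod.intros) auto
      thus "hyp_class N g \<in> ?P" by (simp add: ab(3))
    qed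
  qed
  thus ?case using Suc by (simp add: nat_pow_def ideals_set_def max_ideal_conv)
qed

section \<open>The cyclic modules \<open>R / m\<^sup>n\<close>\<close>

definition trunc :: "nat \<Rightarrow> nat \<Rightarrow> bit fps fps \<Rightarrow> bit fps fps set set"
  where "trunc N n s = ideal_pow (hyp_ring N) (max_ideal (hyp_ring N)) n +>\<^bsub>hyp_ring N\<^esub> hyp_class N s"

abbreviation trunc_module :: "nat \<Rightarrow> nat \<Rightarrow> (bit fps fps set, bit fps fps set set) module"
  where "trunc_module N n \<equiv> quot_module (hyp_ring N) (ideal_pow (hyp_ring N) (max_ideal (hyp_ring N)) n)"

lemma trunc_module_ops:
  "carrier (trunc_module N n) = range (trunc N n)"
  "trunc N n s \<oplus>\<^bsub>trunc_module N n\<^esub> trunc N n t = trunc N n (s + t)"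
  "hyp_class N a \<odot>\<^bsub>trunc_module N n\<^esub> trunc N n s = trunc N n (a * s)"
proof -
  interpret I: ideal "ideal_pow (hyp_ring N) (max_ideal (hyp_ring N)) n" "hyp_ring N"
    unfolding max_ideal_pow by (rule ideal_hyp_class_image)
  show "carrier (trunc_module N n) = range (trunc N n)"
    by (auto simp: quot_module_def FactRing_def A_RCOSETS_def' carrier_hyp_ring_eq trunc_def)
  show "trunc N n s \<oplus>\<^bsub>trunc_module N n\<^esub> trunc N n t = trunc N n (s + t)"
    by (simp add: quot_module_def FactRing_def trunc_def I.a_rcos_sum)
  show "hyp_class N a \<odot>\<^bsub>trunc_module N n\<^esub> trunc N n s = trunc N n (a * s)"
    by (simp add: quot_module_def FactRing_def trunc_def I.rcoset_mult_add)
qed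

text \<open>
  The bound on \<open>n\<close> is the order of the equation: up to there \<open>R / m\<^sup>n\<close> is a truncation of the power
  series ring itself.
\<close>

lemma trunc_eq_iff:
  assumes "n \<le> N + 2"
  shows "trunc N n s = trunc N n t \<longleftrightarrow> s - t \<in> ord_ideal n"
proof -
  interpret R: cring "hyp_ring N" by (rule cring_hyp_ring)
  let ?I = "ideal_pow (hyp_ring N) (max_ideal (hyp_ring N)) n"
  have I: "ideal ?I (hyp_ring N)"
    unfolding max_ideal_pow by (rule ideal_hyp_class_image)
  have "trunc N n s = trunc N n t \<longleftrightarrow> hyp_class N s \<ominus>\<^bsub>hyp_ring N\<^esub> hyp_class N t \<in> ?I"
    unfolding trunc_def using R.quotient_eq_iff_same_a_r_cos[OF I, of "hyp_class N s" "hyp_class N t"]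
    by simp
  also have "hyp_class N s \<ominus>\<^bsub>hyp_ring N\<^esub> hyp_class N t = hyp_class N (s - t)"
    by (simp add: a_minus_def)
  also have "\<dots> \<in> ?I \<longleftrightarrow> s - t \<in> ord_ideal n"
    unfolding max_ideal_pow using assms by (rule hyp_class_in_image_iff)
  finally show ?thesis .
qed

section \<open>Algebraic dependence modulo a factor of the equation\<close>

text \<open>
  Induction on the number of coordinates: a pivot \<open>k\<close> eliminates the last coordinate of the other
  vectors. Cross-multiplication instead of division keeps all coefficients in the domain.
\<close>

lemma linear_dependence:
  fixes v :: "'b \<Rightarrow> nat \<Rightarrow> 'a::idom"
  assumes "finite I" "d < card I"
  shows "\<exists>c. (\<exists>i\<in>I. c i \<noteq> 0) \<and> (\<forall>j<d. (\<Sum>i\<in>I. c i * v i j) = 0)"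
  using assms
proof (induction d arbitrary: I v)
  case 0
  hence "I \<noteq> {}" by auto
  thus ?case by (intro exI[of _ "\<lambda>_. 1"]) auto
next
  case (Suc d)
  show ?case
  proof (cases "\<forall>i\<in>I. v i d = 0")
    case True
    obtain c where "\<exists>i\<in>I. c i \<noteq> 0" "\<forall>j<d. (\<Sum>i\<in>I. c i * v i j) = 0"
      using Suc.IH[of I v] Suc.prems by auto
    thus ?thesis using True by (intro exI[of _ c]) (auto simp: less_Suc_eq)
  next
    case False
    then obtain k where k: "k \<in> I" "v k d \<noteq> 0" by auto
    define w where "w = (\<lambda>i j. v k d * v i j - v i d * v k j)"
    have "d < card (I - {k})" using Suc.prems k by simp
    then obtain c where c: "\<exists>i\<in>I - {k}. c i \<noteq> 0" "\<forall>j<d. (\<Sum>i\<in>I - {k}. c i * w i j) = 0"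
      using Suc.IH[of "I - {k}" w] Suc.prems by auto
    define c' where "c' = (\<lambda>i. if i = k then - (\<Sum>i\<in>I - {k}. c i * v i d) else v k d * c i)"
    have "(\<Sum>i\<in>I. c' i * v i j) = (\<Sum>i\<in>I - {k}. c i * w i j)" for j
    proof -
      have "(\<Sum>i\<in>I. c' i * v i j) = c' k * v k j + (\<Sum>i\<in>I - {k}. c' i * v i j)"
        using Suc.prems k by (intro sum.remove)
      also have "c' k * v k j = (\<Sum>i\<in>I - {k}. - (c i * v i d * v k j))"
        by (simp add: c'_def sum_distrib_right sum_negf)
      also have "\<dots> + (\<Sum>i\<in>I - {k}. c' i * v i j) = (\<Sum>i\<in>I - {k}. c i * w i j)"
        unfolding sum.distrib[symmetric] by (rule sum.cong) (auto simp: c'_def w_def algebra_simps)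
      finally show ?thesis .
    qed
    moreover have "(\<Sum>i\<in>I - {k}. c i * w i d) = 0" by (simp add: w_def)
    ultimately have "\<forall>j<Suc d. (\<Sum>i\<in>I. c' i * v i j) = 0" using c(2) by (auto simp: less_Suc_eq)
    moreover have "\<exists>i\<in>I. c' i \<noteq> 0" using c(1) k by (auto simp: c'_def)
    ultimately show ?thesis by blast
  qed
qed

text \<open>
  The equation of the hypersurface divided by \<open>x\<close>. It is monic in \<open>y\<close>, so the quotient by it is finite
  over \<open>F\<^sub>2[[x]]\<close>, and its order \<open>N + 1\<close> is one less than that of the equation.
\<close>

definition cofactor :: "nat \<Rightarrow> bit fps fps"
  where "cofactor N = Y_ser * (X_ser ^ N + Y_ser ^ N)"

lemma hyp_poly_cofactor: "hyp_poly N = X_ser * cofactor N"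
  by (simp only: hyp_poly_def cofactor_def mult.assoc)

lemma cofactor_ord_ideal: "cofactor N \<in> ord_ideal (N + 1)"
  unfolding cofactor_def using ord_ideal_mult[of Y_ser 1 "X_ser ^ N + Y_ser ^ N" N]
  by (simp only: add.commute[of N] Y_ord_ideal X_ord_ideal ord_ideal_power ord_ideal_add)

lemma fps_const_sum: "fps_const (\<Sum>i\<in>A. f i) = (\<Sum>i\<in>A. fps_const (f i))"
  by (induction A rule: infinite_finite_induct) (simp_all flip: fps_const_add)

text \<open>
  Division by \<open>y\<close> followed by division by \<open>y\<^sup>N + x\<^sup>N\<close>.
\<close>

lemma cofactor_spanning:
  assumes "N > 0"
  obtains a where "cofactor N dvd s - (\<Sum>j<Suc N. fps_const (a j) * Y_ser ^ j)"
proof -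
  define s' where "s' = fps_shift 1 s"
  have s: "s = fps_const (fps_nth s 0) + Y_ser * s'"
    by (rule fps_ext) (simp add: s'_def)
  obtain a h where ah: "s' = (\<Sum>j<N. fps_const (a j) * Y_ser ^ j) + (Y_ser ^ N - X_ser ^ N) * h"
    by (rule weierstrass_division[OF assms])
  define a' where "a' = (\<lambda>j. case j of 0 \<Rightarrow> fps_nth s 0 | Suc j \<Rightarrow> a j)"
  have "(\<Sum>j<Suc N. fps_const (a' j) * Y_ser ^ j)
      = fps_const (fps_nth s 0) + (\<Sum>j<N. Y_ser * (fps_const (a j) * Y_ser ^ j))"
    unfolding sum.lessThan_Suc_shift by (simp add: a'_def mult_ac)
  also have "\<dots> = fps_const (fps_nth s 0) + Y_ser * (\<Sum>j<N. fps_const (a j) * Y_ser ^ j)"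
    by (simp only: sum_distrib_left)
  finally have "s - (\<Sum>j<Suc N. fps_const (a' j) * Y_ser ^ j) = Y_ser * ((Y_ser ^ N - X_ser ^ N) * h)"
    by (subst s, subst ah) (simp only: distrib_left add_diff_cancel_left add_diff_cancel_left')
  also have "\<dots> = cofactor N * h"
    unfolding cofactor_def char2(3) by (simp only: add.commute mult.assoc)
  finally show thesis by (intro that[of a']) simp
qed

text \<open>
  The \<open>N + 2\<close> elements \<open>1, q, \<dots>, q\<^bsup>N+1\<^esup>\<close> lie in a module with \<open>N + 1\<close> generators over \<open>F\<^sub>2[[x]]\<close>.
\<close>

lemma algebraic_mod_cofactor:
  assumes "N > 0"
  obtains c where "\<exists>i\<le>Suc N. c i \<noteq> 0" "cofactor N dvd (\<Sum>i\<le>Suc N. fps_const (c i) * q ^ i)"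
proof -
  have "\<exists>a. cofactor N dvd q ^ i - (\<Sum>j<Suc N. fps_const (a j) * Y_ser ^ j)" for i
    using cofactor_spanning[OF assms, of "q ^ i"] by metis
  then obtain a where a: "\<And>i. cofactor N dvd q ^ i - (\<Sum>j<Suc N. fps_const (a i j) * Y_ser ^ j)"
    by metis
  obtain c where c: "\<exists>i\<in>{..Suc N}. c i \<noteq> 0" "\<And>j. j < Suc N \<Longrightarrow> (\<Sum>i\<le>Suc N. c i * a i j) = 0"
    using linear_dependence[of "{..Suc N}" "Suc N" a] by auto
  have "(\<Sum>i\<le>Suc N. fps_const (c i) * (\<Sum>j<Suc N. fps_const (a i j) * Y_ser ^ j))
      = (\<Sum>j<Suc N. \<Sum>i\<le>Suc N. fps_const (c i * a i j) * Y_ser ^ j)"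
    unfolding sum_distrib_left mult.assoc[symmetric] fps_const_mult by (rule sum.swap)
  also have "\<dots> = (\<Sum>j<Suc N. fps_const (\<Sum>i\<le>Suc N. c i * a i j) * Y_ser ^ j)"
    unfolding sum_distrib_right[symmetric] by (simp only: fps_const_sum)
  also have "\<dots> = 0" by (rule sum.neutral) (simp add: c(2) del: sum.atMost_Suc)
  finally have "(\<Sum>i\<le>Suc N. fps_const (c i) * q ^ i)
      = (\<Sum>i\<le>Suc N. fps_const (c i) * (q ^ i - (\<Sum>j<Suc N. fps_const (a i j) * Y_ser ^ j)))"
    unfolding right_diff_distrib sum_subtractf by simp
  also have "cofactor N dvd \<dots>" by (intro dvd_sum dvd_mult a)
  finally show thesis using c(1) by (intro that[of c]) auto
qed

lemma fps_mult_eq_X_power: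
  fixes c :: "'a::field fps"
  assumes "c \<noteq> 0"
  obtains e n where "e * c = fps_X ^ n"
proof -
  define n where "n = subdegree c"
  define u where "u = fps_shift n c"
  have "fps_nth u 0 \<noteq> 0" using assms by (simp add: u_def n_def)
  hence u: "inverse u * u = 1" by (rule inverse_mult_eq_1)
  have "c = u * fps_X ^ n" unfolding u_def n_def by (rule subdegree_decompose)
  hence "inverse u * c = fps_X ^ n" using u by (simp add: mult.assoc[symmetric])
  thus thesis by (rule that)
qed

lemma ord_ideal_split:
  assumes "g \<in> ord_ideal (a + b)"
  obtains u w where "g = X_ser ^ a * u + Y_ser ^ b * w"
proof
  define u where "u = Abs_fps (\<lambda>j. if j < b then fps_shift a (fps_nth g j) else 0)"
  show "g = X_ser ^ a * u + Y_ser ^ b * fps_shift b g"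
  proof (intro fps_ext)
    fix i j
    show "cf g i j = cf (X_ser ^ a * u + Y_ser ^ b * fps_shift b g) i j"
      using assms by (auto simp: u_def fps_X_power_mult_nth ord_ideal_def)
  qed
qed

text \<open>
  Ideals of the power series ring, in type-class notation.
\<close>

locale series_ideal =
  fixes I :: "bit fps fps set"
  assumes zero [simp]: "0 \<in> I"
    and add: "a \<in> I \<Longrightarrow> b \<in> I \<Longrightarrow> a + b \<in> I"
    and mult: "a \<in> I \<Longrightarrow> r * a \<in> I"
begin

lemma mult': "a \<in> I \<Longrightarrow> a * r \<in> I"
  using mult[of a r] by (simp add: mult.commute)

lemma diff: "a \<in> I \<Longrightarrow> b \<in> I \<Longrightarrow> a - b \<in> I"
  unfolding char2 by (rule add)

lemma dvd_mem: "a \<in> I \<Longrightarrow> a dvd b \<Longrightarrow> b \<in> I"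
  by (auto elim!: dvdE intro: mult')

text \<open>
  The set in question is the ideal \<open>I + (q)\<close>.
\<close>

lemma extend_series_ideal: "series_ideal {a. \<exists>u. a - u * q \<in> I}"
proof
  show "0 \<in> {a. \<exists>u. a - u * q \<in> I}" by (auto intro: exI[of _ 0])
next
  fix a b assume "a \<in> {a. \<exists>u. a - u * q \<in> I}" "b \<in> {a. \<exists>u. a - u * q \<in> I}"
  then obtain u v where "a - u * q \<in> I" "b - v * q \<in> I" by auto
  hence "(a + b) - (u + v) * q \<in> I" using add[of "a - u * q" "b - v * q"] by (simp add: algebra_simps)
  thus "a + b \<in> {a. \<exists>u. a - u * q \<in> I}" by blast
next
  fix a r assume "a \<in> {a. \<exists>u. a - u * q \<in> I}"
  then obtain u where "a - u * q \<in> I" by auto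
  hence "r * a - (r * u) * q \<in> I" using mult[of "a - u * q" r] by (simp add: algebra_simps)
  thus "r * a \<in> {a. \<exists>u. a - u * q \<in> I}" by blast
qed

lemma ord_ideal_subset_if_powers:
  assumes "X_ser ^ a \<in> I" "Y_ser ^ b \<in> I" shows "ord_ideal (a + b) \<subseteq> I"
proof
  fix g assume "g \<in> ord_ideal (a + b)"
  then obtain u w where "g = X_ser ^ a * u + Y_ser ^ b * w" by (rule ord_ideal_split)
  thus "g \<in> I" using assms by (auto simp del: fps_const_power intro!: add mult')
qed

text \<open>
  As long as the constant coefficient of the relation vanishes, \<open>q\<close> can be cancelled from it. The first
  nonzero coefficient then lies in \<open>I + (q)\<close>, and it is a unit times a power of \<open>x\<close>.
\<close>

lemma X_power_mem_if_relation:
  assumes nzd: "\<And>s. q * s \<in> I \<Longrightarrow> s \<in> I"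
    and "\<exists>i\<le>d. c i \<noteq> 0" "(\<Sum>i\<le>d. fps_const (c i) * q ^ i) \<in> I"
  shows "\<exists>j u. X_ser ^ j - u * q \<in> I"
  using assms(2,3)
proof (induction d arbitrary: c)
  case (Suc d)
  define t where "t = (\<Sum>i\<le>d. fps_const (c (Suc i)) * q ^ i)"
  have eq: "(\<Sum>i\<le>Suc d. fps_const (c i) * q ^ i) = fps_const (c 0) + q * t"
    unfolding sum.atMost_Suc_shift t_def sum_distrib_left by (simp add: mult_ac)
  show ?case
  proof (cases "c 0 = 0")
    case True
    hence "q * t \<in> I" using Suc.prems(2) eq by simp
    hence "t \<in> I" by (rule nzd)
    moreover have "\<exists>i\<le>d. c (Suc i) \<noteq> 0" using Suc.prems(1) True by (metis not0_implies_Suc Suc_le_mono)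
    ultimately show ?thesis using Suc.IH[of "\<lambda>i. c (Suc i)"] by (simp add: t_def)
  next
    case False
    obtain e n where "e * c 0 = fps_X ^ n" by (rule fps_mult_eq_X_power[OF False])
    hence "fps_const e * fps_const (c 0) = X_ser ^ n" by simp
    hence "fps_const e * (fps_const (c 0) + q * t) = X_ser ^ n - (fps_const e * t) * q"
      unfolding char2(3) distrib_left by (simp only: mult_ac)
    moreover have "fps_const e * (fps_const (c 0) + q * t) \<in> I"
      using Suc.prems(2) eq by (intro mult) simp
    ultimately show ?thesis by metis
  qed
next
  case 0
  hence nz: "c 0 \<noteq> 0" and c0: "fps_const (c 0) \<in> I" by simp_all
  obtain e n where "e * c 0 = fps_X ^ n" by (rule fps_mult_eq_X_power[OF nz])
  hence "X_ser ^ n - 0 * q = fps_const e * fps_const (c 0)" by simp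
  thus ?case using mult[OF c0] by metis
qed

text \<open>
  The quotient by the cofactor has dimension one: an element that is a nonzerodivisor modulo \<open>I\<close>
  generates, together with \<open>I\<close>, an ideal that contains a power of the maximal ideal. A power of \<open>x\<close> is
  obtained from algebraic dependence, and \<open>y\<^bsup>N+1\<^esup> \<equiv> x\<^sup>N y\<close> modulo the cofactor then yields a power of \<open>y\<close>.
\<close>

lemma power_subset_if_nonzerodivisor_mod_cofactor:
  assumes "N > 0" "cofactor N \<in> I" and nzd: "\<And>s. q * s \<in> I \<Longrightarrow> s \<in> I"
  shows "\<exists>k. \<forall>a\<in>ord_ideal k. \<exists>u. a - u * q \<in> I"
proof -
  interpret J: series_ideal "{a. \<exists>u. a - u * q \<in> I}" by (rule extend_series_ideal)
  let ?J = "{a. \<exists>u. a - u * q \<in> I}"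
  obtain c where c: "\<exists>i\<le>Suc N. c i \<noteq> 0" "cofactor N dvd (\<Sum>i\<le>Suc N. fps_const (c i) * q ^ i)"
    by (rule algebraic_mod_cofactor[OF assms(1)])
  obtain j where j: "X_ser ^ j \<in> ?J"
    using X_power_mem_if_relation[OF nzd c(1) dvd_mem[OF assms(2) c(2)]] by auto
  have cof: "cofactor N \<in> ?J" using assms(2) by (auto intro: exI[of _ 0])
  have "cofactor N = Y_ser ^ Suc N - X_ser ^ N * Y_ser"
    unfolding char2(3) by (simp only: cofactor_def distrib_left power_Suc add.commute mult.commute)
  moreover have "Y_ser ^ Suc N - X_ser ^ N * Y_ser dvd (Y_ser ^ Suc N) ^ j - (X_ser ^ N * Y_ser) ^ j"
    unfolding power_diff_sumr2[of "Y_ser ^ Suc N"] by (rule dvd_triv_left)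
  ultimately have "(Y_ser ^ Suc N) ^ j - (X_ser ^ N * Y_ser) ^ j \<in> ?J"
    using J.dvd_mem[OF cof] by simp
  moreover have "X_ser ^ j dvd (X_ser ^ N * Y_ser) ^ j"
  proof -
    have "(X_ser ^ N * Y_ser) ^ j = (X_ser ^ j) ^ N * Y_ser ^ j"
      by (simp only: power_mult_distrib power_mult[symmetric] mult.commute[of N])
    moreover have "X_ser ^ j dvd (X_ser ^ j) ^ N" using assms(1) by (intro dvd_power) simp
    ultimately show ?thesis by (metis dvd_mult2)
  qed
  hence "(X_ser ^ N * Y_ser) ^ j \<in> ?J" by (rule J.dvd_mem[OF j])
  ultimately have "(Y_ser ^ Suc N) ^ j \<in> ?J" using J.add by fastforce
  hence "Y_ser ^ (Suc N * j) \<in> ?J" by (simp only: power_mult)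
  from J.ord_ideal_subset_if_powers[OF j this] show ?thesis by blast
qed

text \<open>
  The same on the component \<open>x = 0\<close>, where the quotient ring is \<open>F\<^sub>2[[y]]\<close>: a nonzero element of it is a
  unit times a power of \<open>y\<close>.
\<close>

lemma power_subset_if_notin_mod_X:
  assumes X: "X_ser \<in> I" and q: "q \<notin> I"
  shows "\<exists>k. \<forall>a\<in>ord_ideal k. \<exists>u. a - u * q \<in> I"
proof -
  interpret J: series_ideal "{a. \<exists>u. a - u * q \<in> I}" by (rule extend_series_ideal)
  let ?J = "{a. \<exists>u. a - u * q \<in> I}"
  define q0 where "q0 = Abs_fps (\<lambda>j. fps_const (cf q 0 j))"
  define q1 where "q1 = Abs_fps (\<lambda>j. fps_shift 1 (fps_nth q j))"
  have eq: "q = q0 + X_ser * q1"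
  proof (intro fps_ext)
    show "cf q i j = cf (q0 + X_ser * q1) i j" for i j
      by (cases i) (simp_all add: q0_def q1_def)
  qed
  have "q0 \<noteq> 0" using eq q X mult'[of X_ser q1] by auto
  define n where "n = subdegree q0"
  define e where "e = fps_shift n q0"
  have "fps_nth e 0 \<noteq> 0" using \<open>q0 \<noteq> 0\<close> by (simp add: e_def n_def)
  hence "cf e 0 0 \<noteq> 0" by (auto simp: e_def q0_def)
  from unit_series[OF this] obtain h where h: "h * e = 1" by blast
  have "q0 = e * Y_ser ^ n" unfolding e_def n_def by (rule subdegree_decompose)
  hence "h * q0 = Y_ser ^ n" using h by (simp add: mult.assoc[symmetric])
  hence "Y_ser ^ n - h * q = - (h * q1) * X_ser" by (subst eq) (simp add: algebra_simps)
  hence "Y_ser ^ n - h * q \<in> I" using mult[OF X] by metis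
  hence Y: "Y_ser ^ n \<in> ?J" by blast
  have "X_ser ^ 1 \<in> ?J" using X by (auto intro: exI[of _ 0])
  from J.ord_ideal_subset_if_powers[OF this Y] show ?thesis by blast
qed

end

section \<open>The ring has Krull dimension one\<close>

lemma primeideal_preimage:
  assumes "primeideal P (hyp_ring N)"
  shows "series_ideal {s. hyp_class N s \<in> P}" and "1 \<notin> {s. hyp_class N s \<in> P}"
    and "\<And>a b. a * b \<in> {s. hyp_class N s \<in> P} \<Longrightarrow> a \<in> {s. hyp_class N s \<in> P} \<or> b \<in> {s. hyp_class N s \<in> P}"
    and "hyp_poly N \<in> {s. hyp_class N s \<in> P}"
proof -
  interpret P: primeideal P "hyp_ring N" by fact
  have zero: "hyp_class N 0 \<in> P" 
    using additive_subgroup.zero_closed[OF P.is_additive_subgroup] unfolding hyp_ring_zero .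
  show "series_ideal {s. hyp_class N s \<in> P}"
  proof
    show "0 \<in> {s. hyp_class N s \<in> P}" using zero by simp
  next
    fix a b assume "a \<in> {s. hyp_class N s \<in> P}" "b \<in> {s. hyp_class N s \<in> P}"
    thus "a + b \<in> {s. hyp_class N s \<in> P}"
      using additive_subgroup.a_closed[OF P.is_additive_subgroup, of "hyp_class N a" "hyp_class N b"] by simp
  next
    fix a r assume "a \<in> {s. hyp_class N s \<in> P}"
    thus "r * a \<in> {s. hyp_class N s \<in> P}"
      using P.I_l_closed[of "hyp_class N a" "hyp_class N r"] by simp
  qed
  show "1 \<notin> {s. hyp_class N s \<in> P}"
    using P.one_imp_carrier P.I_notcarr by (auto simp: hyp_ring_one)
  show "a \<in> {s. hyp_class N s \<in> P} \<or> b \<in> {s. hyp_class N s \<in> P}"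
    if "a * b \<in> {s. hyp_class N s \<in> P}" for a b
    using P.I_prime[of "hyp_class N a" "hyp_class N b"] that by simp
  have "hyp_class N (hyp_poly N) = hyp_class N 0" by (simp add: hyp_class_eq_iff)
  thus "hyp_poly N \<in> {s. hyp_class N s \<in> P}" using zero by simp
qed

text \<open>
  A prime \<open>P\<close> contains the equation, hence \<open>x\<close> or the cofactor. On either component an element
  \<open>q\<close> of \<open>Q\<close> outside \<open>P\<close> generates, together with \<open>P\<close>, an ideal that contains a power of the maximal
  ideal.
\<close>

lemma max_ideal_subset_nonminimal_prime:
  assumes N: "N > 0" and P: "primeideal P (hyp_ring N)" and Q: "primeideal Q (hyp_ring N)"
    and PQ: "P \<subset> Q"
  shows "ord_ideal 1 \<subseteq> {s. hyp_class N s \<in> Q}"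
proof
  interpret I: series_ideal "{s. hyp_class N s \<in> P}" by (rule primeideal_preimage[OF P])
  interpret J: series_ideal "{s. hyp_class N s \<in> Q}" by (rule primeideal_preimage[OF Q])
  note primeP = primeideal_preimage(3)[OF P]
  note primeQ = primeideal_preimage(3)[OF Q]
  have "Q \<subseteq> carrier (hyp_ring N)"
    using Q by (simp add: primeideal_def ideal_def additive_subgroup.a_subset)
  with PQ obtain q where q: "hyp_class N q \<in> Q" "hyp_class N q \<notin> P"
    by (auto simp: carrier_hyp_ring_eq)
  have "X_ser * cofactor N \<in> {s. hyp_class N s \<in> P}"
    using primeideal_preimage(4)[OF P] by (simp add: hyp_poly_cofactor)
  then consider "X_ser \<in> {s. hyp_class N s \<in> P}" | "cofactor N \<in> {s. hyp_class N s \<in> P}"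
    using primeP by blast
  hence "\<exists>k. \<forall>a\<in>ord_ideal k. \<exists>u. a - u * q \<in> {s. hyp_class N s \<in> P}"
  proof cases
    case 1
    thus ?thesis using q by (intro I.power_subset_if_notin_mod_X) auto
  next
    case 2
    show ?thesis
      by (rule I.power_subset_if_nonzerodivisor_mod_cofactor[OF N 2]) (use primeP q in blast)
  qed
  then obtain k where k: "\<And>a. a \<in> ord_ideal k \<Longrightarrow> \<exists>u. a - u * q \<in> {s. hyp_class N s \<in> P}" by blast
  fix a assume "a \<in> ord_ideal 1"
  hence "a ^ k \<in> ord_ideal k" by (rule ord_ideal_power)
  then obtain u where "a ^ k - u * q \<in> {s. hyp_class N s \<in> Q}" using k PQ by blast
  moreover have "u * q \<in> {s. hyp_class N s \<in> Q}" using q by (intro J.mult) simp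
  ultimately have "a ^ k \<in> {s. hyp_class N s \<in> Q}" using J.add by fastforce
  thus "a \<in> {s. hyp_class N s \<in> Q}"
    by (induction k) (use primeQ primeideal_preimage(2)[OF Q] in auto)
qed

text \<open>
  This is the prime \<open>(y)\<close>: the series vanishing at \<open>y = 0\<close>.
\<close>

lemma primeideal_Y:
  assumes "N > 0"
  shows "primeideal (hyp_class N ` {s. fps_nth s 0 = 0}) (hyp_ring N)"
proof -
  interpret R: cring "hyp_ring N" by (rule cring_hyp_ring)
  have mem: "hyp_class N s \<in> hyp_class N ` {s. fps_nth s 0 = 0} \<longleftrightarrow> fps_nth s 0 = 0" for s
  proof
    assume "hyp_class N s \<in> hyp_class N ` {s. fps_nth s 0 = 0}"
    then obtain t c where "fps_nth t 0 = 0" "s - t = hyp_poly N * c"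
      by (auto simp: hyp_class_eq_iff elim!: dvdE)
    moreover have "fps_nth (hyp_poly N * c) 0 = 0" by (simp add: hyp_poly_def)
    ultimately have "fps_nth (s - t) 0 = 0" "fps_nth t 0 = 0" by simp_all
    thus "fps_nth s 0 = 0" by simp
  qed simp
  show ?thesis
  proof (rule primeidealI[OF idealI])
    show "subgroup (hyp_class N ` {s. fps_nth s 0 = 0}) (add_monoid (hyp_ring N))"
      by (rule R.add.subgroupI)
        (auto simp: hyp_ring_zero intro!: imageI exI[of _ 0])
    show "carrier (hyp_ring N) \<noteq> hyp_class N ` {s. fps_nth s 0 = 0}"
    proof
      assume "carrier (hyp_ring N) = hyp_class N ` {s. fps_nth s 0 = 0}"
      with hyp_class_closed[of N 1] have "hyp_class N 1 \<in> hyp_class N ` {s. fps_nth s 0 = 0}" by metis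
      thus False unfolding mem by simp
    qed
    show "a \<in> hyp_class N ` {s. fps_nth s 0 = 0} \<or> b \<in> hyp_class N ` {s. fps_nth s 0 = 0}"
      if ab: "a \<in> carrier (hyp_ring N)" "b \<in> carrier (hyp_ring N)"
        "a \<otimes>\<^bsub>hyp_ring N\<^esub> b \<in> hyp_class N ` {s. fps_nth s 0 = 0}" for a b
    proof -
      obtain s t where "a = hyp_class N s" "b = hyp_class N t"
        using ab(1,2) by (auto simp: carrier_hyp_ring_eq)
      thus ?thesis using ab(3) by (simp add: mem)
    qed
  qed (auto simp: R.ring_axioms R.cring_axioms carrier_hyp_ring_eq intro!: imageI)
qed

lemma krull_dim_hyp_ring:
  assumes N: "N > 0" shows "krull_dim (hyp_ring N) = 1"
proof (rule antisym)
  interpret R: cring "hyp_ring N" by (rule cring_hyp_ring)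
  let ?m = "hyp_class N ` ord_ideal 1" and ?p = "hyp_class N ` {s. fps_nth s 0 = 0}"
  have max: "maximalideal ?m (hyp_ring N)"
    using max_ideal_hyp_ring[of N] max_ideal_conv[of N] by simp
  show "1 \<le> krull_dim (hyp_ring N)"
  proof -
    have "?p \<subset> ?m"
    proof
      show "?p \<subseteq> ?m" by (auto simp: ord_ideal_1 simp del: One_nat_def)
      have "hyp_class N X_ser \<notin> ?p"
      proof
        assume "hyp_class N X_ser \<in> ?p"
        then obtain t c where "fps_nth t 0 = 0" "X_ser - t = hyp_poly N * c"
          by (auto simp: hyp_class_eq_iff elim!: dvdE)
        moreover have "fps_nth (hyp_poly N * c) 0 = 0" by (simp add: hyp_poly_def)
        ultimately have "fps_nth (X_ser - t) 0 = 0" "fps_nth t 0 = 0" by simp_all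
        thus False by simp
      qed
      thus "?p \<noteq> ?m" using X_ord_ideal by blast
    qed
    moreover have "primeideal ?m (hyp_ring N)"
      by (rule R.maximalideal_prime[OF max])
    ultimately have "enat 1 \<in> {enat d | d. \<exists>P :: nat \<Rightarrow> bit fps fps set set.
        (\<forall>i\<le>d. primeideal (P i) (hyp_ring N)) \<and> (\<forall>i<d. P i \<subset> P (Suc i))}"
      using primeideal_Y[OF N]
      by (intro CollectI exI[of _ 1] conjI refl exI[of _ "\<lambda>i. if i = 0 then ?p else ?m"]) auto
    thus ?thesis unfolding krull_dim_def one_enat_def by (rule Sup_upper)
  qed
  show "krull_dim (hyp_ring N) \<le> 1" unfolding krull_dim_def
  proof (rule Sup_least, clarify)
    fix d and P :: "nat \<Rightarrow> bit fps fps set set"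
    assume P: "\<forall>i\<le>d. primeideal (P i) (hyp_ring N)" "\<forall>i<d. P i \<subset> P (Suc i)"
    show "enat d \<le> 1"
    proof (rule ccontr)
      assume "\<not> enat d \<le> 1"
      hence d: "2 \<le> d" by (simp add: one_enat_def)
      have prime: "primeideal (P 0) (hyp_ring N)" "primeideal (P 1) (hyp_ring N)" "primeideal (P 2) (hyp_ring N)"
        using P(1) d by auto
      have chain: "P 0 \<subset> P 1" "P 1 \<subset> P 2"
        using P(2)[rule_format, of 0] P(2)[rule_format, of 1] d by (auto simp: numeral_2_eq_2)
      have "P 2 \<subseteq> carrier (hyp_ring N)"
        using prime(3) by (simp add: primeideal_def ideal_def additive_subgroup.a_subset)
      with chain(2) obtain s where s: "hyp_class N s \<in> P 2" "hyp_class N s \<notin> P 1"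
        by (auto simp: carrier_hyp_ring_eq)
      have "s \<notin> ord_ideal 1"
        using max_ideal_subset_nonminimal_prime[OF N prime(1,2) chain(1)] s(2) by blast
      then obtain h where "h * s = 1" using unit_if_notin_ord_ideal by blast
      thus False
        using series_ideal.mult[OF primeideal_preimage(1)[OF prime(3)], of s h] s(1)
          primeideal_preimage(2)[OF prime(3)] by simp
    qed
  qed
qed

section \<open>Initial forms\<close>

text \<open>
  The homogeneous component of degree \<open>n\<close>, dehomogenized by \<open>x = 1\<close>.
\<close>

definition hcomp :: "nat \<Rightarrow> 'a::comm_ring_1 fps fps \<Rightarrow> 'a poly"
  where "hcomp n g = (\<Sum>j\<le>n. monom (fps_nth (fps_nth g j) (n - j)) j)"

lemma coeff_hcomp: "coeff (hcomp n g) j = (if j \<le> n then fps_nth (fps_nth g j) (n - j) else 0)"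
  by (simp add: hcomp_def coeff_sum sum.delta)

lemma degree_hcomp_le: "degree (hcomp n g) \<le> n"
  by (rule degree_le) (simp add: coeff_hcomp)

lemma hcomp_mult: "hcomp n (g * h) = (\<Sum>a=0..n. hcomp a g * hcomp (n - a) h)"
proof (rule poly_eqI)
  fix j
  define F where "F = (\<lambda>l a. coeff (hcomp a g) l * coeff (hcomp (n - a) h) (j - l))"
  have rhs: "coeff (\<Sum>a=0..n. hcomp a g * hcomp (n - a) h) j = (\<Sum>l=0..j. \<Sum>a=0..n. F l a)"
    unfolding coeff_sum coeff_mult F_def atLeast0AtMost by (rule sum.swap)
  show "coeff (hcomp n (g * h)) j = coeff (\<Sum>a=0..n. hcomp a g * hcomp (n - a) h) j"
  proof (cases "j \<le> n")
    case False
    have "F l a = 0" if "l \<le> j" "a \<le> n" for l a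
      using that False by (auto simp: F_def coeff_hcomp)
    thus ?thesis using False by (simp add: rhs coeff_hcomp)
  next
    case True
    have inner: "(\<Sum>a=0..n. F l a)
        = (\<Sum>i=0..n - j. fps_nth (fps_nth g l) i * fps_nth (fps_nth h (j - l)) (n - j - i))"
      if l: "l \<le> j" for l
    proof -
      have "(\<Sum>a=0..n. F l a) = (\<Sum>a=0+l..(n - j)+l. F l a)"
        by (rule sum.mono_neutral_right) (use l True in \<open>auto simp: F_def coeff_hcomp\<close>)
      also have "\<dots> = (\<Sum>i=0..n - j. F l (i + l))"
        by (rule sum.shift_bounds_cl_nat_ivl)
      also have "\<dots> = (\<Sum>i=0..n - j. fps_nth (fps_nth g l) i * fps_nth (fps_nth h (j - l)) (n - j - i))"
      proof (rule sum.cong[OF refl])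
        fix i assume i: "i \<in> {0..n - j}"
        have "n - (i + l) - (j - l) = n - j - i" "j - l \<le> n - (i + l)" using i l True by auto
        thus "F l (i + l) = fps_nth (fps_nth g l) i * fps_nth (fps_nth h (j - l)) (n - j - i)"
          by (simp add: F_def coeff_hcomp)
      qed
      finally show ?thesis .
    qed
    have "coeff (hcomp n (g * h)) j
        = (\<Sum>l=0..j. \<Sum>i=0..n - j. fps_nth (fps_nth g l) i * fps_nth (fps_nth h (j - l)) (n - j - i))"
      using True by (simp add: coeff_hcomp fps_mult_nth fps_sum_nth)
    also have "\<dots> = (\<Sum>l=0..j. \<Sum>a=0..n. F l a)"
      by (rule sum.cong) (simp_all add: inner)
    finally show ?thesis by (simp add: rhs)
  qed
qed

text \<open>
  The substitution \<open>x \<mapsto> t\<close>, \<open>y \<mapsto> T t\<close>, that is, a chart of the blow-up of the origin. It turns the order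
  of a series into the order in \<open>t\<close> of a power series over the domain \<open>F\<^sub>2[T]\<close>, so that initial forms
  become leading coefficients and are multiplicative.
\<close>

definition blowup :: "'a::comm_ring_1 fps fps \<Rightarrow> 'a poly fps"
  where "blowup g = Abs_fps (\<lambda>n. hcomp n g)"

lemma blowup_mult: "blowup (g * h) = blowup g * blowup h"
  by (rule fps_ext) (simp add: blowup_def hcomp_mult fps_mult_nth)

lemma blowup_add: "blowup (g + h) = blowup g + blowup h"
  by (rule fps_ext) (simp add: blowup_def hcomp_def add_monom[symmetric] sum.distrib)

lemma blowup_1: "blowup 1 = 1"
proof (rule fps_ext)
  show "fps_nth (blowup (1::'a fps fps)) n = fps_nth 1 n" for n
    by (rule poly_eqI) (auto simp: blowup_def coeff_hcomp)
qed

lemma blowup_power: "blowup (g ^ n) = blowup g ^ n"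
  by (induction n) (simp_all add: blowup_1 blowup_mult)

lemma blowup_X: "blowup (fps_const fps_X) = fps_X"
proof (rule fps_ext)
  show "fps_nth (blowup (fps_const fps_X :: 'a fps fps)) n = fps_nth fps_X n" for n
    by (rule poly_eqI) (auto simp: blowup_def coeff_hcomp)
qed

lemma blowup_Y: "blowup fps_X = fps_const [:0, 1:] * fps_X"
proof (rule fps_ext)
  show "fps_nth (blowup (fps_X :: 'a fps fps)) n = fps_nth (fps_const [:0, 1:] * fps_X) n" for n
    by (rule poly_eqI) (auto simp: blowup_def coeff_hcomp coeff_pCons split: nat.splits)
qed

lemma blowup_ord_ideal: "g \<in> ord_ideal n \<Longrightarrow> i < n \<Longrightarrow> fps_nth (blowup g) i = 0"
  by (rule poly_eqI) (auto simp: blowup_def coeff_hcomp ord_ideal_def)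

section \<open>The lower bound for the generalized Loewy length\<close>

lemma blowup_hyp_poly:
  "blowup (hyp_poly N) = fps_const (monom 1 1 + monom 1 (Suc N)) * fps_X ^ (N + 2)"
proof -
  have T: "[:0, 1:] = monom 1 (Suc 0)" by (simp add: monom_Suc monom_0)
  have "blowup (hyp_poly N)
      = fps_X * (fps_const [:0, 1:] * fps_X) * (fps_X ^ N + (fps_const [:0, 1:] * fps_X) ^ N)"
    by (simp only: hyp_poly_def blowup_mult blowup_add blowup_power blowup_X blowup_Y)
  also have "\<dots> = fps_const [:0, 1:] * (1 + fps_const [:0, 1:] ^ N) * fps_X ^ (N + 2)"
    by (simp add: power_mult_distrib power_add power2_eq_square algebra_simps del: fps_const_power)
  also have "fps_const [:0, 1:] * (1 + fps_const [:0, 1:] ^ N)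
      = fps_const ([:0, 1:] + [:0, 1:] * [:0, 1:] ^ N :: bit poly)"
    by (simp only: distrib_left mult_1_right fps_const_power fps_const_mult fps_const_add)
  also have "[:0, 1:] + [:0, 1:] * [:0, 1:] ^ N = monom 1 1 + monom (1::bit) (Suc N)"
    unfolding T monom_power mult_monom by simp
  finally show ?thesis .
qed

text \<open>
  Let \<open>d\<close> be the order and \<open>H\<close> the initial form of \<open>\<alpha>\<close>. If \<open>u \<alpha> + v f\<close> has order at least \<open>N + 2\<close>, the order
  of \<open>f\<close>, then so has \<open>u \<alpha>\<close>, and its component of degree \<open>N + 2\<close> is \<open>H\<close> times a form of degree
  \<open>N + 2 - d\<close>. The component of \<open>v f\<close> is a constant times the initial form \<open>T + T\<^bsup>N+1\<^esup>\<close> of \<open>f\<close>.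
\<close>

lemma initial_forms_of_ideal:
  assumes \<alpha>: "\<alpha> \<in> ord_ideal 1"
  shows "\<exists>d\<ge>1. \<exists>H. \<forall>g u v. g \<in> ord_ideal (N + 2) \<longrightarrow> g = u * \<alpha> + v * hyp_poly N \<longrightarrow>
    (\<exists>p e. hcomp (N + 2) g = p * H + [:e:] * (monom 1 1 + monom 1 (Suc N)) \<and>
           (p = 0 \<or> degree p + d \<le> N + 2))"
proof -
  define r where "r = N + 2"
  define h :: "bit poly" where "h = monom 1 1 + monom 1 (Suc N)"
  define A where "A = blowup \<alpha>"
  define d where "d = (if A = 0 then 1 else subdegree A)"
  have d: "d \<ge> 1"
  proof (cases "A = 0")
    case False
    have "fps_nth A 0 = 0" unfolding A_def using \<alpha> by (intro blowup_ord_ideal[of _ 1]) auto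
    thus ?thesis using False using subdegree_geI[OF False, of 1] by (simp add: d_def)
  qed (simp add: d_def)
  have main: "\<exists>p e. hcomp r g = p * fps_nth A d + [:e:] * h \<and> (p = 0 \<or> degree p + d \<le> r)"
    if g: "g \<in> ord_ideal r" and eq: "g = u * \<alpha> + v * hyp_poly N" for g u v
  proof -
    define U where "U = blowup u"
    have Theta: "blowup g = U * A + blowup v * fps_const h * fps_X ^ r"
      by (simp add: eq blowup_add blowup_mult blowup_hyp_poly U_def A_def h_def r_def mult.assoc)
    have V: "fps_nth (blowup v * fps_const h * fps_X ^ r) r = [:cf v 0 0:] * h"
      by (simp add: fps_X_power_mult_right_nth blowup_def hcomp_def monom_0)
    have low: "fps_nth (U * A) i = 0" if "i < r" for i
    proof -
      have "fps_nth (blowup g) i = fps_nth (U * A) i"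
        using that unfolding Theta fps_add_nth by (simp add: fps_X_power_mult_right_nth)
      thus ?thesis using blowup_ord_ideal[OF g that] by simp
    qed
    have top: "hcomp r g = fps_nth (U * A) r + [:cf v 0 0:] * h"
    proof -
      have "hcomp r g = fps_nth (blowup g) r" by (simp add: blowup_def)
      thus ?thesis unfolding Theta fps_add_nth V .
    qed
    show ?thesis
    proof (cases "fps_nth (U * A) r = 0")
      case True
      thus ?thesis using top by (intro exI[of _ 0] exI[of _ "cf v 0 0"]) simp
    next
      case False
      hence nz: "U * A \<noteq> 0" "U \<noteq> 0" "A \<noteq> 0" by auto
      have "subdegree (U * A) = r" using False low by (intro subdegreeI) auto
      hence sub: "subdegree U + d = r" using nz by (simp add: d_def)
      have "fps_nth (U * A) r = hcomp (subdegree U) u * fps_nth A d"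
        
      proof -
        have "fps_nth U (subdegree U) = hcomp (subdegree U) u" by (simp add: U_def blowup_def)
        thus ?thesis using nth_subdegree_mult[of U A] nz(3) unfolding sub[symmetric] by (simp add: d_def)
      qed
      moreover have "degree (hcomp (subdegree U) u) + d \<le> r"
        using degree_hcomp_le[of "subdegree U" u] sub by linarith
      ultimately show ?thesis using top by metis
    qed
  qed
  show ?thesis
    by (intro exI[of _ d] conjI d exI[of _ "fps_nth A d"] allI impI main[unfolded r_def h_def])
qed

text \<open>
  Suppose that all forms of degree \<open>N + 2\<close> are initial forms as in the preceding lemma. The constant
  in front of \<open>h = T + T\<^bsup>N+1\<^esup>\<close> is \<open>0\<close> or \<open>1\<close>, so among \<open>1\<close>, \<open>T\<close> and \<open>1 - T\<close> one is a multiple of \<open>H\<close>, and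
  \<open>H\<close> has degree at most \<open>1\<close>. The form \<open>T\<^bsup>N+2\<^esup>\<close> forces \<open>H\<close> to have degree at least \<open>d \<ge> 1\<close>. Hence \<open>H\<close> has
  degree one, and so a root in \<open>F\<^sub>2\<close>. But \<open>h\<close> vanishes at \<open>0\<close> and at \<open>1\<close>, since all lines over \<open>F\<^sub>2\<close> are
  tangent to the hypersurface, and the form \<open>1\<close> does not vanish at the root.
\<close>

lemma power_not_in_parameter_ideal:
  assumes N: "N > 0" and \<alpha>: "\<alpha> \<in> ord_ideal 1"
  shows "\<exists>g \<in> ord_ideal (N + 2). \<nexists>u v. g = u * \<alpha> + v * hyp_poly N"
proof (rule ccontr)
  assume "\<not> ?thesis"
  hence all: "\<exists>u v. g = u * \<alpha> + v * hyp_poly N" if "g \<in> ord_ideal (N + 2)" for g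
    using that by blast
  define r where "r = N + 2"
  define h :: "bit poly" where "h = monom 1 1 + monom 1 (Suc N)"
  obtain d H where d: "d \<ge> 1"
    and *: "\<forall>g u v. g \<in> ord_ideal (N + 2) \<longrightarrow> g = u * \<alpha> + v * hyp_poly N \<longrightarrow>
      (\<exists>p e. hcomp (N + 2) g = p * H + [:e:] * (monom 1 1 + monom 1 (Suc N)) \<and>
             (p = 0 \<or> degree p + d \<le> N + 2))"
    using initial_forms_of_ideal[OF \<alpha>, of N] by metis
  have forms: "\<exists>p e. hcomp r g = p * H + [:e:] * h \<and> (p = 0 \<or> degree p + d \<le> r)"
    if g: "g \<in> ord_ideal r" for g
    proof -
    have g': "g \<in> ord_ideal (N + 2)" using g by (simp add: r_def)
    then obtain u v where "g = u * \<alpha> + v * hyp_poly N" using all by blast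
    from *[rule_format, OF g' this] show ?thesis unfolding r_def h_def .
  qed
  have monomials: "\<exists>p e. monom 1 j = p * H + [:e:] * h \<and> (p = 0 \<or> degree p + d \<le> r)"
    if "j \<le> r" for j
  proof -
    have mem: "X_ser ^ (r - j) * Y_ser ^ j \<in> ord_ideal r"
      using ord_ideal_mult[OF ord_ideal_power[OF X_ord_ideal, of "r - j"] ord_ideal_power[OF Y_ord_ideal, of j]]
        that by simp
    have "hcomp r (X_ser ^ (r - j) * Y_ser ^ j) = monom 1 j"
      by (rule poly_eqI) (use that in \<open>auto simp: coeff_hcomp fps_X_power_mult_right_nth\<close>)
    with forms[OF mem] show ?thesis by simp
  qed
  have h0: "poly h 0 = 0" and h1: "poly h 1 = 0" by (simp_all add: h_def poly_monom)
  have hr: "coeff h r = 0" using N by (simp add: h_def r_def)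
  obtain p0 e0 where 0: "1 = p0 * H + [:e0:] * h"
    using monomials[of 0] by auto
  obtain p1 e1 where 1: "[:0, 1:] = p1 * H + [:e1:] * h"
  proof -
    have T: "[:0, 1:] = monom (1::bit) 1" by (simp add: monom_Suc monom_0)
    have "1 \<le> r" by (simp add: r_def)
    from monomials[OF this] show ?thesis using that unfolding T by blast
  qed
  obtain p2 e2 where 2: "monom 1 r = p2 * H + [:e2:] * h" "p2 = 0 \<or> degree p2 + d \<le> r"
    using monomials[of r] by auto
  have "coeff (p2 * H) r = 1"
    using arg_cong[OF 2(1), of "\<lambda>p. coeff p r"] hr by simp
  hence "r \<le> degree (p2 * H)" by (intro le_degree) simp
  moreover have "p2 \<noteq> 0" using \<open>coeff (p2 * H) r = 1\<close> by auto
  ultimately have degH: "degree H \<ge> 1" using 2(2) d degree_mult_le[of p2 H] by linarith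
  have H0: "poly H 0 \<noteq> 0" and H1: "poly H 1 \<noteq> 0"
    using arg_cong[OF 0, of "\<lambda>p. poly p 0"] arg_cong[OF 0, of "\<lambda>p. poly p 1"] h0 h1 by auto
  have "degree H \<le> 1"
  proof (cases "e1 = 0")
    case True
    hence "H dvd [:0, 1:]" using 1 by simp
    from dvd_imp_degree_le[OF this] show ?thesis by simp
  next
    case e1: False
    show ?thesis
    proof (cases "e0 = 0")
      case True
      hence "1 = p0 * H" using 0 by simp
      hence "H dvd 1" by (metis dvd_triv_right)
      from dvd_imp_degree_le[OF this] show ?thesis by simp
    next
      case False
      hence "[:e0:] = [:e1:]" using e1 by simp
      hence "1 - [:0, 1:] = (p0 - p1) * H"
        unfolding 0 1 by (simp only: left_diff_distrib) simp
      hence "H dvd 1 - [:0, 1:]" by simp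
      moreover have "1 - [:0, 1:] = [:1, 1 :: bit:]" by (simp add: one_pCons)
      ultimately show ?thesis using dvd_imp_degree_le[of H "[:1, 1:]"] by simp
    qed
  qed
  with degH have "degree H = 1" by simp
  then obtain a b where ab: "H = [:a, b:]" "b \<noteq> 0" by (rule degree1_coeffs)
  show False using ab H0 H1 by simp
qed

section \<open>Depth and submodules\<close>

lemma submodule_zero:
  assumes "Module.module R M" shows "submodule {\<zero>\<^bsub>M\<^esub>} R M"
proof -
  interpret Module.module R M by fact
  show ?thesis by (rule submoduleI) auto
qed

lemma seq_mult_Nil:
  assumes "Module.module R M" shows "seq_mult R M [] = {\<zero>\<^bsub>M\<^esub>}"
proof -
  interpret Module.module R M by fact
  have "\<zero>\<^bsub>M\<^esub> \<in> H" if "submodule H R M" for H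
    using subgroup.one_closed[OF submodule.axioms(1)[OF that]] by simp
  thus ?thesis using submodule_zero[OF assms] by (auto simp: seq_mult_def module_span_def)
qed

lemma regular_seq_nonzerodivisor:
  assumes "Module.module R M" "regular_seq R M (a # as)" "u \<in> carrier M" "a \<odot>\<^bsub>M\<^esub> u = \<zero>\<^bsub>M\<^esub>"
  shows "u = \<zero>\<^bsub>M\<^esub>"
  using assms(2-4) seq_mult_Nil[OF assms(1)] by (auto simp: regular_seq_def)

lemma seq_mult_subset:
  assumes "submodule H R M"
    "\<And>a u. a \<in> set as \<Longrightarrow> u \<in> carrier M \<Longrightarrow> a \<odot>\<^bsub>M\<^esub> u \<in> H"
  shows "seq_mult R M as \<subseteq> H"
  unfolding seq_mult_def module_span_def using assms by blast

lemma smult_in_seq_mult: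
  assumes "a \<in> set as" "u \<in> carrier M" shows "a \<odot>\<^bsub>M\<^esub> u \<in> seq_mult R M as"
  using assms unfolding seq_mult_def module_span_def by blast

section \<open>A maximal Cohen-Macaulay module annihilated by the cofactor\<close>

text \<open>
  The power series ring modulo the cofactor, as a module over the hypersurface ring. Its elements are
  encoded as sets of constant sequences because the delta invariant only admits modules whose elements
  are sets of sequences over the ring.
\<close>

definition branch_elem :: "nat \<Rightarrow> bit fps fps \<Rightarrow> (nat \<Rightarrow> bit fps fps set) set"
  where "branch_elem N s = {(\<lambda>_. hyp_class N t) | t. cofactor N dvd t - s}"

lemma branch_elem_eq_iff: "branch_elem N s = branch_elem N t \<longleftrightarrow> cofactor N dvd s - t"
proof
  assume "branch_elem N s = branch_elem N t"
  moreover have "(\<lambda>_. hyp_class N s) \<in> branch_elem N s" by (auto simp: branch_elem_def)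
  ultimately obtain t' where t': "(\<lambda>_::nat. hyp_class N s) = (\<lambda>_. hyp_class N t')" "cofactor N dvd t' - t"
    by (auto simp: branch_elem_def)
  from fun_cong[OF t'(1)] have "hyp_poly N dvd s - t'" by (simp add: hyp_class_eq_iff)
  hence "cofactor N dvd s - t'" unfolding hyp_poly_cofactor by (rule dvd_mult_right)
  hence "cofactor N dvd (s - t') + (t' - t)" using t'(2) by (rule dvd_add)
  thus "cofactor N dvd s - t" by simp
next
  assume *: "cofactor N dvd s - t"
  have "cofactor N dvd u - t \<longleftrightarrow> cofactor N dvd u - s" for u
    using dvd_add_right_iff[OF *, of "u - s"] by simp
  thus "branch_elem N s = branch_elem N t" by (simp add: branch_elem_def)
qed

definition branch_rep :: "nat \<Rightarrow> (nat \<Rightarrow> bit fps fps set) set \<Rightarrow> bit fps fps"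
  where "branch_rep N = inv_into UNIV (branch_elem N)"

lemma branch_rep: "cofactor N dvd branch_rep N (branch_elem N s) - s"
  unfolding branch_elem_eq_iff[symmetric] branch_rep_def by (rule f_inv_into_f) simp

definition branch_module :: "nat \<Rightarrow> (bit fps fps set, (nat \<Rightarrow> bit fps fps set) set) module"
  where "branch_module N =
    \<lparr> carrier = range (branch_elem N),
      monoid.mult = (\<lambda>C D. branch_elem N (branch_rep N C * branch_rep N D)),
      monoid.one = branch_elem N 1,
      ring.zero = branch_elem N 0,
      ring.add = (\<lambda>C D. branch_elem N (branch_rep N C + branch_rep N D)),
      module.smult = (\<lambda>r C. branch_elem N (inv_into UNIV (hyp_class N) r * branch_rep N C)) \<rparr>"

lemma branch_module_ops [simp]:
  "carrier (branch_module N) = range (branch_elem N)"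
  "\<zero>\<^bsub>branch_module N\<^esub> = branch_elem N 0"
  "branch_elem N s \<oplus>\<^bsub>branch_module N\<^esub> branch_elem N t = branch_elem N (s + t)"
  "hyp_class N a \<odot>\<^bsub>branch_module N\<^esub> branch_elem N s = branch_elem N (a * s)"
proof -
  show "carrier (branch_module N) = range (branch_elem N)" "\<zero>\<^bsub>branch_module N\<^esub> = branch_elem N 0"
    by (simp_all add: branch_module_def)
  have "cofactor N dvd (branch_rep N (branch_elem N s) - s) + (branch_rep N (branch_elem N t) - t)"
    by (intro dvd_add branch_rep)
  thus "branch_elem N s \<oplus>\<^bsub>branch_module N\<^esub> branch_elem N t = branch_elem N (s + t)"
    by (simp add: branch_module_def branch_elem_eq_iff algebra_simps)
  define a' where "a' = inv_into UNIV (hyp_class N) (hyp_class N a)"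
  have "hyp_class N a' = hyp_class N a" unfolding a'_def by (rule f_inv_into_f) simp
  hence "hyp_poly N dvd a' - a" by (simp add: hyp_class_eq_iff)
  hence "cofactor N dvd a' - a" unfolding hyp_poly_cofactor by (rule dvd_mult_right)
  hence "cofactor N dvd (a' - a) * s + a' * (branch_rep N (branch_elem N s) - s)"
    by (intro dvd_add dvd_mult dvd_mult2 branch_rep)
  also have "\<dots> = a' * branch_rep N (branch_elem N s) - a * s" by (simp add: algebra_simps)
  finally show "hyp_class N a \<odot>\<^bsub>branch_module N\<^esub> branch_elem N s = branch_elem N (a * s)"
    by (simp add: branch_module_def branch_elem_eq_iff a'_def)
qed

lemma module_branch_module: "Module.module (hyp_ring N) (branch_module N)"
proof (rule moduleI)
  show "abelian_group (branch_module N)"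
  proof (rule abelian_groupI)
    fix u assume "u \<in> carrier (branch_module N)"
    then obtain s where "u = branch_elem N s" by auto
    hence "branch_elem N (- s) \<oplus>\<^bsub>branch_module N\<^esub> u = \<zero>\<^bsub>branch_module N\<^esub>" by simp
    thus "\<exists>v\<in>carrier (branch_module N). v \<oplus>\<^bsub>branch_module N\<^esub> u = \<zero>\<^bsub>branch_module N\<^esub>"
      by (metis branch_module_ops(1) rangeI)
  qed (auto simp: add_ac)
qed (auto simp: cring_hyp_ring carrier_hyp_ring_eq hyp_ring_one algebra_simps)

lemma submodule_branch_image:
  assumes "series_ideal J" shows "submodule (branch_elem N ` J) (hyp_ring N) (branch_module N)"
proof -
  interpret J: series_ideal J by fact
  interpret M: Module.module "hyp_ring N" "branch_module N" by (rule module_branch_module)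
  have minus: "\<ominus>\<^bsub>branch_module N\<^esub> branch_elem N s = branch_elem N s" for s
    by (rule M.minus_equality) (simp_all add: char2)
  show ?thesis
    by (rule M.submoduleI)
      (auto simp: minus carrier_hyp_ring_eq intro!: imageI intro: J.add J.mult)
qed

lemma series_ideal_ord_ideal: "series_ideal (ord_ideal n)"
  by unfold_locales (auto intro: ord_ideal_add ord_ideal_mult_left)

lemma branch_elem_1_notin: "branch_elem N 1 \<notin> branch_elem N ` ord_ideal 1"
proof
  assume "branch_elem N 1 \<in> branch_elem N ` ord_ideal 1"
  then obtain s where s: "s \<in> ord_ideal 1" "cofactor N dvd 1 - s" by (auto simp: branch_elem_eq_iff)
  have "cofactor N \<in> ord_ideal 1"
    using cofactor_ord_ideal ord_ideal_antimono[of 1 "N + 1"] by auto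
  hence "1 - s \<in> ord_ideal 1" using s(2) by (auto elim!: dvdE intro: ord_ideal_mult_right)
  from ord_ideal_add[OF this s(1)] show False using one_notin_ord_ideal by simp
qed

lemma seq_mult_branch_subset:
  assumes "set as \<subseteq> max_ideal (hyp_ring N)"
  shows "seq_mult (hyp_ring N) (branch_module N) as \<subseteq> branch_elem N ` ord_ideal 1"
proof (rule seq_mult_subset[OF submodule_branch_image[OF series_ideal_ord_ideal]])
  fix a u assume "a \<in> set as" "u \<in> carrier (branch_module N)"
  then obtain \<alpha> s where "\<alpha> \<in> ord_ideal 1" "a = hyp_class N \<alpha>" "u = branch_elem N s"
    using assms by (auto simp: max_ideal_conv)
  thus "a \<odot>\<^bsub>branch_module N\<^esub> u \<in> branch_elem N ` ord_ideal 1"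
    by (auto intro!: imageI ord_ideal_mult_right)
qed

lemma restr_cofactor_nonzero:
  assumes "N > 0" shows "restr (cofactor N) \<noteq> 0"
proof -
  have "fps_nth (fps_X ^ N + (fps_X ^ 2) ^ N :: bit fps) N = 1"
    unfolding power_mult[symmetric] fps_add_nth fps_X_power_nth using assms by simp
  hence "fps_X ^ N + (fps_X ^ 2) ^ N \<noteq> (0 :: bit fps)" by (metis fps_zero_nth zero_neq_one)
  thus ?thesis unfolding cofactor_def restr_mult restr_add restr_power restr_X restr_Y by simp
qed

lemma curve_nonzerodivisor_mod_cofactor:
  assumes "N > 0" "cofactor N dvd curve * s" shows "cofactor N dvd s"
proof -
  obtain t where t: "curve * s = cofactor N * t" using assms(2) by (rule dvdE)
  hence "restr (cofactor N) * restr t = 0" using restr_mult[of curve s] by simp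
  hence "restr t = 0" using restr_cofactor_nonzero[OF assms(1)] by simp
  then obtain t' where "t = curve * t'" by (auto simp: restr_eq_0_iff elim: dvdE)
  hence "curve * s = curve * (cofactor N * t')" using t by (simp add: mult_ac)
  hence "s = cofactor N * t'" using curve_nonzero by simp
  thus ?thesis by simp
qed

text \<open>
  The first element \<open>q\<close> of a regular sequence is a nonzerodivisor, so a power of the second one lies in
  \<open>(q)\<close>; regularity of the second element cancels this power and gives \<open>1 \<in> (q)\<close>.
\<close>

lemma regular_seq_branch_length:
  assumes N: "N > 0" and as: "set as \<subseteq> max_ideal (hyp_ring N)"
    and reg: "regular_seq (hyp_ring N) (branch_module N) as"
  shows "length as \<le> 1"
proof (rule ccontr)
  assume "\<not> length as \<le> 1"
  then obtain a b cs where eq: "as = a # b # cs"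
    by (cases as; cases "tl as") auto
  obtain q w where q: "q \<in> ord_ideal 1" "a = hyp_class N q" and w: "w \<in> ord_ideal 1" "b = hyp_class N w"
    using as by (auto simp: eq max_ideal_conv)
  let ?S = "seq_mult (hyp_ring N) (branch_module N) [a]"
  interpret I: series_ideal "{s. cofactor N dvd s}" by unfold_locales auto
  have nzd: "s \<in> {s. cofactor N dvd s}" if "q * s \<in> {s. cofactor N dvd s}" for s
    using regular_seq_nonzerodivisor[OF module_branch_module reg[unfolded eq], of "branch_elem N s"] that
      rangeI[of "branch_elem N" s] by (simp add: q(2) branch_elem_eq_iff)
  obtain k where k: "\<forall>t\<in>ord_ideal k. \<exists>u. t - u * q \<in> {s. cofactor N dvd s}"
    using I.power_subset_if_nonzerodivisor_mod_cofactor[OF N _ nzd] by (metis CollectI dvd_refl)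
  obtain u where "cofactor N dvd w ^ k - u * q"
    using bspec[OF k ord_ideal_power[OF w(1)]] by (elim exE CollectE)
  hence "branch_elem N (w ^ k) = a \<odot>\<^bsub>branch_module N\<^esub> branch_elem N u"
    by (simp add: q(2) branch_elem_eq_iff mult.commute)
  hence "branch_elem N (w ^ k) \<in> ?S" by (auto intro!: smult_in_seq_mult)
  moreover have step: "branch_elem N s \<in> ?S" if "branch_elem N (w * s) \<in> ?S" for s
  proof -
    have "\<forall>u\<in>carrier (branch_module N). as ! 1 \<odot>\<^bsub>branch_module N\<^esub> u
        \<in> seq_mult (hyp_ring N) (branch_module N) (take 1 as)
        \<longrightarrow> u \<in> seq_mult (hyp_ring N) (branch_module N) (take 1 as)"
      using reg eq unfolding regular_seq_def by auto
    thus ?thesis using that by (simp add: eq w(2))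
  qed
  ultimately have "branch_elem N 1 \<in> ?S" by (induction k) auto
  moreover have "?S \<subseteq> branch_elem N ` ord_ideal 1"
    using as by (intro seq_mult_branch_subset) (simp add: eq)
  ultimately show False using branch_elem_1_notin by blast
qed

lemma depth_branch_module:
  assumes N: "N > 0" shows "depth (hyp_ring N) (branch_module N) = 1"
proof (rule antisym)
  show "depth (hyp_ring N) (branch_module N) \<le> 1" unfolding depth_def one_enat_def
    by (rule Sup_least) (use regular_seq_branch_length[OF N] in auto)
  let ?as = "[hyp_class N curve]"
  have mem: "set ?as \<subseteq> max_ideal (hyp_ring N)" using curve_ord_ideal by (auto simp: max_ideal_conv)
  have "regular_seq (hyp_ring N) (branch_module N) ?as"
    unfolding regular_seq_def
  proof (intro conjI allI impI ballI)
    show "seq_mult (hyp_ring N) (branch_module N) ?as \<noteq> carrier (branch_module N)"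
      using seq_mult_branch_subset[OF mem] branch_elem_1_notin[of N]
      by (metis branch_module_ops(1) rangeI subsetD)
    fix i u assume i: "i < length ?as" and u: "u \<in> carrier (branch_module N)"
      and *: "?as ! i \<odot>\<^bsub>branch_module N\<^esub> u \<in> seq_mult (hyp_ring N) (branch_module N) (take i ?as)"
    then obtain s where s: "u = branch_elem N s" by auto
    have "cofactor N dvd curve * s"
      using * i by (simp add: s seq_mult_Nil[OF module_branch_module] branch_elem_eq_iff)
    from curve_nonzerodivisor_mod_cofactor[OF N this]
    show "u \<in> seq_mult (hyp_ring N) (branch_module N) (take i ?as)"
      using i by (simp add: s seq_mult_Nil[OF module_branch_module] branch_elem_eq_iff)
  qed simp
  with mem have "enat (length ?as) \<le> depth (hyp_ring N) (branch_module N)"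
    unfolding depth_def by (intro Sup_upper) blast
  thus "1 \<le> depth (hyp_ring N) (branch_module N)" by (simp add: one_enat_def)
qed

lemma max_CM_branch_module:
  assumes N: "N > 0" shows "max_CM (hyp_ring N) (branch_module N)"
  unfolding max_CM_def
proof (intro conjI)
  interpret M: Module.module "hyp_ring N" "branch_module N" by (rule module_branch_module)
  show "Module.module (hyp_ring N) (branch_module N)" by (rule module_branch_module)
  have "module_span (hyp_ring N) (branch_module N) {branch_elem N 1} = carrier (branch_module N)"
  proof
    show "module_span (hyp_ring N) (branch_module N) {branch_elem N 1} \<subseteq> carrier (branch_module N)"
      unfolding module_span_def using M.carrier_is_submodule by auto
    have "branch_elem N s \<in> H"
      if "submodule H (hyp_ring N) (branch_module N)" "branch_elem N 1 \<in> H" for s H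
      using submodule.smult_closed[OF that(1) hyp_class_closed that(2), of s] by simp
    thus "carrier (branch_module N) \<subseteq> module_span (hyp_ring N) (branch_module N) {branch_elem N 1}"
      unfolding module_span_def by auto
  qed
  thus "fin_gen (hyp_ring N) (branch_module N)"
    unfolding fin_gen_def by (intro exI[of _ "{branch_elem N 1}"]) auto
  have "branch_elem N 1 \<noteq> branch_elem N 0"
    using branch_elem_1_notin[of N] zero_ord_ideal[of 1] by blast
  thus "carrier (branch_module N) \<noteq> {\<zero>\<^bsub>branch_module N\<^esub>}" by auto
  show "depth (hyp_ring N) (branch_module N) = krull_dim (hyp_ring N)"
    by (simp only: depth_branch_module[OF N] krull_dim_hyp_ring[OF N])
qed

lemma module_hom_zero:
  assumes "Module.module R M" "Module.module R M'" "h \<in> module_hom R M M'"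
  shows "h \<zero>\<^bsub>M\<^esub> = \<zero>\<^bsub>M'\<^esub>"
proof -
  interpret M: Module.module R M by fact
  interpret M': Module.module R M' by fact
  have "h (\<zero>\<^bsub>R\<^esub> \<odot>\<^bsub>M\<^esub> \<zero>\<^bsub>M\<^esub>) = \<zero>\<^bsub>R\<^esub> \<odot>\<^bsub>M'\<^esub> h \<zero>\<^bsub>M\<^esub>" "h \<zero>\<^bsub>M\<^esub> \<in> carrier M'"
    using assms(3) M.R.zero_closed M.M.zero_closed unfolding module_hom_def by blast+
  thus ?thesis by simp
qed

text \<open>
  A nonzero free module is faithful.
\<close>

lemma no_free_summand_if_annihilated:
  assumes M: "Module.module R M" and r: "r \<in> carrier R" "r \<noteq> \<zero>\<^bsub>R\<^esub>"
    and ann: "\<And>u. u \<in> carrier M \<Longrightarrow> r \<odot>\<^bsub>M\<^esub> u = \<zero>\<^bsub>M\<^esub>"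
  shows "\<not> has_free_summand R M"
proof
  interpret M: Module.module R M by fact
  assume "has_free_summand R M"
  then obtain F k h where k: "k \<ge> 1" and h: "h \<in> module_hom R (free_module R k) M"
    and bij: "bij_betw h (carrier (free_module R k)) F"
    unfolding has_free_summand_def by blast
  interpret L: Module.module R "free_module R k" by (rule module_free_module[OF M.R.is_cring])
  define e where "e = (\<lambda>i\<in>{..<k}. \<one>\<^bsub>R\<^esub>)"
  have e: "e \<in> carrier (free_module R k)" by (simp add: e_def free_module_def)
  have he: "h e \<in> carrier M" using h e by (auto simp: module_hom_def)
  have "h (r \<odot>\<^bsub>free_module R k\<^esub> e) = r \<odot>\<^bsub>M\<^esub> h e"
    using h e r(1) by (auto simp: module_hom_def)
  also have "\<dots> = h \<zero>\<^bsub>free_module R k\<^esub>"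
    using ann[OF he] module_hom_zero[OF L.module_axioms M h] by simp
  finally have "r \<odot>\<^bsub>free_module R k\<^esub> e = \<zero>\<^bsub>free_module R k\<^esub>"
    using bij e r(1) by (auto simp: bij_betw_def dest!: inj_onD)
  hence "(r \<odot>\<^bsub>free_module R k\<^esub> e) 0 = \<zero>\<^bsub>free_module R k\<^esub> 0" by simp
  thus False using k r by (simp add: free_module_def e_def)
qed

lemma branch_module_no_free_summand:
  assumes N: "N > 0" shows "\<not> has_free_summand (hyp_ring N) (branch_module N)"
proof (rule no_free_summand_if_annihilated[OF module_branch_module])
  show "hyp_class N (cofactor N) \<in> carrier (hyp_ring N)" by simp
  show "hyp_class N (cofactor N) \<noteq> \<zero>\<^bsub>hyp_ring N\<^esub>"
  proof
    assume "hyp_class N (cofactor N) = \<zero>\<^bsub>hyp_ring N\<^esub>"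
    hence "X_ser * cofactor N dvd cofactor N"
      by (simp add: hyp_ring_zero hyp_class_eq_iff hyp_poly_cofactor)
    then obtain c where "cofactor N = X_ser * cofactor N * c" by (rule dvdE)
    hence "cofactor N * 1 = cofactor N * (X_ser * c)" by (simp add: mult_ac)
    moreover have nz: "cofactor N \<noteq> 0" using restr_cofactor_nonzero[OF N] restr_const[of 0] by auto
    ultimately have "1 = X_ser * c" unfolding mult_left_cancel[OF nz] by simp
    thus False using ord_ideal_mult_right[OF X_ord_ideal, of c] one_notin_ord_ideal by simp
  qed
  fix u assume "u \<in> carrier (branch_module N)"
  then obtain s where "u = branch_elem N s" by auto
  thus "hyp_class N (cofactor N) \<odot>\<^bsub>branch_module N\<^esub> u = \<zero>\<^bsub>branch_module N\<^esub>"
    by (simp add: branch_elem_eq_iff)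
qed

text \<open>
  The cofactor has order \<open>N + 1\<close>, so \<open>R / m\<^sup>n\<close> is a quotient of the module constructed above.
\<close>

lemma delta_inv_small:
  assumes N: "N > 0" and n: "n \<le> N + 1"
  shows "delta_inv (hyp_ring N) (trunc_module N n) = 0"
  unfolding delta_inv_def
proof (rule Least_eq_0)
  let ?D = "direct_sum (branch_module N) (free_module (hyp_ring N) 0)"
  define h where "h = (\<lambda>u :: (nat \<Rightarrow> bit fps fps set) set \<times> (nat \<Rightarrow> bit fps fps set).
    trunc N n (branch_rep N (fst u)))"
  have h: "h (branch_elem N s, z) = trunc N n s" for s z
  proof -
    have "cofactor N \<in> ord_ideal n" using cofactor_ord_ideal ord_ideal_antimono[OF n] by blast
    hence "branch_rep N (branch_elem N s) - s \<in> ord_ideal n"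
      using branch_rep[of N s] by (auto elim!: dvdE intro: ord_ideal_mult_right)
    thus ?thesis using n by (simp add: h_def trunc_eq_iff)
  qed
  have D: "carrier ?D = range (branch_elem N) \<times> {\<lambda>_. undefined}"
    by (simp add: direct_sum_def free_module_def)
  have add: "(branch_elem N s, z) \<oplus>\<^bsub>?D\<^esub> (branch_elem N t, z') = (branch_elem N (s + t), z \<oplus>\<^bsub>free_module (hyp_ring N) 0\<^esub> z')"
    and smult: "hyp_class N a \<odot>\<^bsub>?D\<^esub> (branch_elem N s, z) = (branch_elem N (a * s), hyp_class N a \<odot>\<^bsub>free_module (hyp_ring N) 0\<^esub> z)"
    for s t z z' a by (simp_all add: direct_sum_def)
  have "h \<in> module_hom (hyp_ring N) ?D (trunc_module N n)"
    unfolding module_hom_def D trunc_module_ops carrier_hyp_ring_eq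
    by (auto simp: h add smult trunc_module_ops)
  moreover have "h ` carrier ?D = carrier (trunc_module N n)"
    unfolding D trunc_module_ops by (force simp: h image_iff)
  ultimately show "\<exists>Y :: (bit fps fps set, (nat \<Rightarrow> bit fps fps set) set) module. \<exists>h.
      Module.module (hyp_ring N) Y \<and> (carrier Y = {\<zero>\<^bsub>Y\<^esub>} \<or> max_CM (hyp_ring N) Y) \<and>
      \<not> has_free_summand (hyp_ring N) Y \<and>
      h \<in> module_hom (hyp_ring N) (direct_sum Y (free_module (hyp_ring N) 0)) (trunc_module N n) \<and>
      h ` carrier (direct_sum Y (free_module (hyp_ring N) 0)) = carrier (trunc_module N n)"
    using module_branch_module max_CM_branch_module[OF N] branch_module_no_free_summand[OF N] by blast
qed

section \<open>Kernels of presentations of modules on which the curve is regular\<close>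

text \<open>
  The kernel \<open>K\<close> of a map from \<open>S\<^sup>k\<close> to an \<open>R\<close>-module on which the curve is a nonzerodivisor; vectors are
  sequences of which only the first \<open>k\<close> entries count. Such a kernel is a free module: modulo the curve it
  is a submodule of \<open>F\<^sub>2[[x]]\<^sup>k\<close>, hence has a triangular basis over this discrete valuation ring, and
  the basis lifts because \<open>S\<close> is complete. The rank is \<open>k\<close> since \<open>K\<close> contains \<open>f S\<^sup>k\<close>. This is the part
  of the theory of matrix factorizations that is needed here.
\<close>

locale presentation_kernel =
  fixes N k :: nat and K :: "(nat \<Rightarrow> bit fps fps) set"
  assumes N_pos: "N > 0"
    and K_add: "s \<in> K \<Longrightarrow> t \<in> K \<Longrightarrow> (\<lambda>i. s i + t i) \<in> K"
    and K_smult: "s \<in> K \<Longrightarrow> (\<lambda>i. a * s i) \<in> K"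
    and K_saturated: "(\<lambda>i. curve * s i) \<in> K \<Longrightarrow> s \<in> K"
    and K_hyp_poly: "(\<lambda>i. hyp_poly N * s i) \<in> K"
    and K_cong: "(\<And>i. i < k \<Longrightarrow> s i = t i) \<Longrightarrow> s \<in> K \<Longrightarrow> t \<in> K"
begin

lemma K_lincomb: "s \<in> K \<Longrightarrow> t \<in> K \<Longrightarrow> (\<lambda>i. s i - a * t i) \<in> K"
  unfolding char2(3) by (intro K_add K_smult)

lemma restr_hyp_poly_nonzero: "restr (hyp_poly N) \<noteq> 0"
  using restr_cofactor_nonzero[OF N_pos] by (simp add: hyp_poly_cofactor)

text \<open>
  Among the elements of \<open>K\<close> whose restrictions vanish in the first \<open>j\<close> entries, one with \<open>j\<close>-th entry
  of minimal valuation. Such elements exist because \<open>f\<close> times a unit vector lies in \<open>K\<close>.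
\<close>

lemma triangular_element:
  assumes "j < k"
  shows "\<exists>b\<in>K. (\<forall>i<j. restr (b i) = 0) \<and> restr (b j) \<noteq> 0 \<and>
    (\<forall>s\<in>K. (\<forall>i<j. restr (s i) = 0) \<longrightarrow> restr (b j) dvd restr (s j))"
proof -
  define P where "P = (\<lambda>s. s \<in> K \<and> (\<forall>i<j. restr (s i) = 0) \<and> restr (s j) \<noteq> 0)"
  have "P (\<lambda>i. hyp_poly N * (if i = j then 1 else 0))"
    unfolding P_def using restr_hyp_poly_nonzero restr_const[of 0]
    by (intro conjI K_hyp_poly) auto
  then obtain b where b: "P b" "\<And>s. P s \<Longrightarrow> subdegree (restr (b j)) \<le> subdegree (restr (s j))"
    using ex_has_least_nat[of P _ "\<lambda>s. subdegree (restr (s j))"] by metis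
  have "restr (b j) dvd restr (s j)" if "s \<in> K" "\<forall>i<j. restr (s i) = 0" for s
  proof (cases "restr (s j) = 0")
    case False
    hence "P s" using that by (simp add: P_def)
    thus ?thesis using b False by (simp add: P_def fps_dvd_iff)
  qed simp
  thus ?thesis using b(1) unfolding P_def by blast
qed

definition basis :: "nat \<Rightarrow> nat \<Rightarrow> bit fps fps"
  where "basis j = (SOME b. b \<in> K \<and> (\<forall>i<j. restr (b i) = 0) \<and> restr (b j) \<noteq> 0 \<and>
    (\<forall>s\<in>K. (\<forall>i<j. restr (s i) = 0) \<longrightarrow> restr (b j) dvd restr (s j)))"

lemma basis:
  assumes "j < k"
  shows "basis j \<in> K" "\<And>i. i < j \<Longrightarrow> restr (basis j i) = 0" "restr (basis j j) \<noteq> 0"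
    "\<And>s. s \<in> K \<Longrightarrow> (\<And>i. i < j \<Longrightarrow> restr (s i) = 0) \<Longrightarrow> restr (basis j j) dvd restr (s j)"
proof -
  have "basis j \<in> K \<and> (\<forall>i<j. restr (basis j i) = 0) \<and> restr (basis j j) \<noteq> 0 \<and>
    (\<forall>s\<in>K. (\<forall>i<j. restr (s i) = 0) \<longrightarrow> restr (basis j j) dvd restr (s j))"
    using triangular_element[OF assms] unfolding Bex_def basis_def by (rule someI_ex)
  thus "basis j \<in> K" "\<And>i. i < j \<Longrightarrow> restr (basis j i) = 0" "restr (basis j j) \<noteq> 0"
    "\<And>s. s \<in> K \<Longrightarrow> (\<And>i. i < j \<Longrightarrow> restr (s i) = 0) \<Longrightarrow> restr (basis j j) dvd restr (s j)"
    by blast+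
qed

text \<open>
  Gaussian elimination along the triangular basis, modulo the curve.
\<close>

lemma eliminate:
  assumes "s \<in> K" "j \<le> k"
  shows "\<exists>a. (\<lambda>i. s i - (\<Sum>l<j. fps_const (a l) * basis l i)) \<in> K \<and>
    (\<forall>i<j. restr (s i - (\<Sum>l<j. fps_const (a l) * basis l i)) = 0)"
  using assms(2)
proof (induction j)
  case 0
  show ?case using assms(1) by simp
next
  case (Suc j)
  hence j: "j < k" by simp
  obtain a where "(\<lambda>i. s i - (\<Sum>l<j. fps_const (a l) * basis l i)) \<in> K"
    "\<forall>i<j. restr (s i - (\<Sum>l<j. fps_const (a l) * basis l i)) = 0"
    using Suc by auto
  moreover define t where "t = (\<lambda>i. s i - (\<Sum>l<j. fps_const (a l) * basis l i))"
  ultimately have t: "t \<in> K" "\<And>i. i < j \<Longrightarrow> restr (t i) = 0" by blast+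
  from basis(4)[OF j t] obtain c where c: "restr (t j) = restr (basis j j) * c" by (rule dvdE)
  define a' where "a' = a(j := c)"
  have "(\<Sum>l<j. fps_const (a' l) * basis l i) = (\<Sum>l<j. fps_const (a l) * basis l i)" for i
    by (rule sum.cong) (auto simp: a'_def)
  hence eq: "s i - (\<Sum>l<Suc j. fps_const (a' l) * basis l i) = t i - fps_const c * basis j i" for i
    by (simp add: t_def a'_def)
  have "(\<lambda>i. t i - fps_const c * basis j i) \<in> K"
    using t(1) basis(1)[OF j] by (rule K_lincomb)
  moreover have "restr (t i - fps_const c * basis j i) = 0" if "i < Suc j" for i
    using that t(2) basis(2)[OF j] c by (cases "i = j") auto
  ultimately show ?case by (intro exI[of _ a']) (simp only: eq simp_thms, blast)
qed

lemma reduce: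
  assumes "s \<in> K"
  shows "\<exists>a s'. s' \<in> K \<and> (\<forall>i<k. s i = (\<Sum>j<k. fps_const (a j) * basis j i) + curve * s' i)"
proof -
  obtain a where a: "(\<lambda>i. s i - (\<Sum>l<k. fps_const (a l) * basis l i)) \<in> K"
    "\<forall>i<k. restr (s i - (\<Sum>l<k. fps_const (a l) * basis l i)) = 0"
    using eliminate[OF assms order_refl] by blast
  have "\<forall>i. \<exists>q. i < k \<longrightarrow> s i - (\<Sum>l<k. fps_const (a l) * basis l i) = curve * q"
    using a(2) unfolding restr_eq_0_iff by (auto elim!: dvdE)
  then obtain s' where s': "\<And>i. i < k \<Longrightarrow> s i - (\<Sum>l<k. fps_const (a l) * basis l i) = curve * s' i"
    by metis
  have "(\<lambda>i. curve * s' i) \<in> K" by (rule K_cong[OF _ a(1)]) (rule s')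
  hence "s' \<in> K" by (rule K_saturated)
  moreover have "\<forall>i<k. s i = (\<Sum>j<k. fps_const (a j) * basis j i) + curve * s' i"
    by (intro allI impI) (simp flip: s')
  ultimately show ?thesis by blast
qed

text \<open>
  Iterating the reduction modulo the curve expresses the coefficients as series in powers of the curve
  equation.
\<close>

lemma basis_spans:
  assumes "s \<in> K"
  shows "\<exists>c. \<forall>i<k. s i = (\<Sum>j<k. c j * basis j i)"
proof -
  obtain A T where AT: "\<And>s. s \<in> K \<Longrightarrow> T s \<in> K"
    "\<And>s i. s \<in> K \<Longrightarrow> i < k \<Longrightarrow> s i = (\<Sum>j<k. fps_const (A s j) * basis j i) + curve * T s i"
  proof -
    define P where "P = (\<lambda>s a s'. s' \<in> K \<and>
      (\<forall>i<k. s i = (\<Sum>j<k. fps_const (a j) * basis j i) + curve * s' i))"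
    have "\<forall>s. \<exists>a s'. s \<in> K \<longrightarrow> P s a s'" using reduce unfolding P_def by blast
    then obtain A T where "\<And>s. s \<in> K \<Longrightarrow> P s (A s) (T s)" by metis
    thus thesis by (intro that[of T A]) (simp_all add: P_def)
  qed
  define S where "S = (\<lambda>n. (T ^^ n) s)"
  have S: "S n \<in> K" "S (Suc n) = T (S n)" for n
    by (induction n) (use assms AT(1) in \<open>auto simp: S_def\<close>)
  define t where "t = (\<lambda>j n. \<Sum>l<n. curve ^ l * fps_const (A (S l) j))"
  have expand: "s i = (\<Sum>j<k. t j n * basis j i) + curve ^ n * S n i" if "i < k" for n i
  proof (induction n)
    case 0
    show ?case by (simp add: t_def S_def)
  next
    case (Suc n)
    have "curve ^ n * S n i
        = curve ^ n * (\<Sum>j<k. fps_const (A (S n) j) * basis j i) + curve ^ Suc n * S (Suc n) i"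
      by (subst AT(2)[OF S(1) that]) (simp add: S(2) distrib_left mult_ac)
    moreover have "(\<Sum>j<k. t j (Suc n) * basis j i)
        = (\<Sum>j<k. t j n * basis j i) + curve ^ n * (\<Sum>j<k. fps_const (A (S n) j) * basis j i)"
      by (simp add: t_def distrib_right sum.distrib sum_distrib_left mult.assoc)
    ultimately show ?case using Suc by simp
  qed
  have "\<exists>c. \<forall>n. c - t j n \<in> ord_ideal n" for j
  proof -
    have "t j (Suc n) - t j n = curve ^ n * fps_const (A (S n) j)" for n
      by (simp add: t_def)
    hence "t j (Suc n) - t j n \<in> ord_ideal n" for n
      by (simp only: ord_ideal_mult_right ord_ideal_power curve_ord_ideal)
    thus ?thesis by (rule ord_ideal_complete) blast
  qed
  then obtain c where c: "\<And>j n. c j - t j n \<in> ord_ideal n" by metis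
  have "s i = (\<Sum>j<k. c j * basis j i)" if i: "i < k" for i
  proof -
    have "s i - (\<Sum>j<k. c j * basis j i) \<in> ord_ideal n" for n
    proof -
      have "s i - (\<Sum>j<k. c j * basis j i) = curve ^ n * S n i - (\<Sum>j<k. (c j - t j n) * basis j i)"
        unfolding left_diff_distrib sum_subtractf by (subst expand[OF i, of n]) simp
      also have "\<dots> \<in> ord_ideal n"
        by (intro ord_ideal_diff ord_ideal_sum ord_ideal_mult_right ord_ideal_power curve_ord_ideal c)
      finally show ?thesis .
    qed
    hence "s i - (\<Sum>j<k. c j * basis j i) = 0" by (rule ord_ideal_Inter)
    thus ?thesis by (simp only: right_minus_eq)
  qed
  thus ?thesis by blast
qed

lemma relation_restr:
  assumes rel: "\<And>i. i < k \<Longrightarrow> (\<Sum>j<k. c j * basis j i) = 0" and "j < k"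
  shows "restr (c j) = 0"
  using assms(2)
proof (induction j rule: less_induct)
  case (less j)
  have "(\<Sum>l<k. restr (c l) * restr (basis l j)) = restr (\<Sum>l<k. c l * basis l j)" by simp
  also have "\<dots> = 0" using rel[OF less.prems] restr_const[of 0] by simp
  finally have "0 = (\<Sum>l<k. restr (c l) * restr (basis l j))" ..
  also have "\<dots> = (\<Sum>l<k. if l = j then restr (c j) * restr (basis j j) else 0)"
  proof (rule sum.cong[OF refl])
    fix l assume "l \<in> {..<k}"
    thus "restr (c l) * restr (basis l j) = (if l = j then restr (c j) * restr (basis j j) else 0)"
      using less.IH[of l] basis(2)[of l j] by (cases l j rule: linorder_cases) auto
  qed
  also have "\<dots> = restr (c j) * restr (basis j j)" using less.prems by (subst sum.delta) auto
  finally show ?case using basis(3)[OF less.prems] by simp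
qed

text \<open>
  By triangularity all coefficients of a relation are divisible by the curve equation. Dividing them by
  it gives another relation, so they are divisible by all its powers.
\<close>

lemma basis_independent:
  assumes "\<And>i. i < k \<Longrightarrow> (\<Sum>j<k. c j * basis j i) = 0" "j < k"
  shows "c j = 0"
proof -
  have "curve ^ n dvd c j" if "\<And>i. i < k \<Longrightarrow> (\<Sum>j<k. c j * basis j i) = 0" "j < k" for n c j
    using that
  proof (induction n arbitrary: c j)
    case (Suc n)
    have "\<forall>j. \<exists>q. j < k \<longrightarrow> c j = curve * q"
      using relation_restr[OF Suc.prems(1)] by (auto simp: restr_eq_0_iff dvd_def)
    then obtain q where q: "\<And>j. j < k \<Longrightarrow> c j = curve * q j" by metis
    have "(\<Sum>j<k. q j * basis j i) = 0" if "i < k" for i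
    proof -
      have "curve * (\<Sum>j<k. q j * basis j i) = (\<Sum>j<k. c j * basis j i)"
        unfolding sum_distrib_left by (rule sum.cong) (simp_all add: q mult.assoc)
      thus ?thesis using Suc.prems(1)[OF that] curve_nonzero by simp
    qed
    hence "curve ^ n dvd q j" using Suc.IH Suc.prems(2) by blast
    thus ?case using q[OF Suc.prems(2)] by (simp add: mult_dvd_mono)
  qed simp
  hence "curve ^ n dvd c j" for n using assms by blast
  hence "c j \<in> ord_ideal n" for n
    using ord_ideal_power[OF curve_ord_ideal, of n] by (metis dvdE ord_ideal_mult_right)
  thus ?thesis by (rule ord_ideal_Inter)
qed

definition coord :: "(nat \<Rightarrow> bit fps fps) \<Rightarrow> nat \<Rightarrow> bit fps fps"
  where "coord s = (SOME c. \<forall>i<k. s i = (\<Sum>j<k. c j * basis j i))"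

lemma coord: "s \<in> K \<Longrightarrow> i < k \<Longrightarrow> s i = (\<Sum>j<k. coord s j * basis j i)"
  using someI_ex[OF basis_spans[of s]] unfolding coord_def by blast

lemma coord_unique:
  assumes "s \<in> K" "\<And>i. i < k \<Longrightarrow> s i = (\<Sum>j<k. c j * basis j i)" "j < k"
  shows "coord s j = c j"
proof -
  have "(\<Sum>j<k. (coord s j - c j) * basis j i) = 0" if "i < k" for i
    unfolding left_diff_distrib sum_subtractf
    using coord[OF assms(1) that] assms(2)[OF that] by simp
  hence "coord s j - c j = 0" using assms(3) by (rule basis_independent)
  thus ?thesis by (simp only: right_minus_eq)
qed

lemma coord_add:
  assumes "s \<in> K" "t \<in> K" "j < k"
  shows "coord (\<lambda>i. s i + t i) j = coord s j + coord t j"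
  using assms
  by (intro coord_unique K_add) (auto simp: distrib_right sum.distrib simp flip: coord)

lemma coord_smult:
  assumes "s \<in> K" "j < k"
  shows "coord (\<lambda>i. a * s i) j = a * coord s j"
  using assms
  by (intro coord_unique K_smult) (auto simp: mult.assoc simp flip: coord sum_distrib_left)

end

section \<open>Free direct summands\<close>

text \<open>
  A linear functional with value \<open>1\<close> at \<open>y\<close> splits \<open>M\<close> into the free module \<open>R y\<close> and its kernel.
\<close>

lemma has_free_summand_if_functional:
  fixes R (structure)
  assumes M: "Module.module R M"
    and \<phi>: "\<And>u. u \<in> carrier M \<Longrightarrow> \<phi> u \<in> carrier R"
    and \<phi>_add: "\<And>u v. u \<in> carrier M \<Longrightarrow> v \<in> carrier M \<Longrightarrow> \<phi> (u \<oplus>\<^bsub>M\<^esub> v) = \<phi> u \<oplus> \<phi> v"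
    and \<phi>_smult: "\<And>r u. r \<in> carrier R \<Longrightarrow> u \<in> carrier M \<Longrightarrow> \<phi> (r \<odot>\<^bsub>M\<^esub> u) = r \<otimes> \<phi> u"
    and y: "y \<in> carrier M" "\<phi> y = \<one>"
  shows "has_free_summand R M"
proof -
  interpret M: Module.module R M by fact
  define F where "F = (\<lambda>r. r \<odot>\<^bsub>M\<^esub> y) ` carrier R"
  define G where "G = {u \<in> carrier M. \<phi> u = \<zero>}"
  define h where "h = (\<lambda>u :: nat \<Rightarrow> _. u 0 \<odot>\<^bsub>M\<^esub> y)"
  have \<phi>_ry: "\<phi> (r \<odot>\<^bsub>M\<^esub> y) = r" if "r \<in> carrier R" for r
    using that by (simp add: \<phi>_smult y)
  have \<phi>_zero: "\<phi> \<zero>\<^bsub>M\<^esub> = \<zero>" using \<phi>_ry[of \<zero>] y(1) by simp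
  have \<phi>_minus: "\<phi> (\<ominus>\<^bsub>M\<^esub> u) = \<ominus> \<phi> u" if "u \<in> carrier M" for u
    using \<phi>_add[of "\<ominus>\<^bsub>M\<^esub> u" u] that
    by (intro M.R.minus_equality[symmetric]) (auto simp: M.M.l_neg \<phi>_zero \<phi>)
  have F: "submodule F R M"
  proof (rule M.submoduleI)
    show "F \<subseteq> carrier M" using y by (auto simp: F_def)
    show "\<zero>\<^bsub>M\<^esub> \<in> F" unfolding F_def using y by (intro image_eqI[of _ _ \<zero>]) auto
    show "\<ominus>\<^bsub>M\<^esub> u \<in> F" if u: "u \<in> F" for u
    proof -
      obtain r where "r \<in> carrier R" "u = r \<odot>\<^bsub>M\<^esub> y" using u by (auto simp: F_def)
      thus ?thesis unfolding F_def using y by (intro image_eqI[of _ _ "\<ominus> r"]) (auto simp: M.smult_l_minus)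
    qed
    show "u \<oplus>\<^bsub>M\<^esub> v \<in> F" if uv: "u \<in> F" "v \<in> F" for u v
    proof -
      obtain r s where "r \<in> carrier R" "u = r \<odot>\<^bsub>M\<^esub> y" "s \<in> carrier R" "v = s \<odot>\<^bsub>M\<^esub> y"
        using uv by (auto simp: F_def)
      thus ?thesis unfolding F_def using y by (intro image_eqI[of _ _ "r \<oplus> s"]) (auto simp: M.smult_l_distr)
    qed
    show "a \<odot>\<^bsub>M\<^esub> u \<in> F" if au: "a \<in> carrier R" "u \<in> F" for a u
    proof -
      obtain r where "r \<in> carrier R" "u = r \<odot>\<^bsub>M\<^esub> y" using au(2) by (auto simp: F_def)
      thus ?thesis unfolding F_def using y au(1)
        by (intro image_eqI[of _ _ "a \<otimes> r"]) (auto simp: M.smult_assoc1)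
    qed
  qed
  have G: "submodule G R M"
    by (rule M.submoduleI) (auto simp: G_def \<phi>_zero \<phi>_minus \<phi>_add \<phi>_smult)
  have FG: "F \<inter> G = {\<zero>\<^bsub>M\<^esub>}"
  proof -
    have "u = \<zero>\<^bsub>M\<^esub>" if "u \<in> F" "u \<in> G" for u
      using that \<phi>_ry y by (auto simp: F_def G_def)
    moreover have "\<zero>\<^bsub>M\<^esub> \<in> F" "\<zero>\<^bsub>M\<^esub> \<in> G"
      using subgroup.one_closed[OF submodule.axioms(1)[OF F]]
        subgroup.one_closed[OF submodule.axioms(1)[OF G]] by simp_all
    ultimately show ?thesis by blast
  qed
  have sum: "F <+>\<^bsub>M\<^esub> G = carrier M"
  proof
    show "F <+>\<^bsub>M\<^esub> G \<subseteq> carrier M" using y by (auto simp: set_add_def' F_def G_def)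
    show "carrier M \<subseteq> F <+>\<^bsub>M\<^esub> G"
    proof
      fix u assume u: "u \<in> carrier M"
      define f where "f = \<phi> u \<odot>\<^bsub>M\<^esub> y"
      have f: "f \<in> F" "f \<in> carrier M" "\<phi> f = \<phi> u" using u y \<phi> \<phi>_ry by (auto simp: f_def F_def)
      define g where "g = \<ominus>\<^bsub>M\<^esub> f \<oplus>\<^bsub>M\<^esub> u"
      have "\<phi> g = \<zero>" using u f \<phi> by (simp add: g_def \<phi>_add \<phi>_minus M.R.l_neg)
      hence "g \<in> G" using u f by (simp add: G_def g_def)
      moreover have "u = f \<oplus>\<^bsub>M\<^esub> g"
        using u f by (simp add: g_def M.M.a_assoc[symmetric] M.M.r_neg)
      ultimately show "u \<in> F <+>\<^bsub>M\<^esub> G" using f(1) by (auto simp: set_add_def')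
    qed
  qed
  have car: "carrier (free_module R 1) = {..<1} \<rightarrow>\<^sub>E carrier R" by (simp add: free_module_def)
  have u0: "u 0 \<in> carrier R" if "u \<in> carrier (free_module R 1)" for u
    using that unfolding car by (rule PiE_mem) simp
  have h: "h \<in> module_hom R (free_module R 1) M"
  proof -
    have "(u \<oplus>\<^bsub>free_module R 1\<^esub> v) 0 = u 0 \<oplus> v 0" "(r \<odot>\<^bsub>free_module R 1\<^esub> u) 0 = r \<otimes> u 0"
      for u v r by (simp_all add: free_module_def)
    thus ?thesis
      unfolding module_hom_def h_def using y(1)
      by (intro CollectI conjI ballI funcsetI) (simp_all add: u0 M.smult_l_distr M.smult_assoc1 del: One_nat_def)
  qed
  have "bij_betw h (carrier (free_module R 1)) F"
  proof (rule bij_betw_imageI)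
    show "inj_on h (carrier (free_module R 1))"
    proof (rule inj_onI)
      fix u v assume uv: "u \<in> carrier (free_module R 1)" "v \<in> carrier (free_module R 1)" "h u = h v"
      have "\<phi> (u 0 \<odot>\<^bsub>M\<^esub> y) = \<phi> (v 0 \<odot>\<^bsub>M\<^esub> y)"
        using uv(3) unfolding h_def by (rule arg_cong)
      hence "u 0 = v 0" unfolding \<phi>_ry[OF u0[OF uv(1)]] \<phi>_ry[OF u0[OF uv(2)]] .
      thus "u = v" using uv(1,2) unfolding car by (intro PiE_ext) auto
    qed
    show "h ` carrier (free_module R 1) = F"
    proof
      show "h ` carrier (free_module R 1) \<subseteq> F" using u0 by (auto simp: h_def F_def)
      show "F \<subseteq> h ` carrier (free_module R 1)"
      proof
        fix u assume "u \<in> F"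
        then obtain r where "r \<in> carrier R" "u = r \<odot>\<^bsub>M\<^esub> y" by (auto simp: F_def)
        thus "u \<in> h ` carrier (free_module R 1)"
          by (intro image_eqI[of _ _ "\<lambda>i\<in>{..<1}. r"]) (auto simp: h_def car simp del: One_nat_def)
      qed
    qed
  qed
  with F G FG sum h show ?thesis
    unfolding has_free_summand_def by (intro exI[of _ F] exI[of _ G] exI[of _ 1] exI[of _ h] conjI) (simp_all only: order_refl)
qed

lemma module_hom_closed: "h \<in> module_hom R M M' \<Longrightarrow> u \<in> carrier M \<Longrightarrow> h u \<in> carrier M'"
  by (auto simp: module_hom_def)

section \<open>Linear combinations of module generators\<close>

primrec lin_comb ::
  "nat \<Rightarrow> (bit fps fps set, 'a, 'd) module_scheme \<Rightarrow> (nat \<Rightarrow> 'a) \<Rightarrow> nat \<Rightarrow> (nat \<Rightarrow> bit fps fps) \<Rightarrow> 'a"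
  where
    "lin_comb N M e 0 s = \<zero>\<^bsub>M\<^esub>"
  | "lin_comb N M e (Suc k) s = lin_comb N M e k s \<oplus>\<^bsub>M\<^esub> hyp_class N (s k) \<odot>\<^bsub>M\<^esub> e k"

locale generated_module = M: Module.module "hyp_ring N" M
  for N :: nat and M (structure) +
  fixes e :: "nat \<Rightarrow> 'a"
  assumes e_closed [simp]: "e i \<in> carrier M"
begin

lemma lin_comb_closed [simp]: "lin_comb N M e k s \<in> carrier M"
  by (induction k) auto

lemma lin_comb_add:
  "lin_comb N M e k (\<lambda>i. s i + t i) = lin_comb N M e k s \<oplus> lin_comb N M e k t"
proof (induction k)
  case (Suc k)
  have "hyp_class N (s k + t k) \<odot> e k = hyp_class N (s k) \<odot> e k \<oplus> hyp_class N (t k) \<odot> e k"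
    unfolding hyp_class_hom(1)[symmetric] by (rule M.smult_l_distr) auto
  thus ?case using Suc by (simp add: M.M.a_ac)
qed simp

lemma lin_comb_smult: "lin_comb N M e k (\<lambda>i. a * s i) = hyp_class N a \<odot> lin_comb N M e k s"
proof (induction k)
  case (Suc k)
  have "hyp_class N (a * s k) \<odot> e k = hyp_class N a \<odot> (hyp_class N (s k) \<odot> e k)"
    unfolding hyp_class_hom(2)[symmetric] by (rule M.smult_assoc1) auto
  thus ?case using Suc by (simp add: M.smult_r_distr)
qed simp

lemma lin_comb_cong:
  "(\<And>i. i < k \<Longrightarrow> s i = t i) \<Longrightarrow> lin_comb N M e k s = lin_comb N M e k t"
  by (induction k) auto

lemma lin_comb_zero: "lin_comb N M e k (\<lambda>_. 0) = \<zero>"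
  using lin_comb_smult[of k 0 "\<lambda>_. 0"] by (simp flip: hyp_ring_zero)

lemma lin_comb_unit: "lin_comb N M e k (\<lambda>i. if i = j then 1 else 0) = (if j < k then e j else \<zero>)"
proof (induction k)
  case (Suc k)
  have "hyp_class N 1 \<odot> e k = e k" "hyp_class N 0 \<odot> e k = \<zero>"
    using M.smult_one[of "e k"] M.smult_l_null[of "e k"] by (simp_all add: hyp_ring_one hyp_ring_zero)
  thus ?case using Suc by (auto simp: less_Suc_eq)
qed simp

lemma submodule_lin_comb: "submodule (range (lin_comb N M e k)) (hyp_ring N) M"
proof (rule M.submoduleI)
  show "\<zero> \<in> range (lin_comb N M e k)" using lin_comb_zero by (metis rangeI)
  show "\<ominus> u \<in> range (lin_comb N M e k)" if u: "u \<in> range (lin_comb N M e k)" for u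
  proof -
    obtain s where s: "u = lin_comb N M e k s" using u by blast
    have "lin_comb N M e k (\<lambda>i. s i + s i) = \<zero>" unfolding char2 by (rule lin_comb_zero)
    hence "\<ominus> u = u" unfolding lin_comb_add s by (intro M.M.minus_equality) auto
    thus ?thesis using u by simp
  qed
  show "u \<oplus> v \<in> range (lin_comb N M e k)"
    if "u \<in> range (lin_comb N M e k)" "v \<in> range (lin_comb N M e k)" for u v
    using that by (auto simp flip: lin_comb_add)
  show "a \<odot> u \<in> range (lin_comb N M e k)"
    if "a \<in> carrier (hyp_ring N)" "u \<in> range (lin_comb N M e k)" for a u
    using that by (auto simp: carrier_hyp_ring_eq simp flip: lin_comb_smult)
qed auto

lemma hom_lin_comb:
  assumes h: "h \<in> module_hom (hyp_ring N) M (trunc_module N n)"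
    and w: "\<And>i. h (e i) = trunc N n (w i)"
  shows "h (lin_comb N M e k s) = trunc N n (\<Sum>i<k. s i * w i)"
proof (induction k)
  case 0
  obtain t where "h \<zero> = trunc N n t"
    using module_hom_closed[OF h M.M.zero_closed] unfolding trunc_module_ops by blast
  moreover have "h (hyp_class N 0 \<odot> \<zero>) = hyp_class N 0 \<odot>\<^bsub>trunc_module N n\<^esub> h \<zero>"
    using h M.M.zero_closed hyp_class_closed unfolding module_hom_def by blast
  moreover have "hyp_class N 0 \<odot> \<zero> = \<zero>" by (rule M.smult_r_null) simp
  ultimately show ?case by (simp add: trunc_module_ops)
next
  case (Suc k)
  have "h (lin_comb N M e (Suc k) s)
      = h (lin_comb N M e k s) \<oplus>\<^bsub>trunc_module N n\<^esub> hyp_class N (s k) \<odot>\<^bsub>trunc_module N n\<^esub> h (e k)"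
    using h by (simp add: module_hom_def)
  thus ?case using Suc by (simp add: w trunc_module_ops)
qed

end

lemma fin_gen_lin_comb:
  assumes M: "Module.module (hyp_ring N) M" and "fin_gen (hyp_ring N) M"
  obtains e k where "generated_module N M e" "range (lin_comb N M e k) = carrier M"
proof -
  interpret M: Module.module "hyp_ring N" M by fact
  obtain A where A: "finite A" "A \<subseteq> carrier M" "module_span (hyp_ring N) M A = carrier M"
    using assms(2) unfolding fin_gen_def by blast
  obtain xs where xs: "set xs = A" using finite_list[OF A(1)] by blast
  define e where "e = (\<lambda>i. if i < length xs then xs ! i else \<zero>\<^bsub>M\<^esub>)"
  have gen: "generated_module N M e"
    by unfold_locales (use A(2) xs in \<open>auto simp: e_def\<close>)
  interpret generated_module N M e by (rule gen)
  have "A \<subseteq> range (lin_comb N M e (length xs))"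
  proof
    fix a assume "a \<in> A"
    then obtain j where j: "j < length xs" "xs ! j = a" using xs by (auto simp: in_set_conv_nth)
    hence "lin_comb N M e (length xs) (\<lambda>i. if i = j then 1 else 0) = a"
      by (simp add: lin_comb_unit) (simp add: e_def)
    thus "a \<in> range (lin_comb N M e (length xs))" by (metis rangeI)
  qed
  hence "carrier M \<subseteq> range (lin_comb N M e (length xs))"
    using submodule_lin_comb unfolding A(3)[symmetric] module_span_def by blast
  hence "range (lin_comb N M e (length xs)) = carrier M" by auto
  with gen show thesis by (rule that)
qed

section \<open>Maximal Cohen-Macaulay modules mapping onto \<open>R / m\<^bsup>N+2\<^esup>\<close>\<close>

text \<open>
  The curve is a parameter of the hypersurface ring: the restriction of the equation to the curve is a
  unit times a power of \<open>x\<close>, and the restriction of \<open>\<alpha>\<close> is divisible by \<open>x\<close>.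
\<close>

lemma power_in_curve_hyp_poly:
  assumes N: "N > 0" and \<alpha>: "\<alpha> \<in> ord_ideal 1"
  obtains j c where "curve dvd \<alpha> ^ j - hyp_poly N * c"
proof -
  have "\<alpha> - fps_const (restr \<alpha>) \<in> ord_ideal 1"
    using curve_dvd_restr[of \<alpha>] curve_ord_ideal by (auto elim!: dvdE intro: ord_ideal_mult_right)
  from ord_ideal_diff[OF \<alpha> this] have "fps_nth (restr \<alpha>) 0 = 0" by (simp add: ord_ideal_1 del: One_nat_def)
  hence X: "fps_X dvd restr \<alpha>"
    by (intro dvdI[of _ _ "fps_shift 1 (restr \<alpha>)"] fps_ext) auto
  have nz: "restr (hyp_poly N) \<noteq> 0"
    using restr_cofactor_nonzero[OF N] by (simp add: hyp_poly_cofactor)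
  obtain u j where "u * restr (hyp_poly N) = fps_X ^ j"
    by (rule fps_mult_eq_X_power[OF nz])
  hence "restr (hyp_poly N) dvd fps_X ^ j" by (metis dvd_triv_right)
  also have "\<dots> dvd restr \<alpha> ^ j" using X by (rule dvd_power_same)
  finally obtain c where "restr (\<alpha> ^ j) = restr (hyp_poly N) * c" by (auto elim: dvdE)
  hence "restr (\<alpha> ^ j - hyp_poly N * fps_const c) = 0" by simp
  thus thesis by (intro that[of j "fps_const c"]) (simp only: restr_eq_0_iff)
qed

text \<open>
  Depth one provides some element of the maximal ideal that is regular on \<open>M\<close>. A power of it is a
  multiple of the curve, so the curve is regular as well.
\<close>

lemma curve_regular_on_max_CM:
  assumes N: "N > 0" and CM: "max_CM (hyp_ring N) M"
    and u: "u \<in> carrier M" "hyp_class N curve \<odot>\<^bsub>M\<^esub> u = \<zero>\<^bsub>M\<^esub>"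
  shows "u = \<zero>\<^bsub>M\<^esub>"
proof -
  have M: "Module.module (hyp_ring N) M" using CM by (simp add: max_CM_def)
  interpret M: Module.module "hyp_ring N" M by (rule M)
  have "depth (hyp_ring N) M = 1" using CM krull_dim_hyp_ring[OF N] by (simp add: max_CM_def)
  moreover have "depth (hyp_ring N) M \<le> 0"
    if "\<And>as. set as \<subseteq> max_ideal (hyp_ring N) \<Longrightarrow> regular_seq (hyp_ring N) M as \<Longrightarrow> as = []"
    unfolding depth_def by (rule Sup_least) (use that in \<open>auto simp: zero_enat_def\<close>)
  ultimately obtain as where as: "set as \<subseteq> max_ideal (hyp_ring N)" "regular_seq (hyp_ring N) M as" "as \<noteq> []"
    by auto
  then obtain a bs where eq: "as = a # bs" by (cases as) auto
  obtain \<alpha> where \<alpha>: "\<alpha> \<in> ord_ideal 1" "a = hyp_class N \<alpha>"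
    using as(1) by (auto simp: eq max_ideal_conv)
  obtain j c where "curve dvd \<alpha> ^ j - hyp_poly N * c" by (rule power_in_curve_hyp_poly[OF N \<alpha>(1)])
  then obtain t where "\<alpha> ^ j - hyp_poly N * c = curve * t" by (rule dvdE)
  hence "\<alpha> ^ j - t * curve = hyp_poly N * c" by (simp add: algebra_simps)
  hence "hyp_class N (\<alpha> ^ j) = hyp_class N t \<otimes>\<^bsub>hyp_ring N\<^esub> hyp_class N curve"
    by (simp add: hyp_class_eq_iff)
  hence "hyp_class N (\<alpha> ^ j) \<odot>\<^bsub>M\<^esub> u = \<zero>\<^bsub>M\<^esub>"
    using u M.smult_assoc1[OF hyp_class_closed hyp_class_closed u(1)] by simp
  thus ?thesis
  proof (induction j)
    case 0
    thus ?case using M.smult_one[OF u(1)] by (simp add: hyp_ring_one)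
  next
    case (Suc j)
    have "hyp_class N (\<alpha> ^ Suc j) \<odot>\<^bsub>M\<^esub> u = a \<odot>\<^bsub>M\<^esub> (hyp_class N (\<alpha> ^ j) \<odot>\<^bsub>M\<^esub> u)"
      using M.smult_assoc1[OF hyp_class_closed hyp_class_closed u(1), of \<alpha> "\<alpha> ^ j"] by (simp add: \<alpha>(2))
    hence "hyp_class N (\<alpha> ^ j) \<odot>\<^bsub>M\<^esub> u = \<zero>\<^bsub>M\<^esub>"
      using regular_seq_nonzerodivisor[OF M as(2)[unfolded eq]] Suc.prems u(1) by simp
    thus ?case by (rule Suc.IH)
  qed
qed

lemma hyp_poly_notin_ord_ideal:
  assumes "N > 0" shows "hyp_poly N \<notin> ord_ideal (N + 3)"
proof
  assume "hyp_poly N \<in> ord_ideal (N + 3)"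
  hence "cf (hyp_poly N) (N + 1) 1 = 0" by (simp add: ord_ideal_def)
  moreover have "cf (hyp_poly N) (N + 1) 1 = 1"
  proof -
    have "hyp_poly N = fps_const (fps_X ^ Suc N) * Y_ser + X_ser * Y_ser ^ Suc N"
      by (simp add: hyp_poly_def algebra_simps flip: fps_const_mult)
    thus ?thesis using assms by (simp add: fps_X_power_nth)
  qed
  ultimately show False by simp
qed

lemma presentation_kernel_lin_comb:
  assumes N: "N > 0" and CM: "max_CM (hyp_ring N) M" and gen: "generated_module N M e"
  shows "presentation_kernel N k {s. lin_comb N M e k s = \<zero>\<^bsub>M\<^esub>}"
proof -
  interpret generated_module N M e by (rule gen)
  show ?thesis
  proof (unfold_locales, goal_cases)
    case (4 s)
    thus ?case using curve_regular_on_max_CM[OF N CM lin_comb_closed] by (simp add: lin_comb_smult)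
  next
    case (5 s)
    have "hyp_class N (hyp_poly N) = hyp_class N 0" by (simp add: hyp_class_eq_iff)
    thus ?case by (simp add: lin_comb_smult flip: hyp_ring_zero)
  next
    case (6 s t)
    thus ?case using lin_comb_cong[of k s t] by simp
  qed (use N in \<open>auto simp: lin_comb_add lin_comb_smult\<close>)
qed

text \<open>
  Present \<open>M\<close> as \<open>S\<^sup>k / K\<close>, choose \<open>v\<close> mapping to the class of \<open>1\<close> and write \<open>f v = \<Sum> c\<^sub>j b\<^sub>j\<close> in the basis
  of \<open>K\<close>. If some \<open>c\<^sub>j\<close> is a unit, the functional \<open>s \<mapsto> (f s)\<^sub>j\<close>, the \<open>j\<close>-th coordinate, maps \<open>K\<close> to \<open>f S\<close>
  and \<open>v\<close> to a unit, so that it splits off a free summand. Otherwise the \<open>c\<^sub>j\<close> have positive order. Lift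
  \<open>h\<close> to a linear form \<open>w\<close> on \<open>S\<^sup>k\<close>. It maps the \<open>b\<^sub>j\<close> into \<open>(x, y)\<^bsup>N+2\<^esup>\<close> and \<open>v\<close> to a unit, so
  \<open>f w(v) = \<Sum> c\<^sub>j w(b\<^sub>j)\<close> shows that \<open>f\<close> has order at least \<open>N + 3\<close>, which is not the case.
\<close>

lemma free_summand_if_onto:
  assumes N: "N > 0" and CM: "max_CM (hyp_ring N) M"
    and h: "h \<in> module_hom (hyp_ring N) M (trunc_module N (N + 2))"
    and onto: "h ` carrier M = carrier (trunc_module N (N + 2))"
  shows "has_free_summand (hyp_ring N) M"
proof -
  have M: "Module.module (hyp_ring N) M" and fg: "fin_gen (hyp_ring N) M"
    using CM by (simp_all add: max_CM_def)
  obtain e k where gen: "generated_module N M e" and span: "range (lin_comb N M e k) = carrier M"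
    by (rule fin_gen_lin_comb[OF M fg])
  interpret generated_module N M e by (rule gen)
  define \<pi> where "\<pi> = lin_comb N M e k"
  interpret K: presentation_kernel N k "{s. lin_comb N M e k s = \<zero>\<^bsub>M\<^esub>}"
    by (rule presentation_kernel_lin_comb[OF N CM gen])
  have \<pi>_add: "\<pi> (\<lambda>i. s i + t i) = \<pi> s \<oplus>\<^bsub>M\<^esub> \<pi> t" and \<pi>_smult: "\<pi> (\<lambda>i. a * s i) = hyp_class N a \<odot>\<^bsub>M\<^esub> \<pi> s"
    for s t a by (simp_all add: \<pi>_def lin_comb_add lin_comb_smult)
  obtain v where v: "h (\<pi> v) = trunc N (N + 2) 1"
  proof -
    have "trunc N (N + 2) 1 \<in> h ` carrier M" unfolding onto trunc_module_ops by simp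
    thus thesis using that unfolding span[symmetric] \<pi>_def by auto
  qed
  define c where "c = K.coord (\<lambda>i. hyp_poly N * v i)"
  have fv: "hyp_poly N * v i = (\<Sum>j<k. c j * K.basis j i)" if "i < k" for i
    using K.coord[OF K.K_hyp_poly that, of v] by (simp add: c_def)
  have "\<exists>j<k. c j \<notin> ord_ideal 1"
  proof (rule ccontr)
    assume "\<not> ?thesis"
    hence c1: "c j \<in> ord_ideal 1" if "j < k" for j using that by blast
    \<comment> \<open>The images of the generators, lifted to the power series ring, define the linear form \<open>w\<close>.\<close>
    have "\<exists>w. h (e i) = trunc N (N + 2) w" for i
      using module_hom_closed[OF h e_closed[of i]] unfolding trunc_module_ops by blast
    then obtain w where w: "\<And>i. h (e i) = trunc N (N + 2) (w i)" by metis
    note h_comb = hom_lin_comb[OF h w, of k]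
    define W where "W = (\<Sum>i<k. v i * w i)"
    have "trunc N (N + 2) W = trunc N (N + 2) 1"
      using v h_comb[of v] by (simp add: \<pi>_def W_def)
    hence "W - 1 \<in> ord_ideal (N + 2)" by (simp add: trunc_eq_iff)
    hence "W - 1 \<in> ord_ideal 1" using ord_ideal_antimono[of 1 "N + 2"] by auto
    hence "W \<notin> ord_ideal 1"
      using ord_ideal_diff[of W 1 "W - 1"] one_notin_ord_ideal by auto
    then obtain W' where W': "W' * W = 1" using unit_if_notin_ord_ideal by blast
    have basis_w: "(\<Sum>i<k. K.basis j i * w i) \<in> ord_ideal (N + 2)" if "j < k" for j
    proof -
      have "h (lin_comb N M e k (K.basis j)) = h (lin_comb N M e k (\<lambda>_. 0))"
        using K.basis(1)[OF that] lin_comb_zero by simp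
      hence "trunc N (N + 2) (\<Sum>i<k. K.basis j i * w i) = trunc N (N + 2) 0"
        unfolding h_comb by simp
      thus ?thesis by (simp add: trunc_eq_iff)
    qed
    have "hyp_poly N * W = (\<Sum>i<k. (\<Sum>j<k. c j * K.basis j i) * w i)"
      unfolding W_def sum_distrib_left by (rule sum.cong) (simp_all add: fv flip: mult.assoc)
    also have "\<dots> = (\<Sum>j<k. c j * (\<Sum>i<k. K.basis j i * w i))"
      unfolding sum_distrib_left sum_distrib_right mult.assoc by (rule sum.swap)
    also have "\<dots> \<in> ord_ideal (1 + (N + 2))"
      by (intro ord_ideal_sum ord_ideal_mult c1 basis_w) auto
    finally have "W' * (hyp_poly N * W) \<in> ord_ideal (1 + (N + 2))" by (rule ord_ideal_mult_left)
    also have "W' * (hyp_poly N * W) = hyp_poly N * (W' * W)" by (simp only: mult_ac)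
    also have "1 + (N + 2) = N + 3" by simp
    finally show False using W' hyp_poly_notin_ord_ideal[OF N] by simp
  qed
  then obtain j where j: "j < k" and "c j \<notin> ord_ideal 1" by blast
  then obtain \<epsilon> where \<epsilon>: "\<epsilon> * c j = 1" using unit_if_notin_ord_ideal by blast
  \<comment> \<open>The \<open>j\<close>-th coordinate of \<open>f s\<close>, scaled so that \<open>v\<close> has the value \<open>1\<close>.\<close>
  define \<nu> where "\<nu> = (\<lambda>s. \<epsilon> * K.coord (\<lambda>i. hyp_poly N * s i) j)"
  have \<nu>_add: "\<nu> (\<lambda>i. s i + t i) = \<nu> s + \<nu> t" for s t
    using K.coord_add[OF K.K_hyp_poly K.K_hyp_poly j, of s t] by (simp add: \<nu>_def distrib_left)
  have \<nu>_smult: "\<nu> (\<lambda>i. a * s i) = a * \<nu> s" for s a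
    using K.coord_smult[OF K.K_hyp_poly j, of a s] by (simp add: \<nu>_def mult.left_commute)
  have \<nu>_K: "hyp_poly N dvd \<nu> s" if "\<pi> s = \<zero>\<^bsub>M\<^esub>" for s
    using K.coord_smult[of s j "hyp_poly N"] that j by (simp add: \<nu>_def \<pi>_def)
  have well_defined: "hyp_class N (\<nu> s) = hyp_class N (\<nu> t)" if "\<pi> s = \<pi> t" for s t
  proof -
    have "\<pi> (\<lambda>i. s i + t i) = \<pi> (\<lambda>i. t i + t i)" unfolding \<pi>_add that ..
    also have "\<dots> = \<zero>\<^bsub>M\<^esub>" unfolding char2 \<pi>_def by (rule lin_comb_zero)
    finally have "hyp_poly N dvd \<nu> s + \<nu> t" unfolding \<nu>_add[symmetric] by (rule \<nu>_K)
    thus ?thesis unfolding hyp_class_eq_iff char2(3) .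
  qed
  define \<phi> where "\<phi> = (\<lambda>u. hyp_class N (\<nu> (SOME s. \<pi> s = u)))"
  have \<phi>: "\<phi> (\<pi> s) = hyp_class N (\<nu> s)" for s
    unfolding \<phi>_def by (rule well_defined) (rule someI[of _ s], rule refl)
  have carrier: "carrier M = range \<pi>" using span by (simp add: \<pi>_def)
  show ?thesis
  proof (rule has_free_summand_if_functional[OF M, of \<phi> "\<pi> v"])
    show "\<phi> u \<in> carrier (hyp_ring N)" if "u \<in> carrier M" for u
      by (simp add: \<phi>_def)
    show "\<phi> (u \<oplus>\<^bsub>M\<^esub> u') = \<phi> u \<oplus>\<^bsub>hyp_ring N\<^esub> \<phi> u'" if "u \<in> carrier M" "u' \<in> carrier M" for u u'
      using that unfolding carrier by (auto simp: \<phi> \<nu>_add simp flip: \<pi>_add)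
    show "\<phi> (r \<odot>\<^bsub>M\<^esub> u) = r \<otimes>\<^bsub>hyp_ring N\<^esub> \<phi> u" if "r \<in> carrier (hyp_ring N)" "u \<in> carrier M" for r u
      using that unfolding carrier carrier_hyp_ring_eq by (auto simp: \<phi> \<nu>_smult simp flip: \<pi>_smult)
    show "\<pi> v \<in> carrier M" by (simp add: \<pi>_def)
    have "\<nu> v = 1" using \<epsilon> by (simp add: \<nu>_def c_def)
    thus "\<phi> (\<pi> v) = \<one>\<^bsub>hyp_ring N\<^esub>" by (simp add: \<phi> hyp_ring_one)
  qed
qed

definition zero_module :: "nat \<Rightarrow> (bit fps fps set, (nat \<Rightarrow> bit fps fps set) set) module"
  where "zero_module N =
    \<lparr> carrier = {{}}, monoid.mult = (\<lambda>_ _. {}), monoid.one = {}, ring.zero = {},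
      ring.add = (\<lambda>_ _. {}), module.smult = (\<lambda>_ _. {}) \<rparr>"

text \<open>
  A rank one free module surjects onto the cyclic module \<open>R / m\<^bsup>N+2\<^esup>\<close>, so the value is at most one, with
  the zero module as the summand without free part. The value zero is excluded by the preceding lemma.
\<close>

lemma delta_inv_order:
  assumes N: "N > 0"
  shows "delta_inv (hyp_ring N) (trunc_module N (N + 2)) = 1"
proof -
  let ?R = "hyp_ring N" and ?T = "trunc_module N (N + 2)"
  let ?P = "\<lambda>n. \<exists>Y :: (bit fps fps set, (nat \<Rightarrow> bit fps fps set) set) module. \<exists>h.
       Module.module ?R Y \<and> (carrier Y = {\<zero>\<^bsub>Y\<^esub>} \<or> max_CM ?R Y) \<and> \<not> has_free_summand ?R Y \<and>
       h \<in> module_hom ?R (direct_sum Y (free_module ?R n)) ?T \<and>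
       h ` carrier (direct_sum Y (free_module ?R n)) = carrier ?T"
  have one: "hyp_class N 1 \<noteq> hyp_class N 0"
  proof
    assume "hyp_class N 1 = hyp_class N 0"
    hence "hyp_class N 1 \<in> hyp_class N ` ord_ideal 1" using zero_ord_ideal by blast
    thus False using one_notin_ord_ideal by (simp add: hyp_class_in_image_iff del: One_nat_def)
  qed
  have trunc_one: "trunc N (N + 2) 1 \<noteq> trunc N (N + 2) 0"
    using one_notin_ord_ideal ord_ideal_antimono[of 1 "N + 2"] by (auto simp: trunc_eq_iff)
  have not0: "\<not> ?P 0"
  proof
    assume "?P 0"
    then obtain Y :: "(bit fps fps set, (nat \<Rightarrow> bit fps fps set) set) module" and h
      where Y: "Module.module ?R Y" "carrier Y = {\<zero>\<^bsub>Y\<^esub>} \<or> max_CM ?R Y" "\<not> has_free_summand ?R Y"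
        and h: "h \<in> module_hom ?R (direct_sum Y (free_module ?R 0)) ?T"
        and onto: "h ` carrier (direct_sum Y (free_module ?R 0)) = carrier ?T"
      by (elim exE conjE) (rule that; assumption)
    define z :: "nat \<Rightarrow> bit fps fps set" where "z = (\<lambda>_. undefined)"
    define g where "g = (\<lambda>u. h (u, z))"
    have car: "carrier (direct_sum Y (free_module ?R 0)) = carrier Y \<times> {z}"
      by (simp add: direct_sum_def free_module_def z_def)
    have ops: "(u, z) \<oplus>\<^bsub>direct_sum Y (free_module ?R 0)\<^esub> (u', z) = (u \<oplus>\<^bsub>Y\<^esub> u', z)"
      "r \<odot>\<^bsub>direct_sum Y (free_module ?R 0)\<^esub> (u, z) = (r \<odot>\<^bsub>Y\<^esub> u, z)" for u u' r
      by (auto simp: direct_sum_def free_module_def z_def)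
    have g: "g \<in> module_hom ?R Y ?T"
      using h unfolding module_hom_def car by (auto simp: g_def ops[symmetric] simp del: ops)
    have g_onto: "g ` carrier Y = carrier ?T"
      using onto unfolding car by (auto simp: g_def image_iff)
    have "carrier Y \<noteq> {\<zero>\<^bsub>Y\<^esub>}"
    proof
      assume "carrier Y = {\<zero>\<^bsub>Y\<^esub>}"
      hence "range (trunc N (N + 2)) = {g \<zero>\<^bsub>Y\<^esub>}" using g_onto unfolding trunc_module_ops by simp
      hence "trunc N (N + 2) s = g \<zero>\<^bsub>Y\<^esub>" for s by blast
      thus False using trunc_one by metis
    qed
    hence "max_CM ?R Y" using Y(2) by blast
    from free_summand_if_onto[OF N this g g_onto] Y(3) show False by blast
  qed
  have "?P 1"
  proof (intro exI[of _ "zero_module N"] exI[of _ "\<lambda>u. trunc N (N + 2) (inv_into UNIV (hyp_class N) (snd u 0))"] conjI)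
    let ?Z = "zero_module N"
    let ?D = "direct_sum ?Z (free_module ?R 1)"
    have Z: "carrier ?Z = {{}}" "\<zero>\<^bsub>?Z\<^esub> = {}" "u \<oplus>\<^bsub>?Z\<^esub> v = {}" "r \<odot>\<^bsub>?Z\<^esub> u = {}" for u v r
      by (simp_all add: zero_module_def)
    show mod: "Module.module ?R ?Z"
    proof (rule moduleI)
      show "abelian_group ?Z" by (rule abelian_groupI) (auto simp: Z)
    qed (auto simp: Z cring_hyp_ring)
    show "carrier ?Z = {\<zero>\<^bsub>?Z\<^esub>} \<or> max_CM ?R ?Z" by (simp add: Z)
    show "\<not> has_free_summand ?R ?Z"
      by (rule no_free_summand_if_annihilated[OF mod, of "hyp_class N 1"])
        (use one in \<open>auto simp: Z hyp_ring_zero\<close>)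
    have inv: "trunc N (N + 2) (inv_into UNIV (hyp_class N) (hyp_class N s)) = trunc N (N + 2) s" for s
    proof -
      have "hyp_class N (inv_into UNIV (hyp_class N) (hyp_class N s)) = hyp_class N s"
        by (rule f_inv_into_f) simp
      thus ?thesis by (simp add: trunc_def)
    qed
    have D: "carrier ?D = {{}} \<times> ({..<1} \<rightarrow>\<^sub>E range (hyp_class N))"
      by (simp add: direct_sum_def free_module_def Z carrier_hyp_ring_eq)
    have D_ops: "snd (u \<oplus>\<^bsub>?D\<^esub> v) 0 = snd u 0 \<oplus>\<^bsub>?R\<^esub> snd v 0" "snd (r \<odot>\<^bsub>?D\<^esub> u) 0 = r \<otimes>\<^bsub>?R\<^esub> snd u 0"
      for u v r by (simp_all add: direct_sum_def free_module_def)
    have snd0: "\<exists>s. snd u 0 = hyp_class N s" if "u \<in> carrier ?D" for u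
      using that unfolding D by (auto dest!: PiE_mem[of _ _ _ 0])
    show "(\<lambda>u. trunc N (N + 2) (inv_into UNIV (hyp_class N) (snd u 0))) \<in> module_hom ?R ?D ?T"
      unfolding module_hom_def
    proof (intro CollectI conjI ballI)
      show "(\<lambda>u. trunc N (N + 2) (inv_into UNIV (hyp_class N) (snd u 0))) \<in> carrier ?D \<rightarrow> carrier ?T"
        unfolding trunc_module_ops by (intro funcsetI rangeI)
    next
      fix u v assume "u \<in> carrier ?D" "v \<in> carrier ?D"
      then obtain s t where "snd u 0 = hyp_class N s" "snd v 0 = hyp_class N t" using snd0 by metis
      thus "trunc N (N + 2) (inv_into UNIV (hyp_class N) (snd (u \<oplus>\<^bsub>?D\<^esub> v) 0))
        = trunc N (N + 2) (inv_into UNIV (hyp_class N) (snd u 0)) \<oplus>\<^bsub>?T\<^esub> trunc N (N + 2) (inv_into UNIV (hyp_class N) (snd v 0))"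
        unfolding D_ops by (simp add: inv trunc_module_ops del: add_2_eq_Suc')
    next
      fix r u assume "r \<in> carrier ?R" "u \<in> carrier ?D"
      then obtain a s where "r = hyp_class N a" "snd u 0 = hyp_class N s"
        using snd0 unfolding carrier_hyp_ring_eq by blast
      thus "trunc N (N + 2) (inv_into UNIV (hyp_class N) (snd (r \<odot>\<^bsub>?D\<^esub> u) 0))
        = r \<odot>\<^bsub>?T\<^esub> trunc N (N + 2) (inv_into UNIV (hyp_class N) (snd u 0))"
        unfolding D_ops by (simp add: inv trunc_module_ops del: add_2_eq_Suc')
    qed
    show "(\<lambda>u. trunc N (N + 2) (inv_into UNIV (hyp_class N) (snd u 0))) ` carrier ?D = carrier ?T"
    proof
      show "(\<lambda>u. trunc N (N + 2) (inv_into UNIV (hyp_class N) (snd u 0))) ` carrier ?D \<subseteq> carrier ?T"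
        unfolding trunc_module_ops by (intro image_subsetI rangeI)
      show "carrier ?T \<subseteq> (\<lambda>u. trunc N (N + 2) (inv_into UNIV (hyp_class N) (snd u 0))) ` carrier ?D"
      proof
        fix C assume "C \<in> carrier ?T"
        then obtain s where "C = trunc N (N + 2) s" unfolding trunc_module_ops by blast
        thus "C \<in> (\<lambda>u. trunc N (N + 2) (inv_into UNIV (hyp_class N) (snd u 0))) ` carrier ?D"
          by (intro image_eqI[of _ _ "({}, \<lambda>i\<in>{..<1}. hyp_class N s)"])
            (auto simp: D inv simp del: add_2_eq_Suc' One_nat_def)
      qed
    qed
  qed
  moreover have "1 \<le> n" if "?P n" for n
    using that not0 by (cases n) auto
  ultimately have "(LEAST n. ?P n) = 1" by (rule Least_equality)
  thus ?thesis unfolding delta_inv_def .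
qed

lemma ring_index_hyp_ring:
  assumes N: "N > 0" shows "ring_index (hyp_ring N) = enat (N + 2)"
  unfolding ring_index_def
proof (rule antisym)
  let ?A = "{enat n | n. n \<ge> 1 \<and> delta_inv (hyp_ring N) (trunc_module N n) = 1}"
  have "enat (N + 2) \<in> ?A" using delta_inv_order[OF N] by auto
  thus "Inf ?A \<le> enat (N + 2)" by (rule Inf_lower)
  show "enat (N + 2) \<le> Inf ?A"
  proof (rule Inf_greatest, clarify)
    fix n assume "delta_inv (hyp_ring N) (trunc_module N n) = 1"
    hence "\<not> n \<le> N + 1" using delta_inv_small[OF N, of n] by auto
    thus "enat (N + 2) \<le> enat n" by simp
  qed
qed

section \<open>The upper bound for the generalized Loewy length\<close>

text \<open>
  Let \<open>Q = x\<^sup>2 + xy + y\<^sup>2\<close>. Modulo \<open>Q\<close> one has \<open>x\<^sup>3 = y\<^sup>3\<close>, which reduces the equation to \<open>y\<^bsup>N+2\<^esup>\<close> up to sign if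
  \<open>N \<equiv> 1\<close> modulo \<open>3\<close>, and to \<open>y\<^bsup>N+1\<^esup> (x + y)\<close> up to sign if \<open>N \<equiv> 2\<close>. Both give \<open>y\<^bsup>N+3\<^esup>\<close> and
  \<open>x y\<^bsup>N+2\<^esup>\<close>; all other monomials of degree \<open>N + 3\<close> follow from \<open>x\<^sup>2 = -xy - y\<^sup>2\<close>. Conceptually, \<open>Q\<close>
  is the norm form of \<open>F\<^sub>4\<close> if the ground field is \<open>F\<^sub>2\<close>, and \<open>xy(x\<^sup>N + y\<^sup>N)\<close> does not vanish at its
  roots, the primitive third roots of unity, unless \<open>3\<close> divides \<open>N\<close>.
\<close>

lemma monomials_in_loewy_ideal:
  fixes x y :: "'a::comm_ring_1"
  assumes add: "\<And>a b. a \<in> J \<Longrightarrow> b \<in> J \<Longrightarrow> a + b \<in> J"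
    and mult: "\<And>a r. a \<in> J \<Longrightarrow> r * a \<in> J"
    and Q: "x ^ 2 + x * y + y ^ 2 \<in> J" and f: "x * y * (x ^ N + y ^ N) \<in> J"
    and N: "\<not> 3 dvd N"
  shows "i \<le> N + 3 \<Longrightarrow> x ^ i * y ^ (N + 3 - i) \<in> J"
proof -
  have diff: "a - b \<in> J" if "a \<in> J" "b \<in> J" for a b
    using add[OF that(1) mult[OF that(2), of "-1"]] by simp
  define k where "k = N div 3"
  have cubes: "x ^ (3 * k) - y ^ (3 * k) \<in> J"
  proof -
    have "x ^ 3 - y ^ 3 = (x - y) * (x ^ 2 + x * y + y ^ 2)"
      by (simp add: power2_eq_square power3_eq_cube algebra_simps)
    hence "x ^ 3 - y ^ 3 \<in> J" using mult[OF Q] by simp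
    from mult[OF this, of "\<Sum>i<k. (y ^ 3) ^ (k - Suc i) * (x ^ 3) ^ i"]
    show ?thesis unfolding power_mult power_diff_sumr2 by (simp only: mult.commute)
  qed
  have "y ^ (N + 3) \<in> J \<and> x * y ^ (N + 2) \<in> J"
  proof -
    have "N = 3 * k + 1 \<or> N = 3 * k + 2"
      using N unfolding k_def by presburger
    then consider "N = 3 * k + 1" | "N = 3 * k + 2" by blast
    thus ?thesis
    proof cases
      case 1
      have "y ^ (3 * k + 3) = y ^ (3 * k + 1) * (x ^ 2 + x * y + y ^ 2)
          - (x * y * (x ^ N + y ^ N) - x ^ 2 * y * (x ^ (3 * k) - y ^ (3 * k)))"
        unfolding 1 by (simp add: power_add power2_eq_square power3_eq_cube algebra_simps)
      also have "\<dots> \<in> J" by (intro diff mult Q f cubes)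
      finally have *: "y ^ (N + 2) \<in> J" by (simp add: 1 numeral_3_eq_3)
      have "y ^ (N + 3) = y * y ^ (N + 2)" by (simp add: numeral_3_eq_3)
      thus ?thesis using * by (auto intro: mult)
    next
      case 2
      have "x ^ 2 * y ^ (3 * k + 2) = y ^ (3 * k + 1) * x * (x ^ 2 + x * y + y ^ 2)
          - (x * y * (x ^ N + y ^ N) - x ^ 3 * y * (x ^ (3 * k) - y ^ (3 * k)))"
        unfolding 2 by (simp add: power_add power2_eq_square power3_eq_cube algebra_simps)
      also have "\<dots> \<in> J" by (intro diff mult Q f cubes)
      finally have "x ^ 2 * y ^ (3 * k + 2) \<in> J" .
      from diff[OF mult[OF Q, of "y ^ (3 * k + 2)"] this]
      have *: "y ^ (N + 1) * (x + y) \<in> J"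
        unfolding 2 by (simp add: power_add power2_eq_square power3_eq_cube algebra_simps)
      have "y ^ (N + 3) = y ^ (N + 1) * (x ^ 2 + x * y + y ^ 2) - x * (y ^ (N + 1) * (x + y))"
        by (simp add: power_add power2_eq_square power3_eq_cube algebra_simps)
      also have "\<dots> \<in> J" by (intro diff mult Q *)
      finally have y: "y ^ (N + 3) \<in> J" .
      have "x * y ^ (N + 2) = y * (y ^ (N + 1) * (x + y)) - y ^ (N + 3)"
        by (simp add: power_add power2_eq_square power3_eq_cube algebra_simps)
      also have "\<dots> \<in> J" by (intro diff mult * y)
      finally show ?thesis using y by simp
    qed
  qed
  hence base: "y ^ (N + 3) \<in> J" "x * y ^ (N + 2) \<in> J" by simp_all
  show "i \<le> N + 3 \<Longrightarrow> x ^ i * y ^ (N + 3 - i) \<in> J"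
  proof (induction i rule: less_induct)
    case (less i)
    consider "i = 0" | "i = 1" | j where "i = j + 2"
      by (metis One_nat_def Suc_1 add.commute add_2_eq_Suc not0_implies_Suc)
    thus ?case
    proof cases
      case 3
      define l where "l = N + 3 - i"
      have l: "N + 3 - j = l + 2" "N + 3 - (j + 1) = l + 1" using less.prems 3 by (auto simp: l_def)
      have "x ^ j * y ^ (l + 2) \<in> J" "x ^ (j + 1) * y ^ (l + 1) \<in> J"
        using less.IH[of j] less.IH[of "j + 1"] less.prems unfolding 3 l[symmetric] by auto
      hence "x ^ j * y ^ l * (x ^ 2 + x * y + y ^ 2) - x ^ (j + 1) * y ^ (l + 1) - x ^ j * y ^ (l + 2) \<in> J"
        by (intro diff mult[OF Q]) simp_all
      also have "x ^ j * y ^ l * (x ^ 2 + x * y + y ^ 2) - x ^ (j + 1) * y ^ (l + 1) - x ^ j * y ^ (l + 2)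
          = x ^ i * y ^ l"
        unfolding 3 by (simp add: power_add power2_eq_square algebra_simps)
      finally show ?thesis unfolding l_def .
    qed (use base in simp_all)
  qed
qed

text \<open>
  Induction on the degree, passing to the colon ideals \<open>I : x\<close> and \<open>I : y\<close>.
\<close>

lemma ord_ideal_subset_if_monomials:
  assumes "series_ideal I" "\<And>i. i \<le> n \<Longrightarrow> X_ser ^ i * Y_ser ^ (n - i) \<in> I"
  shows "ord_ideal n \<subseteq> I"
  using assms
proof (induction n arbitrary: I)
  case 0
  interpret series_ideal I by fact
  have "X_ser ^ 0 * Y_ser ^ (0 - 0) \<in> I" by (rule 0(2)) simp
  hence "1 \<in> I" by simp
  hence "r * 1 \<in> I" for r by (rule mult)
  thus ?case by auto
next
  case (Suc n)
  interpret series_ideal I by fact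
  have colon: "series_ideal {s. s * a \<in> I}" for a
    by unfold_locales (auto simp: distrib_right mult.assoc intro: add mult)
  have "X_ser ^ i * Y_ser ^ (n - i) \<in> {s. s * X_ser \<in> I}" if "i \<le> n" for i
  proof -
    have "X_ser ^ Suc i * Y_ser ^ (Suc n - Suc i) \<in> I" using that by (intro Suc.prems(2)) simp
    thus ?thesis by (simp add: mult_ac del: fps_const_power)
  qed
  hence X: "ord_ideal n \<subseteq> {s. s * X_ser \<in> I}" by (intro Suc.IH colon) 
  have "X_ser ^ i * Y_ser ^ (n - i) \<in> {s. s * Y_ser \<in> I}" if "i \<le> n" for i
  proof -
    have "X_ser ^ i * Y_ser ^ (Suc n - i) \<in> I" using that by (intro Suc.prems(2)) simp
    thus ?thesis using that by (simp add: Suc_diff_le mult_ac del: fps_const_power)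
  qed
  hence Y: "ord_ideal n \<subseteq> {s. s * Y_ser \<in> I}" by (intro Suc.IH colon)
  show ?case
  proof
    fix g assume "g \<in> ord_ideal (Suc n)"
    then obtain a b where "a \<in> ord_ideal n" "b \<in> ord_ideal n" "g = a * X_ser + b * Y_ser"
      by (rule ord_ideal_Suc_decomp)
    thus "g \<in> I" using X Y by (auto intro: add)
  qed
qed

text \<open>
  The irreducible quadratic form over \<open>F\<^sub>2\<close>. Having no root in \<open>F\<^sub>2\<close>, it avoids the tangent lines
  that obstruct parameters of order one.
\<close>

definition conic :: "bit fps fps"
  where "conic = X_ser ^ 2 + X_ser * Y_ser + Y_ser ^ 2"

lemma conic_ord_ideal: "conic \<in> ord_ideal 1"
proof -
  have *: "conic = X_ser * (X_ser + Y_ser) + Y_ser * Y_ser"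
    by (simp only: conic_def power2_eq_square distrib_left)
  show ?thesis unfolding * by (intro ord_ideal_add ord_ideal_mult_right X_ord_ideal Y_ord_ideal)
qed

lemma power_subset_conic:
  assumes "\<not> 3 dvd N"
  shows "hyp_class N ` ord_ideal (N + 3) \<subseteq> genideal (hyp_ring N) {hyp_class N conic}"
proof -
  define J where "J = {t. \<exists>u v. t = u * conic + v * hyp_poly N}"
  interpret J: series_ideal J
  proof
    show "0 \<in> J" unfolding J_def by (intro CollectI exI[of _ 0]) simp
  next
    fix a b assume "a \<in> J" "b \<in> J"
    then obtain u v u' v' where "a = u * conic + v * hyp_poly N" "b = u' * conic + v' * hyp_poly N"
      by (auto simp: J_def)
    hence "a + b = (u + u') * conic + (v + v') * hyp_poly N" by (simp add: algebra_simps)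
    thus "a + b \<in> J" unfolding J_def by blast
  next
    fix a r assume "a \<in> J"
    then obtain u v where "a = u * conic + v * hyp_poly N" by (auto simp: J_def)
    hence "r * a = (r * u) * conic + (r * v) * hyp_poly N" by (simp add: algebra_simps)
    thus "r * a \<in> J" unfolding J_def by blast
  qed
  have "conic = 1 * conic + 0 * hyp_poly N" "hyp_poly N = 0 * conic + 1 * hyp_poly N" by simp_all
  hence "conic \<in> J" "hyp_poly N \<in> J" unfolding J_def by blast+
  from monomials_in_loewy_ideal[OF J.add J.mult this[unfolded conic_def hyp_poly_def] assms]
  have "ord_ideal (N + 3) \<subseteq> J"
    by (intro ord_ideal_subset_if_monomials J.series_ideal_axioms)
  thus ?thesis by (auto simp: genideal_hyp_class J_def)
qed

section \<open>The generalized Loewy length\<close>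

lemma system_of_parameters_singleton:
  assumes N: "N > 0" and as: "system_of_parameters (hyp_ring N) as"
  obtains \<alpha> where "as = [hyp_class N \<alpha>]" "\<alpha> \<in> ord_ideal 1"
proof -
  have "enat (length as) = 1" "set as \<subseteq> hyp_class N ` ord_ideal 1"
    using as krull_dim_hyp_ring[OF N] by (simp_all add: system_of_parameters_def max_ideal_conv)
  moreover from this(1) obtain a where "as = [a]"
    by (auto simp: one_enat_def length_Suc_conv)
  ultimately show thesis using that by auto
qed

lemma system_of_parameters_conic:
  assumes N: "N > 0" "\<not> 3 dvd N"
  shows "system_of_parameters (hyp_ring N) [hyp_class N conic]"
proof -
  let ?I = "genideal (hyp_ring N) {hyp_class N conic}"
  have "radical (hyp_ring N) ?I = hyp_class N ` ord_ideal 1"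
  proof
    show "radical (hyp_ring N) ?I \<subseteq> hyp_class N ` ord_ideal 1"
    proof
      fix a assume "a \<in> radical (hyp_ring N) ?I"
      then obtain \<alpha> k where a: "a = hyp_class N \<alpha>" and "hyp_class N (\<alpha> ^ k) \<in> ?I"
        by (auto simp: radical_def carrier_hyp_ring_eq)
      then obtain u v where "\<alpha> ^ k = u * conic + v * hyp_poly N" by (auto simp: genideal_hyp_class)
      moreover have "hyp_poly N \<in> ord_ideal 1"
        using hyp_poly_ord_ideal[of N] ord_ideal_antimono[of 1 "N + 2"] by auto
      ultimately have "\<alpha> ^ k \<in> ord_ideal 1"
        by (simp only: ord_ideal_add ord_ideal_mult_left conic_ord_ideal)
      hence "\<alpha> \<in> ord_ideal 1"
      proof (rule contrapos_pp)
        assume "\<alpha> \<notin> ord_ideal 1"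
        then obtain h where "h * \<alpha> = 1" using unit_if_notin_ord_ideal by blast
        hence "h ^ k * \<alpha> ^ k = 1" by (metis power_mult_distrib power_one)
        thus "\<alpha> ^ k \<notin> ord_ideal 1" using ord_ideal_mult_left one_notin_ord_ideal by metis
      qed
      thus "a \<in> hyp_class N ` ord_ideal 1" by (simp add: a)
    qed
    show "hyp_class N ` ord_ideal 1 \<subseteq> radical (hyp_ring N) ?I"
    proof safe
      fix \<alpha> assume "\<alpha> \<in> ord_ideal 1"
      hence "hyp_class N (\<alpha> ^ (N + 3)) \<in> ?I" using power_subset_conic[OF N(2)] ord_ideal_power by blast
      thus "hyp_class N \<alpha> \<in> radical (hyp_ring N) ?I"
        unfolding radical_def by (intro CollectI conjI exI[of _ "N + 3"]) simp_all
    qed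
  qed
  thus ?thesis
    using krull_dim_hyp_ring[OF N(1)] conic_ord_ideal
    by (simp add: system_of_parameters_def max_ideal_conv one_enat_def)
qed

lemma gen_loewy_length_hyp_ring:
  assumes N: "N > 0" "\<not> 3 dvd N"
  shows "gen_loewy_length (hyp_ring N) = N + 3"
  unfolding gen_loewy_length_def
proof (rule Least_equality)
  show "N + 3 \<ge> 1 \<and> (\<exists>as. system_of_parameters (hyp_ring N) as \<and>
      ideal_pow (hyp_ring N) (max_ideal (hyp_ring N)) (N + 3) \<subseteq> genideal (hyp_ring N) (set as))"
    using system_of_parameters_conic[OF N] power_subset_conic[OF N(2)]
    by (intro conjI exI[of _ "[hyp_class N conic]"]) (simp_all add: max_ideal_pow)
next
  fix n
  assume "n \<ge> 1 \<and> (\<exists>as. system_of_parameters (hyp_ring N) as \<and>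
      ideal_pow (hyp_ring N) (max_ideal (hyp_ring N)) n \<subseteq> genideal (hyp_ring N) (set as))"
  then obtain as where as: "system_of_parameters (hyp_ring N) as"
    "hyp_class N ` ord_ideal n \<subseteq> genideal (hyp_ring N) (set as)"
    by (auto simp: max_ideal_pow)
  obtain \<alpha> where \<alpha>: "as = [hyp_class N \<alpha>]" "\<alpha> \<in> ord_ideal 1"
    by (rule system_of_parameters_singleton[OF N(1) as(1)])
  obtain g where g: "g \<in> ord_ideal (N + 2)" "\<nexists>u v. g = u * \<alpha> + v * hyp_poly N"
    using power_not_in_parameter_ideal[OF N(1) \<alpha>(2)] by blast
  show "N + 3 \<le> n"
  proof (rule ccontr)
    assume "\<not> N + 3 \<le> n"
    hence "g \<in> ord_ideal n" using g(1) ord_ideal_antimono[of n "N + 2"] by auto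
    hence "hyp_class N g \<in> genideal (hyp_ring N) {hyp_class N \<alpha>}" using as(2) \<alpha>(1) by auto
    thus False using g(2) by (simp add: genideal_hyp_class)
  qed
qed

theorem proposition3p12:
  fixes p m n :: nat
  defines "R \<equiv> hyp_ring (2 ^ n * p ^ m)"
    and "x \<equiv> hyp_x (2 ^ n * p ^ m)"
    and "y \<equiv> hyp_y (2 ^ n * p ^ m)"
  assumes "Factorial_Ring.prime p" and "p > 3"
    and "residue_primroot (p ^ 2) 2 \<or> m = 1 \<and> residue_primroot p 2"
  shows "enat (gen_loewy_length R) = ring_index R + 1 \<and>
    ring_index R + 1 = enat (2 ^ n * p ^ m + 3) \<and>
    ideal_pow R (genideal R {x, y}) (2 ^ n * p ^ m + 3)
      \<subseteq> genideal R {x \<otimes>\<^bsub>R\<^esub> x \<oplus>\<^bsub>R\<^esub> x \<otimes>\<^bsub>R\<^esub> y \<oplus>\<^bsub>R\<^esub> y \<otimes>\<^bsub>R\<^esub> y}"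
proof -
  define N where "N = 2 ^ n * p ^ m"
  have N: "N > 0" using \<open>p > 3\<close> by (simp add: N_def)
  have three: "\<not> 3 dvd N"
  proof
    have prime3: "Factorial_Ring.prime (3::nat)" by simp
    assume "3 dvd N"
    hence "3 dvd (2::nat) ^ n \<or> 3 dvd p ^ m" unfolding N_def prime_dvd_mult_iff[OF prime3] .
    hence "3 dvd (2::nat) \<or> 3 dvd p" using prime_dvd_power[OF prime3] by blast
    hence "3 dvd p" by auto
    hence "3 = p" using primes_dvd_imp_eq[OF prime3 \<open>Factorial_Ring.prime p\<close>] by blast
    thus False using \<open>p > 3\<close> by simp
  qed
  have xy: "x = hyp_class N X_ser" "y = hyp_class N Y_ser"
    by (simp_all add: x_def y_def hyp_x_def hyp_y_def hyp_class_def N_def)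
  have R: "R = hyp_ring N" by (simp add: R_def N_def)
  have "x \<otimes>\<^bsub>R\<^esub> x \<oplus>\<^bsub>R\<^esub> x \<otimes>\<^bsub>R\<^esub> y \<oplus>\<^bsub>R\<^esub> y \<otimes>\<^bsub>R\<^esub> y = hyp_class N conic"
    unfolding xy R hyp_class_hom conic_def power2_eq_square ..
  moreover have "genideal R {x, y} = max_ideal (hyp_ring N)"
    unfolding max_ideal_hyp_ring(2) by (simp add: R x_def y_def N_def)
  ultimately have "ideal_pow R (genideal R {x, y}) (N + 3)
      \<subseteq> genideal R {x \<otimes>\<^bsub>R\<^esub> x \<oplus>\<^bsub>R\<^esub> x \<otimes>\<^bsub>R\<^esub> y \<oplus>\<^bsub>R\<^esub> y \<otimes>\<^bsub>R\<^esub> y}"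
    using power_subset_conic[OF three] by (simp add: R max_ideal_pow)
  moreover have "ring_index R + 1 = enat (N + 3)"
    unfolding R ring_index_hyp_ring[OF N] by (simp add: one_enat_def)
  moreover have "gen_loewy_length R = N + 3"
    unfolding R by (rule gen_loewy_length_hyp_ring[OF N three])
  ultimately show ?thesis unfolding N_def by simp
qed

end
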